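(* Let $K$ be a valued field of equi-characteristic $0$, considered as a structure in a language $\mathcal L\supset\{+,\cdot,\mathcal O_K\}$, such that $\mathrm{Th}(K)$ is $1$-h-minimal, and let $f\colon K\to K$ be a definable (with parameters) function. Then the strict derivative of $f$ exists almost everywhere, i.e., the set of $x\in K$ such that the strict derivative of $f$ does not exist at $x$ is finite.
   Context: Valued fields: valuations are arbitrary non-trivial Krull valuations. $K$ has valuation ring $\mathcal O_K\subsetneq K$; equi-characteristic $0$ means that $K$ and its residue field have characteristic $0$. The value group is written multiplicatively, $\Gamma_K^\times=K^\times/\mathcal O_K^\times$, $\Gamma_K=\Gamma_K^\times\cup\{0\}$, with valuation $|\cdot|\colon K\to\Gamma_K$, $|0|=0$, ordered so that $\mathcal O_K=\{x:|x|\le 1\}$. Strict derivative: the strict derivative of $f\colon K\to K$ exists at $x\in K$ if there is $a\in K$ such that for each $\varepsilon\in\Gamma_K^\times$ there exists $\delta\in\Gamma_K^\times$ such that for all $y_1\neq y_2$ in $K$ with $|x-y_i|<\delta$ for $i=1,2$, one has $\left|\frac{f(y_1)-f(y_2)}{y_1-y_2}-a\right|<\varepsilon$. Leading terms: for $\lambda\le 1$ in $\Gamma_K^\times$ let $\mathrm{RV}_\lambda=K^\times/(1+\{x:|x|<\lambda\})\ \cup\{0\}$ and let $\mathrm{rv}_\lambda\colon K\to\mathrm{RV}_\lambda$ be the quotient map on $K^\times$ extended by $0\mapsto 0$. Write $\mathrm{RV}=\mathrm{RV}_1$. Elements of $\mathrm{RV}_\lambda$ are imaginary elements and may be used as parameters.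 "$A$-definable" means definable with parameters from $A$. Preparation: a finite non-empty set $C\subset K$ $\lambda$-prepares $X\subset K$ if whether $x\in K$ lies in $X$ depends only on the tuple $(\mathrm{rv}_\lambda(x-c))_{c\in C}$. Hensel minimality: for $\ell\ge 0$ an integer or $\omega$, a theory $\mathcal T$ of valued fields of equi-characteristic $0$ in a language containing $\{+,\cdot,\mathcal O_K\}$ is $\ell$-h-minimal if for every model $K\models\mathcal T$, every $\lambda\le1$ in $\Gamma_K^\times$, every $A\subset K$ and every $A'\subset\mathrm{RV}_\lambda$ with $\#A'\le\ell$, every $(A\cup\mathrm{RV}\cup A')$-definable set $X\subset K$ can be $\lambda$-prepared by a finite $A$-definable set $C\subset K$. *)

theory Defs
  imports
    "HOL-Algebra.Subrings"
    "HOL-Algebra.QuotRing"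
    "HOL-Library.Extended_Nat"
    "HOL-Library.Countable_Set"
begin

section \<open>First-order languages and structures\<close>

text \<open>
  A one-sorted language whose function (relation) symbols are all the elements of the type
  \<open>'f\<close> (\<open>'r\<close>), with three distinguished symbols for \<open>+\<close>, \<open>\<cdot>\<close> and \<open>\<O>\<close>.
\<close>

record ('f, 'r) lang =
  farity :: "'f \<Rightarrow> nat"
  rarity :: "'r \<Rightarrow> nat"
  plus_sym :: 'f
  times_sym :: 'f
  vring_sym :: 'r

definition vf_language :: "('f, 'r) lang \<Rightarrow> bool" where
  "vf_language L \<longleftrightarrow>
     farity L (plus_sym L) = 2 \<and> farity L (times_sym L) = 2 \<and> rarity L (vring_sym L) = 1"

datatype 'f tm = Var nat | Fun 'f "'f tm list"

datatype ('f, 'r) fm =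
    Eq "'f tm" "'f tm"
  | Rel 'r "'f tm list"
  | Neg "('f, 'r) fm"
  | And "('f, 'r) fm" "('f, 'r) fm"
  | Ex nat "('f, 'r) fm"

fun tm_vars :: "'f tm \<Rightarrow> nat set" where
  "tm_vars (Var i) = {i}"
| "tm_vars (Fun f ts) = (\<Union>t\<in>set ts. tm_vars t)"

fun fm_vars :: "('f, 'r) fm \<Rightarrow> nat set" where
  "fm_vars (Eq s t) = tm_vars s \<union> tm_vars t"
| "fm_vars (Rel r ts) = (\<Union>t\<in>set ts. tm_vars t)"
| "fm_vars (Neg p) = fm_vars p"
| "fm_vars (And p q) = fm_vars p \<union> fm_vars q"
| "fm_vars (Ex i p) = fm_vars p - {i}"

fun wf_tm :: "('f, 'r) lang \<Rightarrow> 'f tm \<Rightarrow> bool" where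
  "wf_tm L (Var i) \<longleftrightarrow> True"
| "wf_tm L (Fun f ts) \<longleftrightarrow> length ts = farity L f \<and> (\<forall>t\<in>set ts. wf_tm L t)"

fun wf_fm :: "('f, 'r) lang \<Rightarrow> ('f, 'r) fm \<Rightarrow> bool" where
  "wf_fm L (Eq s t) \<longleftrightarrow> wf_tm L s \<and> wf_tm L t"
| "wf_fm L (Rel r ts) \<longleftrightarrow> length ts = rarity L r \<and> (\<forall>t\<in>set ts. wf_tm L t)"
| "wf_fm L (Neg p) \<longleftrightarrow> wf_fm L p"
| "wf_fm L (And p q) \<longleftrightarrow> wf_fm L p \<and> wf_fm L q"
| "wf_fm L (Ex i p) \<longleftrightarrow> wf_fm L p"

record ('f, 'r, 'a) struct =
  univ :: "'a set"
  fint :: "'f \<Rightarrow> 'a list \<Rightarrow> 'a"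
  rint :: "'r \<Rightarrow> 'a list \<Rightarrow> bool"

definition tuples :: "('f, 'r, 'a) struct \<Rightarrow> nat \<Rightarrow> 'a list set" where
  "tuples M n = {xs. length xs = n \<and> set xs \<subseteq> univ M}"

definition is_structure :: "('f, 'r) lang \<Rightarrow> ('f, 'r, 'a) struct \<Rightarrow> bool" where
  "is_structure L M \<longleftrightarrow>
     univ M \<noteq> {} \<and> (\<forall>f. \<forall>xs\<in>tuples M (farity L f). fint M f xs \<in> univ M)"

fun eval :: "('f, 'r, 'a) struct \<Rightarrow> (nat \<Rightarrow> 'a) \<Rightarrow> 'f tm \<Rightarrow> 'a" where
  "eval M e (Var i) = e i"
| "eval M e (Fun f ts) = fint M f (map (eval M e) ts)"

fun sat :: "('f, 'r, 'a) struct \<Rightarrow> (nat \<Rightarrow> 'a) \<Rightarrow> ('f, 'r) fm \<Rightarrow> bool" where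
  "sat M e (Eq s t) \<longleftrightarrow> eval M e s = eval M e t"
| "sat M e (Rel r ts) \<longleftrightarrow> rint M r (map (eval M e) ts)"
| "sat M e (Neg p) \<longleftrightarrow> \<not> sat M e p"
| "sat M e (And p q) \<longleftrightarrow> sat M e p \<and> sat M e q"
| "sat M e (Ex i p) \<longleftrightarrow> (\<exists>a\<in>univ M. sat M (e(i := a)) p)"

definition sentence :: "('f, 'r) lang \<Rightarrow> ('f, 'r) fm \<Rightarrow> bool" where
  "sentence L p \<longleftrightarrow> wf_fm L p \<and> fm_vars p = {}"

definition holds :: "('f, 'r, 'a) struct \<Rightarrow> ('f, 'r) fm \<Rightarrow> bool" where
  "holds M p \<longleftrightarrow> (\<forall>e. range e \<subseteq> univ M \<longrightarrow> sat M e p)"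

definition Th :: "('f, 'r) lang \<Rightarrow> ('f, 'r, 'a) struct \<Rightarrow> ('f, 'r) fm set" where
  "Th L M = {p. sentence L p \<and> holds M p}"

definition is_model :: "('f, 'r) lang \<Rightarrow> ('f, 'r, 'a) struct \<Rightarrow> ('f, 'r) fm set \<Rightarrow> bool" where
  "is_model L M T \<longleftrightarrow> is_structure L M \<and> (\<forall>p\<in>T. holds M p)"


section \<open>Definable sets\<close>

text \<open>
  The variables \<open>0, \<dots>, n - 1\<close> range over the points of the definable set; any other free
  variable is a parameter.
\<close>

definition definable ::
  "('f, 'r) lang \<Rightarrow> ('f, 'r, 'a) struct \<Rightarrow> 'a set \<Rightarrow> nat \<Rightarrow> 'a list set \<Rightarrow> bool" where
  "definable L M A n X \<longleftrightarrow>
     (\<exists>p e. wf_fm L p \<and> (\<forall>i\<in>fm_vars p. n \<le> i \<longrightarrow> e i \<in> A) \<and>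
        X = {xs \<in> tuples M n. sat M (\<lambda>i. if i < n then xs ! i else e i) p})"

text \<open>
  Imaginary sorts: for every parameter-free definable equivalence relation \<open>E\<close> on a
  (necessarily parameter-free definable) set of \<open>n\<close>-tuples, the classes of \<open>E\<close> form a sort.
  Formulas with imaginary variables are the formulas of the resulting many-sorted structure
  (``\<open>M\<close>-eq''): \<open>Proj E ts k\<close> says that the projection of the tuple \<open>ts\<close> to the sort \<open>E\<close> equals
  the \<open>k\<close>-th variable of sort \<open>E\<close>.
\<close>

type_synonym 'a eqsort = "('a list \<times> 'a list) set"

definition is_eqsort :: "('f, 'r) lang \<Rightarrow> ('f, 'r, 'a) struct \<Rightarrow> 'a eqsort \<Rightarrow> bool" where
  "is_eqsort L M E \<longleftrightarrow>
     (\<exists>n. E \<subseteq> tuples M n \<times> tuples M n \<and> equiv (Domain E) E \<and>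
        definable L M {} (2 * n) {xs @ ys | xs ys. (xs, ys) \<in> E})"

definition imaginaries :: "'a eqsort \<Rightarrow> 'a list set set" where
  "imaginaries E = Domain E // E"

datatype ('f, 'r, 'a) eqfm =
    Home "('f, 'r) fm"
  | Proj "'a eqsort" "'f tm list" nat
  | ImEq "'a eqsort" nat nat
  | QNeg "('f, 'r, 'a) eqfm"
  | QAnd "('f, 'r, 'a) eqfm" "('f, 'r, 'a) eqfm"
  | QEx nat "('f, 'r, 'a) eqfm"
  | QExIm "'a eqsort" nat "('f, 'r, 'a) eqfm"

fun wf_eqfm :: "('f, 'r) lang \<Rightarrow> ('f, 'r, 'a) struct \<Rightarrow> ('f, 'r, 'a) eqfm \<Rightarrow> bool" where
  "wf_eqfm L M (Home p) \<longleftrightarrow> wf_fm L p"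
| "wf_eqfm L M (Proj E ts k) \<longleftrightarrow> is_eqsort L M E \<and> (\<forall>t\<in>set ts. wf_tm L t)"
| "wf_eqfm L M (ImEq E j k) \<longleftrightarrow> is_eqsort L M E"
| "wf_eqfm L M (QNeg p) \<longleftrightarrow> wf_eqfm L M p"
| "wf_eqfm L M (QAnd p q) \<longleftrightarrow> wf_eqfm L M p \<and> wf_eqfm L M q"
| "wf_eqfm L M (QEx i p) \<longleftrightarrow> wf_eqfm L M p"
| "wf_eqfm L M (QExIm E k p) \<longleftrightarrow> is_eqsort L M E \<and> wf_eqfm L M p"

fun home_vars :: "('f, 'r, 'a) eqfm \<Rightarrow> nat set" where
  "home_vars (Home p) = fm_vars p"
| "home_vars (Proj E ts k) = (\<Union>t\<in>set ts. tm_vars t)"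
| "home_vars (ImEq E j k) = {}"
| "home_vars (QNeg p) = home_vars p"
| "home_vars (QAnd p q) = home_vars p \<union> home_vars q"
| "home_vars (QEx i p) = home_vars p - {i}"
| "home_vars (QExIm E k p) = home_vars p"

fun im_vars :: "('f, 'r, 'a) eqfm \<Rightarrow> ('a eqsort \<times> nat) set" where
  "im_vars (Home p) = {}"
| "im_vars (Proj E ts k) = {(E, k)}"
| "im_vars (ImEq E j k) = {(E, j), (E, k)}"
| "im_vars (QNeg p) = im_vars p"
| "im_vars (QAnd p q) = im_vars p \<union> im_vars q"
| "im_vars (QEx i p) = im_vars p"
| "im_vars (QExIm E k p) = im_vars p - {(E, k)}"

fun eqsat ::
  "('f, 'r, 'a) struct \<Rightarrow> (nat \<Rightarrow> 'a) \<Rightarrow> ('a eqsort \<times> nat \<Rightarrow> 'a list set) \<Rightarrow>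
   ('f, 'r, 'a) eqfm \<Rightarrow> bool" where
  "eqsat M e g (Home p) \<longleftrightarrow> sat M e p"
| "eqsat M e g (Proj E ts k) \<longleftrightarrow>
     map (eval M e) ts \<in> Domain E \<and> E `` {map (eval M e) ts} = g (E, k)"
| "eqsat M e g (ImEq E j k) \<longleftrightarrow> g (E, j) = g (E, k)"
| "eqsat M e g (QNeg p) \<longleftrightarrow> \<not> eqsat M e g p"
| "eqsat M e g (QAnd p q) \<longleftrightarrow> eqsat M e g p \<and> eqsat M e g q"
| "eqsat M e g (QEx i p) \<longleftrightarrow> (\<exists>a\<in>univ M. eqsat M (e(i := a)) g p)"
| "eqsat M e g (QExIm E k p) \<longleftrightarrow> (\<exists>c\<in>imaginaries E. eqsat M e (g((E, k) := c)) p)"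

text \<open>
  \<open>X\<close> is definable with parameters from the set \<open>A\<close> of field elements and the set \<open>B\<close> of
  imaginary elements.
\<close>

definition eq_definable ::
  "('f, 'r) lang \<Rightarrow> ('f, 'r, 'a) struct \<Rightarrow> 'a set \<Rightarrow> 'a list set set \<Rightarrow> 'a set \<Rightarrow> bool" where
  "eq_definable L M A B X \<longleftrightarrow>
     (\<exists>p e g. wf_eqfm L M p \<and>
        (\<forall>i\<in>home_vars p. i \<noteq> 0 \<longrightarrow> e i \<in> A) \<and>
        (\<forall>(E, k)\<in>im_vars p. g (E, k) \<in> B \<inter> imaginaries E) \<and>
        X = {x \<in> univ M. eqsat M (e(0 := x)) g p})"


section \<open>Valued fields\<close>

definition ring_of :: "('f, 'r) lang \<Rightarrow> ('f, 'r, 'a) struct \<Rightarrow> 'a ring" where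
  "ring_of L M =
     (let add = (\<lambda>x y. fint M (plus_sym L) [x, y]);
          mul = (\<lambda>x y. fint M (times_sym L) [x, y])
      in \<lparr>carrier = univ M,
          mult = mul,
          one = (THE u. u \<in> univ M \<and> (\<forall>x\<in>univ M. mul u x = x \<and> mul x u = x)),
          zero = (THE z. z \<in> univ M \<and> (\<forall>x\<in>univ M. add z x = x \<and> add x z = x)),
          add = add\<rparr>)"

definition vring :: "('f, 'r) lang \<Rightarrow> ('f, 'r, 'a) struct \<Rightarrow> 'a set" where
  "vring L M = {x \<in> univ M. rint M (vring_sym L) [x]}"

definition vring_units :: "('f, 'r) lang \<Rightarrow> ('f, 'r, 'a) struct \<Rightarrow> 'a set" where
  "vring_units L M = Units (ring_of L M\<lparr>carrier := vring L M\<rparr>)"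

definition residue_field :: "('f, 'r) lang \<Rightarrow> ('f, 'r, 'a) struct \<Rightarrow> 'a set ring" where
  "residue_field L M =
     (ring_of L M\<lparr>carrier := vring L M\<rparr>) Quot (vring L M - vring_units L M)"

definition char_zero :: "('a, 'b) ring_scheme \<Rightarrow> bool" where
  "char_zero R \<longleftrightarrow> (\<forall>n::nat. n > 0 \<longrightarrow> [n] \<cdot>\<^bsub>R\<^esub> \<one>\<^bsub>R\<^esub> \<noteq> \<zero>\<^bsub>R\<^esub>)"

definition valued_field :: "('f, 'r) lang \<Rightarrow> ('f, 'r, 'a) struct \<Rightarrow> bool" where
  "valued_field L M \<longleftrightarrow>
     field (ring_of L M) \<and> subring (vring L M) (ring_of L M) \<and> vring L M \<noteq> univ M \<and>
     (\<forall>x\<in>univ M - {\<zero>\<^bsub>ring_of L M\<^esub>}. x \<in> vring L M \<or> inv\<^bsub>ring_of L M\<^esub> x \<in> vring L M)"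

definition equichar0_valued_field :: "('f, 'r) lang \<Rightarrow> ('f, 'r, 'a) struct \<Rightarrow> bool" where
  "equichar0_valued_field L M \<longleftrightarrow>
     valued_field L M \<and> char_zero (ring_of L M) \<and> char_zero (residue_field L M)"

text \<open>
  The value of a nonzero element is its coset modulo the units of the valuation ring; the same
  formula gives the value \<open>{0}\<close> of \<open>0\<close>, which plays the role of the zero of the value group.
\<close>

definition vabs :: "('f, 'r) lang \<Rightarrow> ('f, 'r, 'a) struct \<Rightarrow> 'a \<Rightarrow> 'a set" where
  "vabs L M x = {x \<otimes>\<^bsub>ring_of L M\<^esub> u | u. u \<in> vring_units L M}"

definition value_group :: "('f, 'r) lang \<Rightarrow> ('f, 'r, 'a) struct \<Rightarrow> 'a set set" where
  "value_group L M = vabs L M ` (univ M - {\<zero>\<^bsub>ring_of L M\<^esub>})"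

definition vle :: "('f, 'r) lang \<Rightarrow> ('f, 'r, 'a) struct \<Rightarrow> 'a set \<Rightarrow> 'a set \<Rightarrow> bool" where
  "vle L M \<gamma> \<delta> \<longleftrightarrow> (\<exists>x\<in>\<gamma>. \<exists>y\<in>\<delta>. \<exists>c\<in>vring L M. x = c \<otimes>\<^bsub>ring_of L M\<^esub> y)"

definition vless :: "('f, 'r) lang \<Rightarrow> ('f, 'r, 'a) struct \<Rightarrow> 'a set \<Rightarrow> 'a set \<Rightarrow> bool" where
  "vless L M \<gamma> \<delta> \<longleftrightarrow> vle L M \<gamma> \<delta> \<and> \<gamma> \<noteq> \<delta>"

definition vone :: "('f, 'r) lang \<Rightarrow> ('f, 'r, 'a) struct \<Rightarrow> 'a set" where
  "vone L M = vabs L M \<one>\<^bsub>ring_of L M\<^esub>"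


section \<open>Leading terms and Hensel minimality\<close>

text \<open>Again the coset formula yields \<open>{0}\<close> for \<open>x = 0\<close>, which is the added element \<open>0\<close>.\<close>

definition rv :: "('f, 'r) lang \<Rightarrow> ('f, 'r, 'a) struct \<Rightarrow> 'a set \<Rightarrow> 'a \<Rightarrow> 'a set" where
  "rv L M \<rho> x = {x \<otimes>\<^bsub>ring_of L M\<^esub> (\<one>\<^bsub>ring_of L M\<^esub> \<oplus>\<^bsub>ring_of L M\<^esub> y) | y.
                   y \<in> univ M \<and> vless L M (vabs L M y) \<rho>}"

definition RV :: "('f, 'r) lang \<Rightarrow> ('f, 'r, 'a) struct \<Rightarrow> 'a set \<Rightarrow> 'a set set" where
  "RV L M \<rho> = rv L M \<rho> ` univ M"

text \<open>
  The cosets making up \<open>RV\<close> for a fixed \<open>\<rho>\<close> are in general only definable with a parameter for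
  \<open>\<rho>\<close>.  As an imaginary element, \<open>\<xi>\<close> is therefore the class of the pairs \<open>(x, l)\<close> with
  \<open>rv x = \<xi>\<close> and \<open>\<bar>l\<bar> = \<rho>\<close>, for the parameter-free definable relation on
  \<open>{(x, l). 0 < \<bar>l\<bar> \<le> 1}\<close> that identifies \<open>(x, l)\<close> and \<open>(x', l')\<close> if \<open>\<bar>l\<bar> = \<bar>l'\<bar>\<close> and \<open>x, x'\<close>
  have the same leading term with respect to that value.  Recall that \<open>\<xi>\<close> and \<open>\<rho>\<close> are cosets,
  i.e. sets of field elements.
\<close>

definition rv_imag :: "'a set \<Rightarrow> 'a set \<Rightarrow> 'a list set" where
  "rv_imag \<rho> \<xi> = {[x, l] | x l. x \<in> \<xi> \<and> l \<in> \<rho>}"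

definition prepares ::
  "('f, 'r) lang \<Rightarrow> ('f, 'r, 'a) struct \<Rightarrow> 'a set \<Rightarrow> 'a set \<Rightarrow> 'a set \<Rightarrow> bool" where
  "prepares L M \<rho> C X \<longleftrightarrow>
     finite C \<and> C \<noteq> {} \<and> C \<subseteq> univ M \<and>
     (\<forall>x\<in>univ M. \<forall>y\<in>univ M.
        (\<forall>c\<in>C. rv L M \<rho> (x \<ominus>\<^bsub>ring_of L M\<^esub> c) = rv L M \<rho> (y \<ominus>\<^bsub>ring_of L M\<^esub> c)) \<longrightarrow>
        (x \<in> X \<longleftrightarrow> y \<in> X))"

definition card_le :: "'b set \<Rightarrow> enat \<Rightarrow> bool" where
  "card_le S l \<longleftrightarrow> (case l of enat n \<Rightarrow> finite S \<and> card S \<le> n | \<infinity> \<Rightarrow> countable S)"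

text \<open>
  \<open>l\<close>-h-minimality of a theory \<open>T\<close>, where \<open>\<infinity>\<close> stands for \<open>\<omega>\<close> and the models of \<open>T\<close> are those
  whose universe is a subset of the type \<open>'u\<close>.  By the downward Loewenheim-Skolem theorem the
  notion does not depend on \<open>'u\<close> as soon as \<open>'u\<close> has at least as many elements as there are
  formulas: a set that cannot be prepared is defined with finitely many parameters, and still
  cannot be prepared in an elementary substructure containing (representatives of) these.
\<close>

definition h_minimal ::
  "'u itself \<Rightarrow> ('f, 'r) lang \<Rightarrow> enat \<Rightarrow> ('f, 'r) fm set \<Rightarrow> bool" where
  "h_minimal U L l T \<longleftrightarrow>
     (\<forall>M :: ('f, 'r, 'u) struct. is_model L M T \<longrightarrow>
        equichar0_valued_field L M \<and>
        (\<forall>\<rho>\<in>value_group L M. \<forall>A A' X.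
           vle L M \<rho> (vone L M) \<and> A \<subseteq> univ M \<and> A' \<subseteq> RV L M \<rho> \<and> card_le A' l \<and>
           eq_definable L M A (rv_imag (vone L M) ` RV L M (vone L M) \<union> rv_imag \<rho> ` A') X
           \<longrightarrow> (\<exists>C. definable L M A 1 ((\<lambda>c. [c]) ` C) \<and> prepares L M \<rho> C X)))"


section \<open>Strict derivatives\<close>

definition strictly_differentiable ::
  "('f, 'r) lang \<Rightarrow> ('f, 'r, 'a) struct \<Rightarrow> ('a \<Rightarrow> 'a) \<Rightarrow> 'a \<Rightarrow> bool" where
  "strictly_differentiable L M f x \<longleftrightarrow>
     (let R = ring_of L M in
      \<exists>a\<in>univ M. \<forall>\<epsilon>\<in>value_group L M. \<exists>\<delta>\<in>value_group L M. \<forall>y1\<in>univ M. \<forall>y2\<in>univ M.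
        y1 \<noteq> y2 \<and> vless L M (vabs L M (x \<ominus>\<^bsub>R\<^esub> y1)) \<delta> \<and> vless L M (vabs L M (x \<ominus>\<^bsub>R\<^esub> y2)) \<delta> \<longrightarrow>
        vless L M (vabs L M (((f y1 \<ominus>\<^bsub>R\<^esub> f y2) \<otimes>\<^bsub>R\<^esub> inv\<^bsub>R\<^esub> (y1 \<ominus>\<^bsub>R\<^esub> y2)) \<ominus>\<^bsub>R\<^esub> a)) \<epsilon>)"

end

theory Submission
  imports Defs
begin

text \<open>
  Passing to an ultrapower indexed by finite lists of elements of \<open>K\<close> turns 1-h-minimality into
  uniform preparation: for a \<open>K\<close>-definable relation \<open>\<phi>\<close> there is a single finite \<open>C \<subseteq> K\<close> that
  \<open>\<lambda>\<close>-prepares \<open>{x. \<exists>b' \<in> \<xi>. \<phi> x b'}\<close> for all \<open>\<lambda> \<le> 1\<close> and \<open>\<xi> \<in> RV\<^sub>\<lambda>\<close> simultaneously.  A failing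
  \<open>\<xi>\<close> for every \<open>C\<close> would give an imaginary element of the ultrapower whose fibre is prepared by a
  finite \<open>K\<close>-definable set; but such a set consists of elements of \<open>K\<close>.

  Applied to the fibres of \<open>g\<close>, uniform preparation bounds \<open>\<bar>g x - g y\<bar>\<close> by
  \<open>\<bar>x - y\<bar> \<bar>g x\<bar> / min\<^sub>c \<bar>x - c\<bar>\<close>; applied to the images of balls \<open>rv\<^sub>\<lambda> (x - c) = \<xi>\<close> under \<open>f\<close>, it shows
  that these contain large balls.  On most open balls of radius \<open>\<bar>r\<bar>\<close> inside a closed ball of the
  same radius the two bounds match, and \<open>f\<close> multiplies all distances by one constant.

  For small \<open>h\<close>, the difference quotient \<open>u x = (f (x + h) - f x) / h\<close> varies by less than \<open>\<epsilon>\<close> on some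
  ball of radius much larger than \<open>\<bar>h\<bar>\<close>.  There the function \<open>f x - a x\<close> with \<open>a = u x\<^sub>0\<close> scales
  distances by the constant \<open>\<bar>u x - a\<bar> < \<epsilon>\<close>, so every ball contains a point near which all difference
  quotients are \<open>\<epsilon>\<close>-close to \<open>a\<close>.  Preparing the exceptional sets for all \<open>\<epsilon>\<close> at once leaves finitely
  many points.  At the others the difference quotients form a Cauchy filter, and its limit exists
  because the definable nested balls of candidates all meet a finite set preparing them.
\<close>

section \<open>Renaming variables and definability with parameters\<close>

lemma eval_cong: "(\<And>i. i \<in> tm_vars t \<Longrightarrow> e i = e' i) \<Longrightarrow> eval M e t = eval M e' t"
proof (induction t)
  case (Fun f ts)
  then have "map (eval M e) ts = map (eval M e') ts" by (intro map_cong) auto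
  then show ?case by (simp del: map_eq_conv)
qed simp

lemma map_eval_cong:
  "(\<And>i. i \<in> (\<Union>t\<in>set ts. tm_vars t) \<Longrightarrow> e i = e' i) \<Longrightarrow> map (eval M e) ts = map (eval M e') ts"
  by (intro map_cong refl eval_cong) auto

lemma sat_cong: "(\<And>i. i \<in> fm_vars p \<Longrightarrow> e i = e' i) \<Longrightarrow> sat M e p \<longleftrightarrow> sat M e' p"
proof (induction p arbitrary: e e')
  case (Eq s t)
  then show ?case using eval_cong[of s e e' M] eval_cong[of t e e' M] by simp
next
  case (Rel r ts)
  then have "map (eval M e) ts = map (eval M e') ts" by (intro map_eval_cong) simp
  then show ?case by (simp del: map_eq_conv)
next
  case (Neg p)
  then show ?case by (metis fm_vars.simps(3) sat.simps(3))
next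
  case (And p q)
  then have "sat M e p \<longleftrightarrow> sat M e' p" "sat M e q \<longleftrightarrow> sat M e' q" by (metis UnCI fm_vars.simps(4))+
  then show ?case by simp
next
  case (Ex i p)
  have "sat M (e(i := a)) p \<longleftrightarrow> sat M (e'(i := a)) p" for a
    using Ex.prems by (intro Ex.IH) auto
  then show ?case by simp
qed

fun rename_tm :: "(nat \<Rightarrow> nat) \<Rightarrow> 'f tm \<Rightarrow> 'f tm" where
  "rename_tm \<sigma> (Var i) = Var (\<sigma> i)"
| "rename_tm \<sigma> (Fun f ts) = Fun f (map (rename_tm \<sigma>) ts)"

fun rename_fm :: "(nat \<Rightarrow> nat) \<Rightarrow> ('f, 'r) fm \<Rightarrow> ('f, 'r) fm" where
  "rename_fm \<sigma> (Eq s t) = Eq (rename_tm \<sigma> s) (rename_tm \<sigma> t)"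
| "rename_fm \<sigma> (Rel r ts) = Rel r (map (rename_tm \<sigma>) ts)"
| "rename_fm \<sigma> (Neg p) = Neg (rename_fm \<sigma> p)"
| "rename_fm \<sigma> (And p q) = And (rename_fm \<sigma> p) (rename_fm \<sigma> q)"
| "rename_fm \<sigma> (Ex i p) = Ex (\<sigma> i) (rename_fm \<sigma> p)"

lemma wf_rename_tm [simp]: "wf_tm L (rename_tm \<sigma> t) \<longleftrightarrow> wf_tm L t"
  by (induction t) auto

lemma wf_rename_fm [simp]: "wf_fm L (rename_fm \<sigma> p) \<longleftrightarrow> wf_fm L p"
  by (induction p) auto

lemma eval_rename: "eval M e (rename_tm \<sigma> t) = eval M (\<lambda>i. e (\<sigma> i)) t"
proof (induction t)
  case (Fun f ts)
  then have "map (eval M e \<circ> rename_tm \<sigma>) ts = map (eval M (\<lambda>i. e (\<sigma> i))) ts" by simp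
  then show ?case by (simp del: map_eq_conv)
qed simp

text \<open>Bound variables are renamed together with the free ones. Injectivity rules out capture:
  updating an environment at \<open>\<sigma> i\<close> changes its composite with
  \<open>\<sigma>\<close> at \<open>i\<close> only.\<close>

lemma sat_rename: "inj \<sigma> \<Longrightarrow> sat M e (rename_fm \<sigma> p) \<longleftrightarrow> sat M (\<lambda>i. e (\<sigma> i)) p"
proof (induction p arbitrary: e)
  case (Rel r ts)
  have "map (eval M e \<circ> rename_tm \<sigma>) ts = map (eval M (\<lambda>i. e (\<sigma> i))) ts" by (simp add: eval_rename)
  then show ?case by (simp del: map_eq_conv)
next
  case (Ex i p)
  have "(\<lambda>j. (e(\<sigma> i := a)) (\<sigma> j)) = (\<lambda>j. e (\<sigma> j))(i := a)" for a
    using Ex.prems by (auto simp: fun_eq_iff inj_eq)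
  then show ?case using Ex by simp
qed (simp_all add: eval_rename)

text \<open>Definability with parameters of a predicate on environments: a formula sees the environment
  at the even variables and its parameters at the odd ones.\<close>

definition interleave :: "(nat \<Rightarrow> 'a) \<Rightarrow> (nat \<Rightarrow> 'a) \<Rightarrow> nat \<Rightarrow> 'a" where
  "interleave e q n = (if even n then e (n div 2) else q (n div 2))"

lemma interleave_simps [simp]:
  "interleave e q (2 * n) = e n" "interleave e q (Suc (2 * n)) = q n"
  "interleave e q 0 = e 0" "interleave e q (Suc 0) = q 0" "interleave e q 2 = e 1" "interleave e q 4 = e 2"
  by (simp_all add: interleave_def)

lemma interleave_cases: obtains k where "n = 2 * k" | k where "n = Suc (2 * k)"
  by (metis evenE oddE Suc_eq_plus1)

lemma interleave_cases': obtains "n = 0" | k where "n = 2 * Suc k" | k where "n = Suc (2 * k)"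
  by (metis interleave_cases mult_0_right not0_implies_Suc)

text \<open>Definability is attached to semantic predicates, so that closure under connectives and
  quantifiers is proved once and formulas need not be written out later. The sequence
  \<open>q\<close> supplies the parameters.\<close>

definition pdefinable ::
  "('f, 'r) lang \<Rightarrow> ('f, 'r, 'a) struct \<Rightarrow> ((nat \<Rightarrow> 'a) \<Rightarrow> bool) \<Rightarrow> bool" where
  "pdefinable L M P \<longleftrightarrow> (\<exists>p q. wf_fm L p \<and> range q \<subseteq> univ M \<and>
     (\<forall>e. range e \<subseteq> univ M \<longrightarrow> (P e \<longleftrightarrow> sat M (interleave e q) p)))"

lemma pdefinableI:
  assumes "wf_fm L p" "range q \<subseteq> univ M"
    "\<And>e. range e \<subseteq> univ M \<Longrightarrow> P e \<longleftrightarrow> sat M (interleave e q) p"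
  shows "pdefinable L M P"
  using assms unfolding pdefinable_def by blast

lemma pdefinable_cong:
  "pdefinable L M P \<Longrightarrow> (\<And>e. range e \<subseteq> univ M \<Longrightarrow> P e = Q e) \<Longrightarrow> pdefinable L M Q"
  unfolding pdefinable_def by (metis (no_types, lifting))

lemma pdefinable_not: "pdefinable L M P \<Longrightarrow> pdefinable L M (\<lambda>e. \<not> P e)"
proof -
  assume "pdefinable L M P"
  then obtain p q where "wf_fm L p" "range q \<subseteq> univ M"
    "\<And>e. range e \<subseteq> univ M \<Longrightarrow> P e \<longleftrightarrow> sat M (interleave e q) p"
    unfolding pdefinable_def by blast
  then show ?thesis by (intro pdefinableI[of L "Neg p" q]) simp_all
qed

lemma pdefinable_and:
  assumes "pdefinable L M P" "pdefinable L M Q"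
  shows "pdefinable L M (\<lambda>e. P e \<and> Q e)"
proof -
  obtain p1 q1 where 1: "wf_fm L p1" "range q1 \<subseteq> univ M"
    "\<And>e. range e \<subseteq> univ M \<Longrightarrow> P e \<longleftrightarrow> sat M (interleave e q1) p1"
    using assms(1) unfolding pdefinable_def by blast
  obtain p2 q2 where 2: "wf_fm L p2" "range q2 \<subseteq> univ M"
    "\<And>e. range e \<subseteq> univ M \<Longrightarrow> Q e \<longleftrightarrow> sat M (interleave e q2) p2"
    using assms(2) unfolding pdefinable_def by blast
  \<comment> \<open>\<open>s r\<close> fixes the environment variables and sends parameter
    \<open>k\<close> to parameter \<open>2 * k + r\<close>, so that both parameter sequences fit
    into \<open>interleave q1 q2\<close>.\<close>
  define s where "s r n = (if even n then n else Suc (2 * (2 * (n div 2) + r)))" for r n :: nat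
  have s0: "s r (2 * k) = 2 * k" and s1: "s r (Suc (2 * k)) = Suc (2 * (2 * k + r))" for r k
    by (simp_all add: s_def)
  have inj: "inj (s r)" for r
  proof (rule injI)
    fix n m assume "s r n = s r m"
    then show "n = m"
      by (cases n rule: interleave_cases; cases m rule: interleave_cases; simp add: s0 s1; presburger)
  qed
  have s: "interleave e (interleave q1 q2) (s 0 n) = interleave e q1 n"
    "interleave e (interleave q1 q2) (s (Suc 0) n) = interleave e q2 n" for e n
    by (cases n rule: interleave_cases; simp only: s0 s1 add_0_right add_Suc_right interleave_simps)+
  show ?thesis
  proof (rule pdefinableI[of L "And (rename_fm (s 0) p1) (rename_fm (s (Suc 0)) p2)" "interleave q1 q2"])
    show "range (interleave q1 q2) \<subseteq> univ M"
      using 1 2 by (auto simp: interleave_def)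
  qed (use 1 2 in \<open>simp_all add: sat_rename[OF inj] s\<close>)
qed

text \<open>As with de Bruijn indices, the quantified value is pushed in front of the
  environment.\<close>

lemma pdefinable_ex:
  assumes "pdefinable L M (\<lambda>e. P (e 0) (\<lambda>i. e (Suc i)))"
  shows "pdefinable L M (\<lambda>e. \<exists>x\<in>univ M. P x e)"
proof -
  obtain p q where p: "wf_fm L p" "range q \<subseteq> univ M"
    "\<And>e. range e \<subseteq> univ M \<Longrightarrow> P (e 0) (\<lambda>i. e (Suc i)) \<longleftrightarrow> sat M (interleave e q) p"
    using assms unfolding pdefinable_def by blast
  \<comment> \<open>Variable 1, the slot of parameter 0, becomes the bound variable; parameters move
    up by one and environment entries down by one. The filler \<open>q 0\<close> put into that slot
    is overwritten by the quantifier.\<close>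
  define s where "s n = (if n = 0 then 1 else if even n then n - 2 else n + 2)" for n :: nat
  have s0: "s 0 = 1" "s (2 * Suc k) = 2 * k" and s1: "s (Suc (2 * k)) = Suc (2 * Suc k)" for k
    by (simp_all add: s_def)
  have inj: "inj s"
  proof (rule injI)
    fix n m assume "s n = s m"
    then show "n = m"
      by (cases n rule: interleave_cases'; cases m rule: interleave_cases'; simp add: s0 s1 del: mult_Suc_right; presburger)
  qed
  have s: "((interleave e (case_nat (q 0) q))(1 := x)) (s n) = interleave (case_nat x e) q n" for e x n
  proof (cases n rule: interleave_cases')
    case 1
    then show ?thesis by (simp add: s0)
  next
    case (2 k)
    have "2 * k \<noteq> 1" by presburger
    then show ?thesis unfolding 2 s0 interleave_simps by simp
  next
    case (3 k)
    then show ?thesis unfolding 3 s1 by (simp del: mult_Suc_right)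
  qed
  show ?thesis
  proof (rule pdefinableI[of L "Ex 1 (rename_fm s p)" "case_nat (q 0) q"])
    show "range (case_nat (q 0) q) \<subseteq> univ M" using p(2) by (auto split: nat.split)
    fix e :: "nat \<Rightarrow> 'c" assume e: "range e \<subseteq> univ M"
    have "P x e \<longleftrightarrow> sat M (interleave (case_nat x e) q) p" if "x \<in> univ M" for x
    proof -
      have "range (case_nat x e) \<subseteq> univ M" using subsetD[OF e rangeI] that by (auto split: nat.split)
      from p(3)[OF this] show ?thesis by simp
    qed
    then show "(\<exists>x\<in>univ M. P x e) \<longleftrightarrow> sat M (interleave e (case_nat (q 0) q)) (Ex 1 (rename_fm s p))"
      by (simp add: sat_rename[OF inj] s del: One_nat_def fun_upd_apply)
  qed (use p in simp)
qed

lemma pdefinable_rename: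
  assumes "pdefinable L M P" "inj \<sigma>"
  shows "pdefinable L M (\<lambda>e. P (\<lambda>i. e (\<sigma> i)))"
proof -
  obtain p q where p: "wf_fm L p" "range q \<subseteq> univ M"
    "\<And>e. range e \<subseteq> univ M \<Longrightarrow> P e \<longleftrightarrow> sat M (interleave e q) p"
    using assms unfolding pdefinable_def by blast
  define s where "s n = (if even n then 2 * \<sigma> (n div 2) else n)" for n
  have s0: "s (2 * k) = 2 * \<sigma> k" and s1: "s (Suc (2 * k)) = Suc (2 * k)" for k
    by (simp_all add: s_def)
  have inj: "inj s"
  proof (rule injI)
    fix n m assume "s n = s m"
    then show "n = m"
      by (cases n rule: interleave_cases; cases m rule: interleave_cases;
          simp add: s0 s1 inj_eq[OF assms(2)]; presburger)
  qed
  have s: "interleave e q (s n) = interleave (\<lambda>i. e (\<sigma> i)) q n" for e n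
    by (cases n rule: interleave_cases) (simp_all add: s0 s1)
  show ?thesis
  proof (rule pdefinableI[of L "rename_fm s p" q])
    fix e :: "nat \<Rightarrow> 'c" assume e: "range e \<subseteq> univ M"
    then have "range (\<lambda>i. e (\<sigma> i)) \<subseteq> univ M" by auto
    from p(3)[OF this] show "P (\<lambda>i. e (\<sigma> i)) \<longleftrightarrow> sat M (interleave e q) (rename_fm s p)"
      by (simp add: sat_rename[OF inj] s)
  qed (use p in simp_all)
qed

lemma pdefinable_graph:
  assumes "definable L M (univ M) 2 {[x, f x] | x. x \<in> univ M}" "univ M \<noteq> {}"
  shows "pdefinable L M (\<lambda>e. e (Suc 0) = f (e 0))"
proof -
  obtain p d where p: "wf_fm L p" "\<forall>i\<in>fm_vars p. 2 \<le> i \<longrightarrow> d i \<in> univ M"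
    and eq: "{[x, f x] | x. x \<in> univ M} = {xs \<in> tuples M 2. sat M (\<lambda>i. if i < 2 then xs ! i else d i) p}"
    using assms(1) unfolding definable_def by blast
  obtain c where c: "c \<in> univ M" using assms(2) by blast
  \<comment> \<open>The assignment \<open>d\<close> is constrained only at parameters that occur in
    \<open>p\<close>; elsewhere it may leave the universe and is replaced by
    \<open>c\<close>.\<close>
  define q where "q i = (if d i \<in> univ M then d i else c)" for i
  \<comment> \<open>In \<open>definable\<close> the two coordinates are the variables 0 and 1 and
    the parameters start at 2; here the coordinates move to 0 and 2 and the parameters to odd
    variables.\<close>
  define s where "s i = (if i < 2 then 2 * i else Suc (2 * i))" for i :: nat
  have inj: "inj s"
  proof (rule injI)
    show "n = m" if "s n = s m" for n m
      using that unfolding s_def by (cases "n < 2"; cases "m < 2"; simp; presburger)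
  qed
  show ?thesis
  proof (rule pdefinableI[of L "rename_fm s p" q])
    show "range q \<subseteq> univ M" using c by (auto simp: q_def)
    fix e :: "nat \<Rightarrow> 'c" assume "range e \<subseteq> univ M"
    then have e: "e 0 \<in> univ M" "e (Suc 0) \<in> univ M" by auto
    have "e (Suc 0) = f (e 0) \<longleftrightarrow> [e 0, e (Suc 0)] \<in> {[x, f x] | x. x \<in> univ M}" using e by auto
    also have "\<dots> \<longleftrightarrow> sat M (\<lambda>i. if i < 2 then [e 0, e (Suc 0)] ! i else d i) p"
      unfolding eq using e by (simp add: tuples_def)
    also have "\<dots> \<longleftrightarrow> sat M (\<lambda>i. interleave e q (s i)) p"
    proof (rule sat_cong)
      fix i assume "i \<in> fm_vars p"
      then show "(if i < 2 then [e 0, e (Suc 0)] ! i else d i) = interleave e q (s i)"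
        using p(2) by (cases "i = 0"; cases "i = 1") (auto simp: s_def q_def)
    qed
    finally show "e (Suc 0) = f (e 0) \<longleftrightarrow> sat M (interleave e q) (rename_fm s p)"
      by (simp add: sat_rename[OF inj])
  qed (use p in simp)
qed

section \<open>Ultrapowers\<close>

definition ultrafilter :: "'i filter \<Rightarrow> bool" where
  "ultrafilter U \<longleftrightarrow> U \<noteq> bot \<and> (\<forall>P. eventually P U \<or> eventually (\<lambda>i. \<not> P i) U)"

text \<open>Zorn's lemma for the reversed order, smaller filters being finer. The infimum of a chain
  of proper filters is proper because every finite non-empty part of the chain has a least
  member.\<close>

lemma ex_ultrafilter:
  assumes "F \<noteq> (bot :: 'i filter)"
  shows "\<exists>U \<le> F. ultrafilter U"
proof -
  have "\<exists>U\<in>{U. U \<noteq> bot \<and> U \<le> F}. \<forall>U'\<in>{U. U \<noteq> bot \<and> U \<le> F}. U' \<le> U \<longrightarrow> U' = U"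
  proof (rule predicate_Zorn)
    show "partial_order_on {U. U \<noteq> bot \<and> U \<le> F} (relation_of (\<lambda>x y. y \<le> x) {U. U \<noteq> bot \<and> U \<le> F})"
      by (rule partial_order_on_relation_ofI) auto
    fix C assume C: "C \<in> Chains (relation_of (\<lambda>x y. y \<le> x) {U. U \<noteq> bot \<and> U \<le> F})"
    then have Cs: "C \<subseteq> {U. U \<noteq> bot \<and> U \<le> F}" and lin: "\<And>a b. a \<in> C \<Longrightarrow> b \<in> C \<Longrightarrow> a \<le> b \<or> b \<le> a"
      by (auto simp: Chains_def relation_of_def)
    show "\<exists>u\<in>{U. U \<noteq> bot \<and> U \<le> F}. \<forall>a\<in>C. u \<le> a"
    proof (cases "C = {}")
      case True
      then show ?thesis using assms by blast
    next
      case False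
      have min: "\<exists>m\<in>X. m \<le> Inf X" if "finite X" "X \<noteq> {}" "X \<subseteq> C" for X
        using that
      proof (induction X rule: finite_ne_induct)
        case (insert x X)
        then obtain m where m: "m \<in> X" "m \<le> Inf X" by auto
        then have "m \<le> x \<or> x \<le> m" using lin[of m x] insert by auto
        then show ?case
        proof
          assume "m \<le> x" then show ?thesis using m by auto
        next
          assume "x \<le> m" then have "x \<le> Inf X" using m by (meson order_trans)
          then show ?thesis by auto
        qed
      qed auto
      have ne: "top_class.top \<noteq> (bot :: 'i filter)" using assms by (metis bot_unique top_greatest)
      have "Inf C \<noteq> bot"
      proof (rule Inf_filter_not_bot)
        fix X assume "X \<subseteq> C" "finite X"
        show "Inf X \<noteq> bot"
        proof (cases "X = {}")
          case True
          then show ?thesis using ne by simp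
        next
          case False
          then obtain m where m: "m \<in> X" "m \<le> Inf X" using min \<open>X \<subseteq> C\<close> \<open>finite X\<close> by blast
          then have "m \<noteq> bot" using \<open>X \<subseteq> C\<close> Cs by auto
          then show ?thesis using m(2) by (metis bot_unique)
        qed
      qed
      moreover have "Inf C \<le> F"
      proof -
        obtain c where c: "c \<in> C" using False by auto
        then have "c \<le> F" using Cs by auto
        with Inf_lower[OF c] show ?thesis by (rule order_trans)
      qed
      ultimately show ?thesis by (intro bexI[of _ "Inf C"] ballI Inf_lower) simp_all
    qed
  qed
  then obtain U where U: "U \<noteq> bot" "U \<le> F"
    and max': "\<And>U'. U' \<noteq> bot \<Longrightarrow> U' \<le> F \<Longrightarrow> U' \<le> U \<Longrightarrow> U' = U"
    by blast
  have max: "U' = U" if "U' \<noteq> bot" "U' \<le> U" for U'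
    using max'[OF that(1) order_trans[OF that(2) U(2)] that(2)] .
  \<comment> \<open>By minimality, the restriction of \<open>U\<close> to \<open>{i. P i}\<close> is
    either improper, so that the complement is large, or equal to \<open>U\<close>.\<close>
  have "eventually P U \<or> eventually (\<lambda>i. \<not> P i) U" for P
  proof (cases "inf U (principal {i. P i}) = bot")
    case True
    then have "eventually (\<lambda>i. \<not> P i) U"
      using eventually_inf_principal[of "\<lambda>_. False" U "{i. P i}"] by (simp add: eventually_bot)
    then show ?thesis ..
  next
    case False
    then have "inf U (principal {i. P i}) = U" using max by simp
    then have "eventually P U" using eventually_inf_principal[of P U "{i. P i}"] by simp
    then show ?thesis ..
  qed
  then show ?thesis using U unfolding ultrafilter_def by blast
qed

lemma ultrafilter_not:
  assumes "ultrafilter U"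
  shows "eventually (\<lambda>i. \<not> P i) U \<longleftrightarrow> \<not> eventually P U"
proof -
  have "\<not> (eventually P U \<and> eventually (\<lambda>i. \<not> P i) U)"
  proof
    assume "eventually P U \<and> eventually (\<lambda>i. \<not> P i) U"
    then have "eventually (\<lambda>i. P i \<and> \<not> P i) U" by (simp only: eventually_conj_iff)
    then show False using assms by (simp add: ultrafilter_def eventually_False)
  qed
  then show ?thesis using assms unfolding ultrafilter_def by blast
qed

lemma ultrafilter_or:
  assumes "ultrafilter U"
  shows "eventually (\<lambda>i. P i \<or> Q i) U \<longleftrightarrow> eventually P U \<or> eventually Q U"
proof -
  have "eventually (\<lambda>i. P i \<or> Q i) U \<longleftrightarrow> \<not> eventually (\<lambda>i. \<not> P i \<and> \<not> Q i) U"
    using ultrafilter_not[OF assms, of "\<lambda>i. \<not> P i \<and> \<not> Q i"] by simp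
  then show ?thesis by (simp add: eventually_conj_iff ultrafilter_not[OF assms])
qed

lemma ultrafilter_finite:
  assumes "ultrafilter U" "finite S" "eventually (\<lambda>i. s i \<in> S) U"
  shows "\<exists>a\<in>S. eventually (\<lambda>i. s i = a) U"
  using assms(2,3)
proof (induction S rule: finite_induct)
  case empty
  then show ?case using assms(1) by (simp add: ultrafilter_def eventually_False)
next
  case (insert a S)
  then have "eventually (\<lambda>i. s i = a) U \<or> eventually (\<lambda>i. s i \<in> S) U"
    using ultrafilter_or[OF assms(1), of "\<lambda>i. s i = a" "\<lambda>i. s i \<in> S"] by simp
  then show ?case using insert by auto
qed

section \<open>The ultrapower of a structure and Los's theorem\<close>

locale ultrapower =
  fixes L :: "('f, 'r) lang" and K :: "('f, 'r, 'a) struct"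
    and U :: "'i filter" and j :: "('i \<Rightarrow> 'a) \<Rightarrow> 'u"
  assumes K: "is_structure L K" and U: "ultrafilter U" and inj_j: "inj j"
begin

definition seqs :: "('i \<Rightarrow> 'a) set" where
  "seqs = {s. range s \<subseteq> univ K}"

text \<open>The choice depends only on the equivalence class of \<open>s\<close>, so equivalent
  sequences get the same code. Coding by \<open>j\<close> places the ultrapower in the type
  \<open>'u\<close> over which the models in \<open>h_minimal\<close> range.\<close>

definition cls :: "('i \<Rightarrow> 'a) \<Rightarrow> 'u" where
  "cls s = j (SOME s'. s' \<in> seqs \<and> (\<forall>\<^sub>F i in U. s i = s' i))"

definition un :: "'u \<Rightarrow> 'i \<Rightarrow> 'a" where
  "un x = (SOME s. s \<in> seqs \<and> cls s = x)"

definition power :: "('f, 'r, 'u) struct" where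
  "power = \<lparr>univ = cls ` seqs,
     fint = (\<lambda>f xs. cls (\<lambda>i. fint K f (map (\<lambda>x. un x i) xs))),
     rint = (\<lambda>r xs. \<forall>\<^sub>F i in U. rint K r (map (\<lambda>x. un x i) xs))\<rparr>"

lemma seqsI: "(\<And>i. s i \<in> univ K) \<Longrightarrow> s \<in> seqs"
  by (auto simp: seqs_def)

lemma seqsD: "s \<in> seqs \<Longrightarrow> s i \<in> univ K"
  by (auto simp: seqs_def)

lemma cls_eqI:
  assumes "\<forall>\<^sub>F i in U. s i = t i"
  shows "cls s = cls t"
proof -
  have "(\<forall>\<^sub>F i in U. s i = s' i) \<longleftrightarrow> (\<forall>\<^sub>F i in U. t i = s' i)" for s'
    using assms by (intro eventually_subst) (auto elim: eventually_mono)
  then show ?thesis by (simp add: cls_def)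
qed

lemma cls_eq_iff:
  assumes "s \<in> seqs" "t \<in> seqs"
  shows "cls s = cls t \<longleftrightarrow> (\<forall>\<^sub>F i in U. s i = t i)"
proof
  assume eq: "cls s = cls t"
  let ?r = "\<lambda>s. SOME s'. s' \<in> seqs \<and> (\<forall>\<^sub>F i in U. s i = s' i)"
  have r: "\<forall>\<^sub>F i in U. s i = ?r s i" if "s \<in> seqs" for s
    using someI_ex[of "\<lambda>s'. s' \<in> seqs \<and> (\<forall>\<^sub>F i in U. s i = s' i)"] that by force
  have "?r s = ?r t" using eq inj_j unfolding cls_def by (rule injD[rotated])
  then show "\<forall>\<^sub>F i in U. s i = t i"
    using r[OF assms(1)] r[OF assms(2)] by (auto elim: eventually_elim2)
qed (rule cls_eqI)

lemma univ_power: "univ power = cls ` seqs"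
  by (simp add: power_def)

lemma cls_univ: "s \<in> seqs \<Longrightarrow> cls s \<in> univ power"
  by (simp add: univ_power)

lemma un:
  assumes "x \<in> univ power"
  shows "un x \<in> seqs" "cls (un x) = x"
  using someI_ex[of "\<lambda>s. s \<in> seqs \<and> cls s = x"] assms unfolding un_def univ_power by auto

lemma un_cls: "s \<in> seqs \<Longrightarrow> \<forall>\<^sub>F i in U. un (cls s) i = s i"
  using cls_eq_iff un cls_univ by blast

lemma map_un_cls:
  assumes "set ss \<subseteq> seqs"
  shows "\<forall>\<^sub>F i in U. map (\<lambda>x. un x i) (map cls ss) = map (\<lambda>s. s i) ss"
proof -
  have "\<forall>\<^sub>F i in U. \<forall>s\<in>set ss. un (cls s) i = s i"
    using assms un_cls by (intro eventually_ball_finite) auto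
  then show ?thesis by (rule eventually_mono) simp
qed

lemma fint_power:
  assumes "set ss \<subseteq> seqs"
  shows "fint power f (map cls ss) = cls (\<lambda>i. fint K f (map (\<lambda>s. s i) ss))"
  unfolding power_def struct.simps
  by (rule cls_eqI, rule eventually_mono[OF map_un_cls[OF assms]]) (simp only:)

lemma rint_power:
  assumes "set ss \<subseteq> seqs"
  shows "rint power r (map cls ss) \<longleftrightarrow> (\<forall>\<^sub>F i in U. rint K r (map (\<lambda>s. s i) ss))"
  unfolding power_def struct.simps
  by (rule eventually_subst, rule eventually_mono[OF map_un_cls[OF assms]]) (simp only:)

lemma fint_closed: "length xs = farity L f \<Longrightarrow> set xs \<subseteq> univ K \<Longrightarrow> fint K f xs \<in> univ K"
  using K unfolding is_structure_def tuples_def by blast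

lemma eval_closed: "wf_tm L t \<Longrightarrow> range e \<subseteq> univ K \<Longrightarrow> eval K e t \<in> univ K"
proof (induction t)
  case (Fun f ts)
  then show ?case by (auto intro!: fint_closed)
qed auto

lemma eval_power:
  assumes "\<And>n. E n \<in> seqs" "wf_tm L t"
  shows "(\<lambda>i. eval K (\<lambda>n. E n i) t) \<in> seqs"
    and "eval power (\<lambda>n. cls (E n)) t = cls (\<lambda>i. eval K (\<lambda>n. E n i) t)"
proof -
  have seq: "(\<lambda>i. eval K (\<lambda>n. E n i) t) \<in> seqs" if "wf_tm L t" for t
    using that assms(1) by (intro seqsI eval_closed) (auto dest: seqsD)
  then show "(\<lambda>i. eval K (\<lambda>n. E n i) t) \<in> seqs" using assms by blast
  show "eval power (\<lambda>n. cls (E n)) t = cls (\<lambda>i. eval K (\<lambda>n. E n i) t)"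
    using assms(2)
  proof (induction t)
    case (Fun f ts)
    define ss where "ss = map (\<lambda>t i. eval K (\<lambda>n. E n i) t) ts"
    have "set ss \<subseteq> seqs" using seq Fun.prems by (auto simp: ss_def)
    moreover have "map (eval power (\<lambda>n. cls (E n))) ts = map cls ss"
      using Fun by (simp add: ss_def)
    ultimately have "eval power (\<lambda>n. cls (E n)) (Fun f ts) = cls (\<lambda>i. fint K f (map (\<lambda>s. s i) ss))"
      by (simp add: fint_power del: map_eq_conv)
    then show ?case by (simp add: ss_def comp_def)
  qed simp
qed

text \<open>Los's theorem. Negation uses the ultrafilter property, and the existential quantifier a
  coordinatewise choice of witnesses.\<close>

theorem sat_power:
  assumes "\<And>n. E n \<in> seqs" "wf_fm L p"
  shows "sat power (\<lambda>n. cls (E n)) p \<longleftrightarrow> (\<forall>\<^sub>F i in U. sat K (\<lambda>n. E n i) p)"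
  using assms
proof (induction p arbitrary: E)
  case (Eq s t)
  then show ?case by (simp add: eval_power cls_eq_iff)
next
  case (Rel r ts)
  define ss where "ss = map (\<lambda>t i. eval K (\<lambda>n. E n i) t) ts"
  have "set ss \<subseteq> seqs" using eval_power(1)[of E] Rel by (auto simp: ss_def)
  moreover have "map (eval power (\<lambda>n. cls (E n))) ts = map cls ss"
    using eval_power(2)[of E] Rel by (simp add: ss_def)
  ultimately have "sat power (\<lambda>n. cls (E n)) (Rel r ts) \<longleftrightarrow> (\<forall>\<^sub>F i in U. rint K r (map (\<lambda>s. s i) ss))"
    by (simp add: rint_power del: map_eq_conv)
  then show ?case by (simp add: ss_def comp_def)
next
  case (Neg p)
  then show ?case by (simp add: ultrafilter_not[OF U])
next
  case (And p q)
  then show ?case by (simp add: eventually_conj_iff)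
next
  case (Ex n p)
  have upd: "sat power ((\<lambda>m. cls (E m))(n := cls s)) p \<longleftrightarrow> (\<forall>\<^sub>F i in U. sat K ((\<lambda>m. E m i)(n := s i)) p)"
    if s: "s \<in> seqs" for s
  proof -
    have "(\<lambda>m. cls (E m))(n := cls s) = (\<lambda>m. cls ((E(n := s)) m))" by (simp add: fun_eq_iff)
    moreover have "(\<lambda>m. (E(n := s)) m i) = (\<lambda>m. E m i)(n := s i)" for i by (simp add: fun_eq_iff)
    ultimately show ?thesis using Ex.IH[of "E(n := s)"] Ex.prems s by simp
  qed
  show ?case
  proof
    assume "sat power (\<lambda>m. cls (E m)) (Ex n p)"
    then obtain s where s: "s \<in> seqs" "sat power ((\<lambda>m. cls (E m))(n := cls s)) p"
      by (auto simp: univ_power)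
    then have "\<forall>\<^sub>F i in U. sat K ((\<lambda>m. E m i)(n := s i)) p" using upd by blast
    then show "\<forall>\<^sub>F i in U. sat K (\<lambda>m. E m i) (Ex n p)"
      by (rule eventually_mono) (use seqsD[OF s(1)] in auto)
  next
    assume ev: "\<forall>\<^sub>F i in U. sat K (\<lambda>m. E m i) (Ex n p)"
    obtain c where c: "c \<in> univ K" using K unfolding is_structure_def by blast
    \<comment> \<open>A witness wherever there is one, and the default \<open>c\<close> at the other
      indices, which are negligible by \<open>ev\<close>.\<close>
    define s where "s i = (if sat K (\<lambda>m. E m i) (Ex n p)
      then SOME a. a \<in> univ K \<and> sat K ((\<lambda>m. E m i)(n := a)) p else c)" for i
    have s: "s i \<in> univ K" "sat K (\<lambda>m. E m i) (Ex n p) \<Longrightarrow> sat K ((\<lambda>m. E m i)(n := s i)) p" for i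
      using someI_ex[of "\<lambda>a. a \<in> univ K \<and> sat K ((\<lambda>m. E m i)(n := a)) p"] c by (auto simp: s_def)
    have "\<forall>\<^sub>F i in U. sat K ((\<lambda>m. E m i)(n := s i)) p"
      using ev by (rule eventually_mono) (rule s(2))
    then have "sat power ((\<lambda>m. cls (E m))(n := cls s)) p" using upd seqsI s(1) by blast
    then show "sat power (\<lambda>m. cls (E m)) (Ex n p)"
      using seqsI s(1) by (auto simp: univ_power)
  qed
qed

lemma power_structure: "is_structure L power"
  unfolding is_structure_def
proof (intro conjI allI ballI)
  obtain c where "c \<in> univ K" using K unfolding is_structure_def by blast
  then show "univ power \<noteq> {}" using cls_univ seqsI[of "\<lambda>_. c"] by blast
  fix f xs assume xs: "xs \<in> tuples power (farity L f)"
  have "fint power f xs = cls (\<lambda>i. fint K f (map (\<lambda>x. un x i) xs))" by (simp add: power_def)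
  moreover have "(\<lambda>i. fint K f (map (\<lambda>x. un x i) xs)) \<in> seqs"
    using xs un(1) by (intro seqsI fint_closed) (auto simp: tuples_def dest: seqsD subsetD)
  ultimately show "fint power f xs \<in> univ power" by (simp add: cls_univ)
qed

lemma power_model: "is_model L power (Th L K)"
  unfolding is_model_def
proof (intro conjI ballI power_structure)
  fix p assume p: "p \<in> Th L K"
  show "holds power p"
    unfolding holds_def
  proof (intro allI impI)
    fix e :: "nat \<Rightarrow> 'u" assume e: "range e \<subseteq> univ power"
    then have E: "un (e n) \<in> seqs" "cls (un (e n)) = e n" for n using un by auto
    have "sat K (\<lambda>n. un (e n) i) p" for i
    proof -
      have "range (\<lambda>n. un (e n) i) \<subseteq> univ K" using seqsD[OF E(1)] by blast
      then show ?thesis using p by (simp add: Th_def holds_def)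
    qed
    then have "sat power (\<lambda>n. cls (un (e n))) p"
      using p by (subst sat_power) (auto simp: E Th_def sentence_def)
    then show "sat power e p" by (simp add: E)
  qed
qed

end

section \<open>Room for the ultrapower in the given type, and the choice of the ultrafilter\<close>

lemma inj_list_product:
  assumes "infinite (UNIV :: 'a set)"
  shows "\<exists>enc :: 'a list \<times> 'a \<Rightarrow> 'a. inj enc"
proof -
  obtain g :: "'a \<times> 'a \<Rightarrow> 'a" where "bij_betw g (UNIV \<times> UNIV) UNIV"
    using card_of_ordIso[THEN iffD2, OF card_of_Times_same_infinite[OF assms]] by blast
  then have g: "inj g" by (simp add: bij_betw_def)
  obtain n :: "nat \<Rightarrow> 'a" where n: "inj n"
    using infinite_countable_subset[OF assms] by blast
  \<comment> \<open>\<open>le\<close> iterates the pairing function. It separates only lists of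
    equal length, so the final code also records \<open>n (length xs)\<close>.\<close>
  define le where "le = rec_list (n 0) (\<lambda>x xs r. g (x, r))"
  have le: "le [] = n 0" "le (x # xs) = g (x, le xs)" for x xs by (simp_all add: le_def)
  have le_inj: "length xs = length ys \<Longrightarrow> le xs = le ys \<Longrightarrow> xs = ys" for xs ys
  proof (induction xs ys rule: list_induct2')
    case (4 x xs y ys)
    then show ?case using injD[OF g] by (auto simp: le)
  qed auto
  have "inj (\<lambda>(xs, a). g (g (n (length xs), le xs), a))"
  proof (rule injI, clarify)
    fix xs ys a b assume "g (g (n (length xs), le xs), a) = g (g (n (length ys), le ys), b)"
    then have "n (length xs) = n (length ys)" "le xs = le ys" "a = b" using injD[OF g] by blast+
    then show "xs = ys \<and> a = b" using le_inj injD[OF n] by blast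
  qed
  then show ?thesis by blast
qed

text \<open>A sequence is coded by its graph. Since \<open>'a\<close> is infinite, pairs of a list
  and an element embed into \<open>'a\<close>, and the graph becomes a subset of
  \<open>'b + 'a\<close>.\<close>

lemma inj_sequences:
  assumes "infinite (UNIV :: 'a set)" "\<exists>h :: ('b + 'a) set \<Rightarrow> 'u. inj h"
  shows "\<exists>j :: ('a list \<Rightarrow> 'a) \<Rightarrow> 'u. inj j"
proof -
  obtain enc :: "'a list \<times> 'a \<Rightarrow> 'a" where enc: "inj enc" using inj_list_product[OF assms(1)] by blast
  obtain h :: "('b + 'a) set \<Rightarrow> 'u" where h: "inj h" using assms(2) by blast
  have "inj (\<lambda>s. h (range (\<lambda>i. Inr (enc (i, s i)))))"
  proof (rule injI, rule ext)
    fix s t :: "'a list \<Rightarrow> 'a" and i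
    assume "h (range (\<lambda>i. Inr (enc (i, s i)))) = h (range (\<lambda>i. Inr (enc (i, t i))))"
    then have "range (\<lambda>i. Inr (enc (i, s i)) :: 'b + 'a) = range (\<lambda>i. Inr (enc (i, t i)))"
      by (rule injD[OF h])
    then have "(Inr (enc (i, s i)) :: 'b + 'a) \<in> range (\<lambda>i. Inr (enc (i, t i)))" by blast
    then obtain k where "enc (i, s i) = enc (k, t k)" by auto
    then show "s i = t i" using injD[OF enc] by blast
  qed
  then show ?thesis by blast
qed

text \<open>The sets \<open>{i. c \<in> set i}\<close> have the finite intersection property because
  finitely many elements can be listed. An index is to be read as a candidate for a finite preparing
  set; every fixed element eventually belongs to it.\<close>

lemma ex_list_ultrafilter: "\<exists>U :: 'a list filter. ultrafilter U \<and> (\<forall>c. eventually (\<lambda>i. c \<in> set i) U)"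
proof -
  let ?F = "INF c. principal {i :: 'a list. c \<in> set i}"
  have "?F \<noteq> bot"
  proof (rule INF_filter_not_bot)
    fix X :: "'a set" assume "finite X"
    then obtain xs where "set xs = X" using finite_list by blast
    then have "xs \<in> (\<Inter>c\<in>X. {i. c \<in> set i})" by auto
    then show "(INF c\<in>X. principal {i. c \<in> set i}) \<noteq> bot"
      using INF_principal_finite[OF \<open>finite X\<close>, of "\<lambda>c. {i. c \<in> set i}"]
      by (metis empty_iff principal_eq_bot_iff)
  qed
  then obtain U where U: "ultrafilter U" "U \<le> ?F" using ex_ultrafilter by blast
  have "eventually (\<lambda>i. c \<in> set i) U" for c
  proof -
    have "?F \<le> principal {i. c \<in> set i}" by (rule INF_lower) simp
    with U(2) have "U \<le> principal {i. c \<in> set i}" by (rule order_trans)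
    then show ?thesis by (simp add: le_principal)
  qed
  then show ?thesis using U by blast
qed

section \<open>Valued fields\<close>

locale valuation_subring = field R for R (structure) +
  fixes V :: "'a set"
  assumes V_subring: "subring V R"
    and V_proper: "V \<noteq> carrier R"
    and V_total: "x \<in> carrier R \<Longrightarrow> x \<noteq> \<zero> \<Longrightarrow> x \<in> V \<or> inv x \<in> V"
begin

text \<open>This is \<open>|x| \<le> |y|\<close>. Comparing elements instead of cosets keeps the
  value group out of the field computations.\<close>

definition le :: "'a \<Rightarrow> 'a \<Rightarrow> bool" where
  "le x y \<longleftrightarrow> (\<exists>c\<in>V. x = c \<otimes> y)"

text \<open>Negation gives the strict order of values because values are linearly ordered, see
  \<open>le_total\<close>.\<close>

definition lt :: "'a \<Rightarrow> 'a \<Rightarrow> bool" where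
  "lt x y \<longleftrightarrow> \<not> le y x"

lemma not_le: "\<not> le x y \<longleftrightarrow> lt y x"
  by (simp add: lt_def)

lemma V_carrier [simp]: "x \<in> V \<Longrightarrow> x \<in> carrier R"
  using subringE(1)[OF V_subring] by blast

lemma one_V [simp]: "\<one> \<in> V"
  using subringE(3)[OF V_subring] .

lemma zero_V [simp]: "\<zero> \<in> V"
  using subringE(2)[OF V_subring] .

lemma V_mult: "x \<in> V \<Longrightarrow> y \<in> V \<Longrightarrow> x \<otimes> y \<in> V"
  using subringE(6)[OF V_subring] .

lemma V_add: "x \<in> V \<Longrightarrow> y \<in> V \<Longrightarrow> x \<oplus> y \<in> V"
  using subringE(7)[OF V_subring] .

lemma V_minus: "x \<in> V \<Longrightarrow> \<ominus> x \<in> V"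
  using subringE(5)[OF V_subring] .

lemma le_refl [simp]: "x \<in> carrier R \<Longrightarrow> le x x"
  unfolding le_def by (rule bexI[of _ \<one>]) auto

lemma le_trans: "le x y \<Longrightarrow> le y z \<Longrightarrow> x \<in> carrier R \<Longrightarrow> y \<in> carrier R \<Longrightarrow> z \<in> carrier R \<Longrightarrow> le x z"
  unfolding le_def by (metis V_carrier V_mult m_assoc)

lemma le_zero [simp]: "x \<in> carrier R \<Longrightarrow> le \<zero> x"
  unfolding le_def by (rule bexI[of _ \<zero>]) auto

lemma le_zero_iff [simp]: "x \<in> carrier R \<Longrightarrow> le x \<zero> \<longleftrightarrow> x = \<zero>"
  unfolding le_def by (metis V_carrier r_null zero_V)

lemma le_mult_left: "le x y \<Longrightarrow> x \<in> carrier R \<Longrightarrow> y \<in> carrier R \<Longrightarrow> z \<in> carrier R \<Longrightarrow> le (z \<otimes> x) (z \<otimes> y)"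
  unfolding le_def by (metis V_carrier m_lcomm)

lemma inv_closed [simp]: "x \<in> carrier R \<Longrightarrow> x \<noteq> \<zero> \<Longrightarrow> inv x \<in> carrier R"
  by (simp add: field_Units)

lemma inv_l [simp]: "x \<in> carrier R \<Longrightarrow> x \<noteq> \<zero> \<Longrightarrow> inv x \<otimes> x = \<one>"
  by (simp add: field_Units)

lemma inv_r [simp]: "x \<in> carrier R \<Longrightarrow> x \<noteq> \<zero> \<Longrightarrow> x \<otimes> inv x = \<one>"
  by (simp add: field_Units)

lemma mult_eq_zero [simp]: "x \<in> carrier R \<Longrightarrow> y \<in> carrier R \<Longrightarrow> x \<otimes> y = \<zero> \<longleftrightarrow> x = \<zero> \<or> y = \<zero>"
  by (rule integral_iff)

lemma inv_nonzero [simp]: "x \<in> carrier R \<Longrightarrow> x \<noteq> \<zero> \<Longrightarrow> inv x \<noteq> \<zero>"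
  by (metis inv_l l_null one_not_zero)

lemma divide_cancel [simp]: "x \<in> carrier R \<Longrightarrow> y \<in> carrier R \<Longrightarrow> y \<noteq> \<zero> \<Longrightarrow> y \<otimes> (x \<otimes> inv y) = x"
  by (metis inv_closed inv_r m_lcomm r_one)

lemma cancel_divide [simp]: "x \<in> carrier R \<Longrightarrow> y \<in> carrier R \<Longrightarrow> y \<noteq> \<zero> \<Longrightarrow> (x \<otimes> inv y) \<otimes> y = x"
  by (simp add: m_assoc)

lemma le_mult_left_iff [simp]:
  assumes "x \<in> carrier R" "y \<in> carrier R" "z \<in> carrier R" "z \<noteq> \<zero>"
  shows "le (z \<otimes> x) (z \<otimes> y) \<longleftrightarrow> le x y"
proof
  assume "le (z \<otimes> x) (z \<otimes> y)"
  then have "le (inv z \<otimes> (z \<otimes> x)) (inv z \<otimes> (z \<otimes> y))"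
    by (rule le_mult_left) (use assms in auto)
  then show "le x y" using assms by (simp add: m_assoc[symmetric])
qed (use assms in \<open>auto intro: le_mult_left\<close>)

lemma le_mult_right_iff [simp]:
  assumes "x \<in> carrier R" "y \<in> carrier R" "z \<in> carrier R" "z \<noteq> \<zero>"
  shows "le (x \<otimes> z) (y \<otimes> z) \<longleftrightarrow> le x y"
  using le_mult_left_iff[OF assms] assms by (simp add: m_comm)

lemma le_total:
  assumes "x \<in> carrier R" "y \<in> carrier R"
  shows "le x y \<or> le y x"
proof (cases "x = \<zero> \<or> y = \<zero>")
  case False
  then have "x \<otimes> inv y \<in> V \<or> inv (x \<otimes> inv y) \<in> V"
    using assms V_total[of "x \<otimes> inv y"] by auto
  then show ?thesis
  proof
    assume "x \<otimes> inv y \<in> V"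
    then show ?thesis unfolding le_def using assms False
      by (intro disjI1 bexI[of _ "x \<otimes> inv y"]) auto
  next
    assume *: "inv (x \<otimes> inv y) \<in> V"
    have "inv (x \<otimes> inv y) \<otimes> (x \<otimes> inv y) \<otimes> y = y"
      using assms False by (subst inv_l) auto
    moreover have "c \<otimes> (x \<otimes> inv y) \<otimes> y = c \<otimes> x" if "c \<in> carrier R" for c
      using assms False that by (simp add: m_assoc)
    ultimately have "y = inv (x \<otimes> inv y) \<otimes> x"
      using * by simp
    then show ?thesis unfolding le_def using * by blast
  qed
qed (use assms in auto)

lemma lt_mult_left_iff [simp]:
  assumes "x \<in> carrier R" "y \<in> carrier R" "z \<in> carrier R" "z \<noteq> \<zero>"
  shows "lt (z \<otimes> x) (z \<otimes> y) \<longleftrightarrow> lt x y"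
  using assms by (simp add: lt_def)

lemma lt_mult_right_iff [simp]:
  assumes "x \<in> carrier R" "y \<in> carrier R" "z \<in> carrier R" "z \<noteq> \<zero>"
  shows "lt (x \<otimes> z) (y \<otimes> z) \<longleftrightarrow> lt x y"
  using assms by (simp add: lt_def)

lemma lt_imp_le: "lt x y \<Longrightarrow> x \<in> carrier R \<Longrightarrow> y \<in> carrier R \<Longrightarrow> le x y"
  using le_total lt_def by blast

lemma le_lt_trans: "le x y \<Longrightarrow> lt y z \<Longrightarrow> x \<in> carrier R \<Longrightarrow> y \<in> carrier R \<Longrightarrow> z \<in> carrier R \<Longrightarrow> lt x z"
  using le_trans lt_def by blast

lemma lt_le_trans: "lt x y \<Longrightarrow> le y z \<Longrightarrow> x \<in> carrier R \<Longrightarrow> y \<in> carrier R \<Longrightarrow> z \<in> carrier R \<Longrightarrow> lt x z"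
  using le_trans lt_def by blast

lemma lt_trans: "lt x y \<Longrightarrow> lt y z \<Longrightarrow> x \<in> carrier R \<Longrightarrow> y \<in> carrier R \<Longrightarrow> z \<in> carrier R \<Longrightarrow> lt x z"
  using lt_le_trans lt_imp_le by blast

lemma lt_irrefl [simp]: "x \<in> carrier R \<Longrightarrow> \<not> lt x x"
  by (simp add: lt_def)

lemma not_lt_zero [simp]: "x \<in> carrier R \<Longrightarrow> \<not> lt x \<zero>"
  by (simp add: lt_def)

lemma zero_lt_iff [simp]: "x \<in> carrier R \<Longrightarrow> lt \<zero> x \<longleftrightarrow> x \<noteq> \<zero>"
  by (simp add: lt_def)

lemma le_add:
  "le x z \<Longrightarrow> le y z \<Longrightarrow> z \<in> carrier R \<Longrightarrow> le (x \<oplus> y) z"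
  unfolding le_def by (metis V_add V_carrier l_distr)

lemma lt_add:
  assumes "lt x z" "lt y z" "x \<in> carrier R" "y \<in> carrier R" "z \<in> carrier R"
  shows "lt (x \<oplus> y) z"
proof (cases "le x y")
  case True
  then have "le (x \<oplus> y) y" using assms le_add by auto
  then show ?thesis using assms by (auto intro: le_lt_trans)
next
  case False
  then have "le (x \<oplus> y) x" using assms le_add lt_imp_le by (auto simp: not_le)
  then show ?thesis using assms by (auto intro: le_lt_trans)
qed

lemma le_minus_left [simp]: "x \<in> carrier R \<Longrightarrow> y \<in> carrier R \<Longrightarrow> le (\<ominus> x) y \<longleftrightarrow> le x y"
  unfolding le_def by (metis V_carrier V_minus l_minus minus_minus)

lemma le_minus_right [simp]: "x \<in> carrier R \<Longrightarrow> y \<in> carrier R \<Longrightarrow> le y (\<ominus> x) \<longleftrightarrow> le y x"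
  unfolding le_def by (metis V_carrier V_minus l_minus r_minus minus_minus)

lemma minus_swap: "x \<in> carrier R \<Longrightarrow> y \<in> carrier R \<Longrightarrow> x \<ominus> y = \<ominus> (y \<ominus> x)"
  by algebra

lemma le_dist_commute: "x \<in> carrier R \<Longrightarrow> y \<in> carrier R \<Longrightarrow> z \<in> carrier R \<Longrightarrow> le (x \<ominus> y) z \<longleftrightarrow> le (y \<ominus> x) z"
  by (metis minus_swap le_minus_left minus_closed)

lemma le_dist_commute': "x \<in> carrier R \<Longrightarrow> y \<in> carrier R \<Longrightarrow> z \<in> carrier R \<Longrightarrow> le z (x \<ominus> y) \<longleftrightarrow> le z (y \<ominus> x)"
  by (metis minus_swap le_minus_right minus_closed)

lemma lt_dist_commute: "x \<in> carrier R \<Longrightarrow> y \<in> carrier R \<Longrightarrow> z \<in> carrier R \<Longrightarrow> lt (x \<ominus> y) z \<longleftrightarrow> lt (y \<ominus> x) z"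
  unfolding lt_def by (simp add: le_dist_commute')

text \<open>Non-triviality of the valuation enters here: an element outside \<open>V\<close> has
  value above 1, and dividing \<open>r\<close> by it lowers the value.\<close>

lemma ex_small:
  assumes "r \<in> carrier R" "r \<noteq> \<zero>"
  obtains s where "s \<in> carrier R" "s \<noteq> \<zero>" "lt s r"
proof -
  obtain x where x: "x \<in> carrier R" "x \<notin> V" using V_proper V_carrier by blast
  then have nz: "x \<noteq> \<zero>" by auto
  have "lt \<one> x" using x unfolding le_def lt_def by auto
  then have "lt (inv x \<otimes> \<one>) (inv x \<otimes> x)" using x nz by (subst lt_mult_left_iff) auto
  then have "lt (inv x) \<one>" using x nz by simp
  then have "lt (r \<otimes> inv x) (r \<otimes> \<one>)" using x nz assms by (subst lt_mult_left_iff) auto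
  then show thesis using that[of "r \<otimes> inv x"] assms x nz by auto
qed

lemma ex_min:
  assumes "finite C" "C \<noteq> {}" "C \<subseteq> carrier R" "\<And>c. c \<in> C \<Longrightarrow> h c \<in> carrier R"
  obtains c where "c \<in> C" "\<And>d. d \<in> C \<Longrightarrow> le (h c) (h d)"
proof -
  have "\<exists>c\<in>C. \<forall>d\<in>C. le (h c) (h d)"
    using assms
  proof (induction C rule: finite_ne_induct)
    case (insert x F)
    then obtain c where c: "c \<in> F" "\<forall>d\<in>F. le (h c) (h d)" by auto
    show ?case
    proof (cases "le (h c) (h x)")
      case True
      then show ?thesis using c by auto
    next
      case False
      then have "le (h x) (h c)" using lt_imp_le insert c by (auto simp: not_le)
      then have "\<forall>d\<in>insert x F. le (h x) (h d)" using c insert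
        by (metis insertCI insert_iff le_refl le_trans)
      then show ?thesis by blast
    qed
  qed simp
  then show thesis using that by blast
qed

lemma minus_eq_zero [simp]: "x \<in> carrier R \<Longrightarrow> y \<in> carrier R \<Longrightarrow> x \<ominus> y = \<zero> \<longleftrightarrow> x = y"
  by (metis r_right_minus_eq)

lemma minus_self [simp]: "x \<in> carrier R \<Longrightarrow> x \<ominus> x = \<zero>"
  by simp

lemma lt_dist_trans:
  assumes "lt (x \<ominus> y) r" "lt (y \<ominus> z) r" "x \<in> carrier R" "y \<in> carrier R" "z \<in> carrier R" "r \<in> carrier R"
  shows "lt (x \<ominus> z) r"
proof -
  have "x \<ominus> z = (x \<ominus> y) \<oplus> (y \<ominus> z)" using assms by algebra
  then show ?thesis using lt_add[OF assms(1,2)] assms by (simp only: minus_closed)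
qed

lemma le_dist_trans:
  assumes "le (x \<ominus> y) r" "le (y \<ominus> z) r" "x \<in> carrier R" "y \<in> carrier R" "z \<in> carrier R" "r \<in> carrier R"
  shows "le (x \<ominus> z) r"
proof -
  have "x \<ominus> z = (x \<ominus> y) \<oplus> (y \<ominus> z)" using assms by algebra
  then show ?thesis using le_add[OF assms(1,2)] assms by (simp only: minus_closed)
qed

text \<open>Leading terms: \<open>near l x y\<close> says that \<open>x\<close> and \<open>y\<close> have the same leading term with respect
  to \<open>\<bar>l\<bar>\<close>.\<close>

definition near :: "'a \<Rightarrow> 'a \<Rightarrow> 'a \<Rightarrow> bool" where
  "near l x y \<longleftrightarrow> x = y \<or> lt (x \<ominus> y) (l \<otimes> x)"

lemma near_refl [simp]: "near l x x" by (simp add: near_def)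

text \<open>As \<open>|l| \<le> 1\<close>, nearness of distinct elements gives
  \<open>|x - y| < |x|\<close>, which forces equal values by the ultrametric inequality. Hence
  \<open>near\<close>, although measured at its first argument, is symmetric and transitive.\<close>

lemma near_le:
  assumes "near l x y" "l \<in> V" "x \<in> carrier R" "y \<in> carrier R"
  shows "le x y" "le y x"
proof -
  have "le (l \<otimes> x) x" using assms unfolding le_def by blast
  then have *: "x = y \<or> lt (x \<ominus> y) x"
    using assms lt_le_trans[of "x \<ominus> y" "l \<otimes> x" x] by (auto simp: near_def)
  then show "le y x"
  proof
    assume *: "lt (x \<ominus> y) x"
    have "le (x \<oplus> \<ominus> (x \<ominus> y)) x" using assms * lt_imp_le by (intro le_add) auto
    moreover have "x \<oplus> \<ominus> (x \<ominus> y) = y" using assms by algebra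
    ultimately show ?thesis by simp
  qed (use assms in auto)
  show "le x y"
    using *
  proof
    assume *: "lt (x \<ominus> y) x"
    show ?thesis
    proof (rule ccontr)
      assume "\<not> le x y"
      then have "lt y x" by (simp add: not_le)
      with * have "lt ((x \<ominus> y) \<oplus> y) x" using assms by (intro lt_add) auto
      moreover have "(x \<ominus> y) \<oplus> y = x" using assms by algebra
      ultimately show False using assms by simp
    qed
  qed (use assms in auto)
qed

lemma near_sym:
  assumes "near l x y" "l \<in> V" "x \<in> carrier R" "y \<in> carrier R"
  shows "near l y x"
proof -
  have "le (l \<otimes> x) (l \<otimes> y)"
    using near_le[OF assms] assms by (auto intro: le_mult_left)
  then show ?thesis using assms unfolding near_def
    using lt_le_trans[of "x \<ominus> y" "l \<otimes> x" "l \<otimes> y"] lt_dist_commute[of "x" y "l \<otimes> y"] by auto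
qed

lemma near_trans:
  assumes "near l x y" "near l y z" "l \<in> V" "x \<in> carrier R" "y \<in> carrier R" "z \<in> carrier R"
  shows "near l x z"
proof (cases "x = y \<or> y = z")
  case False
  have *: "le (l \<otimes> y) (l \<otimes> x)"
    using near_le(2)[OF assms(1,3,4,5)] assms(3-6) by (simp add: le_mult_left)
  have xy: "lt (x \<ominus> y) (l \<otimes> x)" and "lt (y \<ominus> z) (l \<otimes> y)"
    using assms(1,2) False by (auto simp: near_def)
  with * have "lt (y \<ominus> z) (l \<otimes> x)"
    by (meson assms(3-6) lt_le_trans V_carrier m_closed minus_closed)
  with xy have "lt (x \<ominus> z) (l \<otimes> x)"
    by (rule lt_dist_trans) (use assms(3-6) in simp_all)
  then show ?thesis by (simp add: near_def)
next
  case True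
  then show ?thesis using assms(1,2) by auto
qed

lemma add_pow_one: "x \<in> carrier R \<Longrightarrow> [(n::nat)] \<cdot> x = ([n] \<cdot> \<one>) \<otimes> x"
  by (simp add: add_pow_ldistr)

lemma nat_V: "[(n::nat)] \<cdot> \<one> \<in> V"
  by (induction n) (auto simp: V_add)

end

text \<open>Residue characteristic zero takes the form that positive integers are invertible in the
  valuation ring.\<close>

locale valued = valuation_subring +
  assumes V_char: "n > 0 \<Longrightarrow> \<exists>v\<in>V. v \<otimes> ([(n::nat)] \<cdot> \<one>) = \<one>"
begin

lemma le_nat_mult:
  assumes "n > 0" "x \<in> carrier R"
  shows "le x ([(n::nat)] \<cdot> x)" "le ([n] \<cdot> x) x"
proof -
  obtain v where v: "v \<in> V" "v \<otimes> ([n] \<cdot> \<one>) = \<one>" using V_char assms by blast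
  then have "x = v \<otimes> ([n] \<cdot> x)"
    using assms by (simp add: add_pow_one[of x] m_assoc[symmetric] nat_V)
  then show "le x ([n] \<cdot> x)" using v unfolding le_def by blast
  show "le ([n] \<cdot> x) x" using add_pow_one[of x n] nat_V assms unfolding le_def by blast
qed

text \<open>Nonzero integers have value 1, so the difference of two distinct multiples has the value
  of \<open>x\<close>.\<close>

lemma le_dist_nat_mult:
  assumes "n \<noteq> m" "x \<in> carrier R"
  shows "le x ([(n::nat)] \<cdot> x \<ominus> [m] \<cdot> x)"
proof -
  have *: "le x ([n] \<cdot> x \<ominus> [m] \<cdot> x)" if "m < n" for n m :: nat
  proof -
    have "[n] \<cdot> x = [m] \<cdot> x \<oplus> [(n - m)] \<cdot> x"
      using that add.nat_pow_mult[OF assms(2), of m "n - m"] by simp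
    moreover have "(a \<oplus> b) \<ominus> a = b" if "a \<in> carrier R" "b \<in> carrier R" for a b
      using that by algebra
    ultimately have "[n] \<cdot> x \<ominus> [m] \<cdot> x = [(n - m)] \<cdot> x"
      using assms(2) by simp
    then show ?thesis using le_nat_mult[of "n - m" x] that assms by simp
  qed
  show ?thesis
  proof (cases "m < n")
    case False
    then show ?thesis using *[of n m] assms le_dist_commute'[of "[n] \<cdot> x" "[m] \<cdot> x" x] by auto
  qed (use * in auto)
qed

text \<open>The points \<open>x + n r\<close> are pairwise at distance at least \<open>|r|\<close>,
  so an open ball of radius \<open>|r|\<close> around an element of \<open>C\<close> contains at
  most one of them. Finitely many such balls cannot contain them all.\<close>

lemma avoid:
  assumes "finite C" "C \<subseteq> carrier R" "x \<in> carrier R" "r \<in> carrier R" "r \<noteq> \<zero>"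
  obtains y where "y \<in> carrier R" "le (y \<ominus> x) r" "\<And>c. c \<in> C \<Longrightarrow> le r (y \<ominus> c)"
proof -
  define p where "p n = x \<oplus> [(n::nat)] \<cdot> r" for n
  have p: "p n \<in> carrier R" for n using assms by (simp add: p_def)
  have "\<exists>n. \<forall>c\<in>C. le r (p n \<ominus> c)"
  proof (rule ccontr)
    assume "\<not> ?thesis"
    then obtain g where g: "\<And>n. g n \<in> C \<and> lt (p n \<ominus> g n) r" unfolding not_le[symmetric] by metis
    then have "\<not> inj g" using assms(1) by (meson finite_subset image_subsetI infinite_UNIV_nat finite_imageD)
    then obtain n m where nm: "n \<noteq> m" "g n = g m" by (auto simp: inj_def)
    have c: "g n \<in> carrier R" using g assms by auto
    have "lt (p n \<ominus> g n) r" "lt (g n \<ominus> p m) r"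
      using g[of n] g[of m] nm(2) c p assms(4) by (simp_all add: lt_dist_commute)
    then have "lt (p n \<ominus> p m) r"
      by (rule lt_dist_trans) (use c p assms(4) in simp_all)
    moreover have "p n \<ominus> p m = [n] \<cdot> r \<ominus> [m] \<cdot> r"
      using assms add.nat_pow_closed[of r n] add.nat_pow_closed[of r m] unfolding p_def by algebra
    ultimately show False using le_dist_nat_mult[OF nm(1) assms(4)] by (simp add: lt_def)
  qed
  then obtain n where n: "\<forall>c\<in>C. le r (p n \<ominus> c)" by blast
  have "p n \<ominus> x = [n] \<cdot> r"
    using assms add.nat_pow_closed[of r n] unfolding p_def by algebra
  moreover have "le ([n] \<cdot> r) r" using le_nat_mult[of n r] assms by (cases "n = 0") auto
  ultimately show thesis using that[of "p n"] n p by simp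
qed

end

section \<open>The geometry of prepared families\<close>

text \<open>The interface through which the geometry sees the structure: \<open>D\<close> stands for
  definability with parameters, and \<open>prepare\<close> is uniform preparation. The class of
  \<open>b\<close> under \<open>near l\<close> is an element of RV for the value \<open>|l|\<close>;
  one \<open>C\<close> serves all \<open>l\<close> and \<open>b\<close>.\<close>

locale uniform_preparation = valued R V for R (structure) and V +
  fixes D :: "((nat \<Rightarrow> 'a) \<Rightarrow> bool) \<Rightarrow> bool"
  assumes D_cong: "D P \<Longrightarrow> (\<And>e. range e \<subseteq> carrier R \<Longrightarrow> P e = Q e) \<Longrightarrow> D Q"
    and D_not: "D P \<Longrightarrow> D (\<lambda>e. \<not> P e)"
    and D_and: "D P \<Longrightarrow> D Q \<Longrightarrow> D (\<lambda>e. P e \<and> Q e)"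
    and D_ex: "D (\<lambda>e. P' (e 0) (\<lambda>i. e (Suc i))) \<Longrightarrow> D (\<lambda>e. \<exists>x\<in>carrier R. P' x e)"
    and D_var_eq: "D (\<lambda>e. e i = e j)"
    and D_var_const: "c \<in> carrier R \<Longrightarrow> D (\<lambda>e. e i = c)"
    and D_var_add: "D (\<lambda>e. e i = e j \<oplus> e k)"
    and D_var_mult: "D (\<lambda>e. e i = e j \<otimes> e k)"
    and D_var_V: "D (\<lambda>e. e i \<in> V)"
    and D_rename: "D P \<Longrightarrow> inj \<sigma> \<Longrightarrow> D (\<lambda>e. P (\<lambda>i. e (\<sigma> i)))"
    and prepare: "D (\<lambda>e. \<phi> (e 0) (e (Suc 0))) \<Longrightarrow>
      \<exists>C. finite C \<and> C \<subseteq> carrier R \<and>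
        (\<forall>l\<in>V - {\<zero>}. \<forall>b\<in>carrier R. \<forall>x\<in>carrier R. \<forall>y\<in>carrier R.
          (\<forall>c\<in>C. near l (x \<ominus> c) (y \<ominus> c)) \<longrightarrow>
          (\<exists>b'\<in>carrier R. near l b b' \<and> \<phi> x b') \<longrightarrow> (\<exists>b'\<in>carrier R. near l b b' \<and> \<phi> y b'))"
begin

section \<open>Definable terms and functions\<close>

lemma D_imp: "D P \<Longrightarrow> D Q \<Longrightarrow> D (\<lambda>e. P e \<longrightarrow> Q e)"
  by (rule D_cong[OF D_not[OF D_and[OF _ D_not]]]) auto

lemma D_all:
  assumes "D (\<lambda>e. P (e 0) (\<lambda>i. e (Suc i)))"
  shows "D (\<lambda>e. \<forall>x\<in>carrier R. P x e)"
proof -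
  have "D (\<lambda>e. \<not> (\<exists>x\<in>carrier R. \<not> P x e))" by (intro D_not D_ex assms)
  then show ?thesis by simp
qed

text \<open>Functions of the environment with definable graph; the value sits at position 0 and the
  arguments are shifted. Closure of \<open>T\<close> under the field operations lets introduction
  rules follow the syntax of a goal.\<close>

definition T :: "((nat \<Rightarrow> 'a) \<Rightarrow> 'a) \<Rightarrow> bool" where
  "T t \<longleftrightarrow> (\<forall>e. range e \<subseteq> carrier R \<longrightarrow> t e \<in> carrier R) \<and> D (\<lambda>e. e 0 = t (\<lambda>i. e (Suc i)))"

lemma T_closed: "T t \<Longrightarrow> range e \<subseteq> carrier R \<Longrightarrow> t e \<in> carrier R"
  by (simp add: T_def)

text \<open>Substituting a term amounts to quantifying over a new variable equal to it, which exists
  because terms stay in the carrier.\<close>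

lemma D_subst:
  assumes "T t" "D (\<lambda>e. Q (e 0) (\<lambda>i. e (Suc i)))"
  shows "D (\<lambda>e. Q (t e) e)"
proof -
  have "D (\<lambda>e. \<exists>x\<in>carrier R. x = t e \<and> Q x e)"
    by (intro D_ex D_and) (use assms in \<open>simp_all add: T_def\<close>)
  then show ?thesis
    by (rule D_cong) (use T_closed[OF assms(1)] in auto)
qed

lemma D_eq: "T s \<Longrightarrow> T t \<Longrightarrow> D (\<lambda>e. s e = t e)"
  by (rule D_subst[where Q = "\<lambda>x e. x = t e"]) (simp_all add: T_def)

lemma D_V: "T s \<Longrightarrow> D (\<lambda>e. s e \<in> V)"
  by (rule D_subst[where Q = "\<lambda>x e. x \<in> V"]) (simp_all add: D_var_V)

lemma T_weaken:
  assumes "T t"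
  shows "T (\<lambda>e. t (\<lambda>i. e (Suc i)))"
proof -
  \<comment> \<open>The renaming keeps the value at position 0 and skips position 1, where the new
    variable of the environment lives.\<close>
  have "inj (\<lambda>i. if i = 0 then 0 else Suc i)" by (auto simp: inj_def)
  then have "D (\<lambda>e. e 0 = t (\<lambda>i. e (Suc (Suc i))))"
    using D_rename[of "\<lambda>e. e 0 = t (\<lambda>i. e (Suc i))" "\<lambda>i. if i = 0 then 0 else Suc i"] assms
    by (simp add: T_def)
  moreover have "t (\<lambda>i. e (Suc i)) \<in> carrier R" if "range e \<subseteq> carrier R" for e
    using that by (intro T_closed[OF assms]) auto
  ultimately show ?thesis by (simp add: T_def)
qed

lemma T_var: "T (\<lambda>e. e i)"
  unfolding T_def by (auto intro: D_var_eq)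

lemma T_const: "c \<in> carrier R \<Longrightarrow> T (\<lambda>e. c)"
  unfolding T_def by (auto intro: D_var_const)

lemma T_binary:
  assumes "T s" "T t" "D (\<lambda>e. e (Suc (Suc 0)) = h (e (Suc 0)) (e 0))"
    and "\<And>x y. x \<in> carrier R \<Longrightarrow> y \<in> carrier R \<Longrightarrow> h x y \<in> carrier R"
  shows "T (\<lambda>e. h (s e) (t e))"
proof -
  have "D (\<lambda>e. e (Suc 0) = h (e 0) (t (\<lambda>i. e (Suc (Suc i)))))"
    by (rule D_subst[where Q = "\<lambda>x e. e (Suc 0) = h (e 0) x"]) (use assms in \<open>auto intro!: T_weaken\<close>)
  then have "D (\<lambda>e. e 0 = h (s (\<lambda>i. e (Suc i))) (t (\<lambda>i. e (Suc i))))"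
    by (intro D_subst[where Q = "\<lambda>x e. e 0 = h x (t (\<lambda>i. e (Suc i)))"]) (use assms in \<open>auto intro!: T_weaken\<close>)
  then show ?thesis using assms(4) T_closed[OF assms(1)] T_closed[OF assms(2)] by (simp add: T_def)
qed

lemma T_add: "T s \<Longrightarrow> T t \<Longrightarrow> T (\<lambda>e. s e \<oplus> t e)"
  by (rule T_binary) (auto intro: D_var_add)

lemma T_mult: "T s \<Longrightarrow> T t \<Longrightarrow> T (\<lambda>e. s e \<otimes> t e)"
  by (rule T_binary) (auto intro: D_var_mult)

lemma T_minus: "T s \<Longrightarrow> T t \<Longrightarrow> T (\<lambda>e. s e \<ominus> t e)"
proof (rule T_binary[where h = "\<lambda>x y. x \<ominus> y"])
  show "D (\<lambda>e. e (Suc (Suc 0)) = e (Suc 0) \<ominus> e 0)"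
  proof (rule D_cong[OF D_var_add[of 1 2 0]])
    fix e :: "nat \<Rightarrow> 'a" assume "range e \<subseteq> carrier R"
    then have *: "e 0 \<in> carrier R" "e (Suc 0) \<in> carrier R" "e (Suc (Suc 0)) \<in> carrier R" by auto
    have "b = c \<oplus> a \<longleftrightarrow> c = b \<ominus> a" if "a \<in> carrier R" "b \<in> carrier R" "c \<in> carrier R" for a b c
    proof
      show "b = c \<oplus> a \<Longrightarrow> c = b \<ominus> a" using that by algebra
      show "c = b \<ominus> a \<Longrightarrow> b = c \<oplus> a" using that by algebra
    qed
    from this[OF *] show "(e 1 = e 2 \<oplus> e 0) = (e (Suc (Suc 0)) = e (Suc 0) \<ominus> e 0)"
      by (simp add: numeral_2_eq_2)
  qed
qed auto

definition dfun :: "('a \<Rightarrow> 'a) \<Rightarrow> bool" where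
  "dfun f \<longleftrightarrow> (\<forall>x\<in>carrier R. f x \<in> carrier R) \<and> D (\<lambda>e. e (Suc 0) = f (e 0))"

lemma dfun_closed: "dfun f \<Longrightarrow> x \<in> carrier R \<Longrightarrow> f x \<in> carrier R"
  by (simp add: dfun_def)

lemma T_app: "dfun f \<Longrightarrow> T t \<Longrightarrow> T (\<lambda>e. f (t e))"
  unfolding T_def[of "\<lambda>e. f (t e)"]
  by (intro conjI D_subst[where Q = "\<lambda>x e. e 0 = f x"] T_weaken) (auto simp: dfun_def T_closed)

lemma dfunI:
  assumes "T (\<lambda>e. f (e 0))"
  shows "dfun f"
proof -
  have "D (\<lambda>e. e 0 = f (e (Suc 0)))" using assms by (simp add: T_def)
  moreover have "inj (\<lambda>i. if i = 0 then Suc 0 else if i = Suc 0 then 0 else i)" by (auto simp: inj_def)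
  ultimately have "D (\<lambda>e. e (Suc 0) = f (e 0))"
    using D_rename[of "\<lambda>e. e 0 = f (e (Suc 0))" "\<lambda>i. if i = 0 then Suc 0 else if i = Suc 0 then 0 else i"]
    by simp
  moreover have "f x \<in> carrier R" if "x \<in> carrier R" for x
    using T_closed[OF assms, of "\<lambda>_. x"] that by auto
  ultimately show ?thesis by (simp add: dfun_def)
qed

lemma D_le: "T s \<Longrightarrow> T t \<Longrightarrow> D (\<lambda>e. le (s e) (t e))"
proof -
  assume "T s" "T t"
  then have "D (\<lambda>e. \<exists>c\<in>carrier R. c \<in> V \<and> s e = c \<otimes> t e)"
    by (intro D_ex D_and D_V D_eq T_var T_mult T_weaken)
  then show ?thesis by (rule D_cong) (auto simp: le_def)
qed

lemma D_lt: "T s \<Longrightarrow> T t \<Longrightarrow> D (\<lambda>e. lt (s e) (t e))"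
  unfolding lt_def by (intro D_not D_le)

lemmas D_intros = D_not D_and D_imp D_ex D_all D_eq D_lt D_le T_var T_const T_add T_mult T_minus

section \<open>Finite sets preparing all fibres of a relation over leading terms\<close>

text \<open>Equality of the leading terms of \<open>x - c\<close> and \<open>y - c\<close> is
  replaced by a bound on \<open>|x - y|\<close>, the form in which preparation is applied to
  balls.\<close>

definition prepares_family :: "'a set \<Rightarrow> ('a \<Rightarrow> 'a \<Rightarrow> bool) \<Rightarrow> bool" where
  "prepares_family C \<phi> \<longleftrightarrow> finite C \<and> C \<subseteq> carrier R \<and>
     (\<forall>l\<in>V - {\<zero>}. \<forall>b\<in>carrier R. \<forall>x\<in>carrier R. \<forall>y\<in>carrier R.
       (\<forall>c\<in>C. lt (x \<ominus> y) (l \<otimes> (x \<ominus> c))) \<longrightarrow>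
       (\<exists>b'\<in>carrier R. near l b b' \<and> \<phi> x b') \<longrightarrow> (\<exists>b'\<in>carrier R. near l b b' \<and> \<phi> y b'))"

lemma prepares_familyD:
  assumes "prepares_family C \<phi>" "l \<in> V" "l \<noteq> \<zero>" "b \<in> carrier R" "x \<in> carrier R" "y \<in> carrier R"
    "\<And>c. c \<in> C \<Longrightarrow> lt (x \<ominus> y) (l \<otimes> (x \<ominus> c))"
    "\<exists>b'\<in>carrier R. near l b b' \<and> \<phi> x b'"
  shows "\<exists>b'\<in>carrier R. near l b b' \<and> \<phi> y b'"
  using assms unfolding prepares_family_def by simp

lemma prepares_family_finite: "prepares_family C \<phi> \<Longrightarrow> finite C"
  and prepares_family_carrier: "prepares_family C \<phi> \<Longrightarrow> C \<subseteq> carrier R"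
  by (simp_all add: prepares_family_def)

lemma ex_prepares_family:
  assumes "D (\<lambda>e. \<phi> (e 0) (e (Suc 0)))"
  shows "\<exists>C. prepares_family C \<phi>"
proof -
  obtain C where C: "finite C" "C \<subseteq> carrier R"
    "\<forall>l\<in>V - {\<zero>}. \<forall>b\<in>carrier R. \<forall>x\<in>carrier R. \<forall>y\<in>carrier R.
          (\<forall>c\<in>C. near l (x \<ominus> c) (y \<ominus> c)) \<longrightarrow>
          (\<exists>b'\<in>carrier R. near l b b' \<and> \<phi> x b') \<longrightarrow> (\<exists>b'\<in>carrier R. near l b b' \<and> \<phi> y b')"
    using prepare[OF assms] by (elim exE conjE) (rule that)
  have "near l (x \<ominus> c) (y \<ominus> c)"
    if "c \<in> C" "x \<in> carrier R" "y \<in> carrier R" "lt (x \<ominus> y) (l \<otimes> (x \<ominus> c))" for l x y c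
  proof -
    have "c \<in> carrier R" using C(2) that by auto
    then have "(x \<ominus> c) \<ominus> (y \<ominus> c) = x \<ominus> y" using that by algebra
    then show ?thesis using that by (simp add: near_def)
  qed
  then show ?thesis using C unfolding prepares_family_def by (intro exI[of _ C]) simp
qed

text \<open>The graph of \<open>g\<close> is prepared: the fibre over the leading term of
  \<open>g x\<close> contains \<open>x\<close>, hence also every \<open>y\<close> that is close to
  \<open>x\<close> relative to \<open>C\<close>.\<close>

lemma near_dfun:
  assumes "dfun g"
  shows "\<exists>C. finite C \<and> C \<subseteq> carrier R \<and> (\<forall>l x y. l \<in> V \<longrightarrow> l \<noteq> \<zero> \<longrightarrow> x \<in> carrier R \<longrightarrow> y \<in> carrier R \<longrightarrow>
      (\<forall>c\<in>C. lt (x \<ominus> y) (l \<otimes> (x \<ominus> c))) \<longrightarrow> near l (g x) (g y))"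
proof -
  have "D (\<lambda>e. g (e 0) = e (Suc 0))" by (intro D_intros T_app[OF assms])
  then obtain C where C: "prepares_family C (\<lambda>x b. g x = b)"
    using ex_prepares_family[of "\<lambda>x b. g x = b"] by blast
  have "near l (g x) (g y)" if "l \<in> V" "l \<noteq> \<zero>" "x \<in> carrier R" "y \<in> carrier R"
    "\<forall>c\<in>C. lt (x \<ominus> y) (l \<otimes> (x \<ominus> c))" for l x y
    using prepares_familyD[OF C, of l "g x" x y] that dfun_closed[OF assms] by auto
  then show ?thesis using prepares_family_finite[OF C] prepares_family_carrier[OF C] by blast
qed

end

section \<open>Balls on which a definable function scales all distances by one factor\<close>

context uniform_preparation begin

text \<open>Preparation in the source bounds \<open>|f x - f y|\<close> from above, and preparation
  of image sets in the target makes \<open>f\<close> onto large balls. With \<open>|s|\<close> the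
  distance from \<open>f x1\<close> to the finite set in the target, both radii agree, and
  injectivity turns surjectivity into the lower bound.\<close>

lemma scaled_isometry:
  assumes f: "dfun f" and x0: "x0 \<in> carrier R" and r: "r \<in> carrier R" "r \<noteq> \<zero>"
  obtains x1 s where "x1 \<in> carrier R" "s \<in> carrier R" "le (x1 \<ominus> x0) r"
    "\<And>x y. x \<in> carrier R \<Longrightarrow> y \<in> carrier R \<Longrightarrow> lt (x \<ominus> x1) r \<Longrightarrow> lt (y \<ominus> x1) r \<Longrightarrow>
      le ((f x \<ominus> f y) \<otimes> r) (s \<otimes> (x \<ominus> y)) \<and> le (s \<otimes> (x \<ominus> y)) ((f x \<ominus> f y) \<otimes> r)"
proof -
  have fc [simp]: "f x \<in> carrier R" if "x \<in> carrier R" for x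
    using dfun_closed[OF f that] .
  \<comment> \<open>Here the prepared variable is the target point: the fibre over the class of
    \<open>b\<close> is the image under \<open>f\<close> of all \<open>x0 + b'\<close> with
    \<open>b'\<close> in that class.\<close>
  have "D (\<lambda>e. f (x0 \<oplus> e (Suc 0)) = e 0)"
    by (intro D_intros T_app[OF f] x0)
  then obtain D0 where D0: "prepares_family D0 (\<lambda>z b. f (x0 \<oplus> b) = z)"
    using ex_prepares_family[of "\<lambda>z b. f (x0 \<oplus> b) = z"] by blast
  \<comment> \<open>Adding zero makes the set non-empty, so that an element closest to
    \<open>f x1\<close> exists.\<close>
  define D1 where "D1 = insert \<zero> D0"
  have D1: "finite D1" "D1 \<subseteq> carrier R"
    using prepares_family_finite[OF D0] prepares_family_carrier[OF D0] by (auto simp: D1_def)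
  define good where "good d C \<longleftrightarrow> finite C \<and> C \<subseteq> carrier R \<and>
    (\<forall>l x y. l \<in> V \<longrightarrow> l \<noteq> \<zero> \<longrightarrow> x \<in> carrier R \<longrightarrow> y \<in> carrier R \<longrightarrow>
      (\<forall>c\<in>C. lt (x \<ominus> y) (l \<otimes> (x \<ominus> c))) \<longrightarrow> near l (f x \<ominus> d) (f y \<ominus> d))" for d C
  have "\<exists>C. good d C" if "d \<in> D1" for d
  proof -
    have "d \<in> carrier R" using D1 that by auto
    then have "dfun (\<lambda>x. f x \<ominus> d)" by (intro dfunI D_intros T_app[OF f])
    then show ?thesis unfolding good_def by (rule near_dfun)
  qed
  then obtain Ce where Ce: "\<And>d. d \<in> D1 \<Longrightarrow> good d (Ce d)" by metis
  have Ce_fin: "finite (Ce d)" "Ce d \<subseteq> carrier R" if "d \<in> D1" for d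
    using Ce[OF that] by (simp_all add: good_def)
  \<comment> \<open>This family records coincidences \<open>f (x + b) = f x\<close>; it serves to
    copy one coincidence to all points of a ball.\<close>
  have "D (\<lambda>e. f (e 0 \<oplus> e (Suc 0)) = f (e 0))"
    by (intro D_intros T_app[OF f])
  then obtain Cw where Cw: "prepares_family Cw (\<lambda>x b. f (x \<oplus> b) = f x)"
    using ex_prepares_family[of "\<lambda>x b. f (x \<oplus> b) = f x"] by blast
  define C where "C = insert x0 (Cw \<union> (\<Union>d\<in>D1. Ce d))"
  have "(\<Union>d\<in>D1. Ce d) \<subseteq> carrier R" using Ce_fin(2) by blast
  then have C: "finite C" "C \<subseteq> carrier R"
    using prepares_family_finite[OF Cw] prepares_family_carrier[OF Cw] D1 Ce_fin(1) x0
    unfolding C_def by auto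
  obtain x1 where x1: "x1 \<in> carrier R" "le (x1 \<ominus> x0) r" "\<And>c. c \<in> C \<Longrightarrow> le r (x1 \<ominus> c)"
    using avoid[OF C x0 r] by blast
  \<comment> \<open>The ball \<open>B\<close> stays at distance at least \<open>|r|\<close> from
    \<open>C\<close>, so on \<open>B\<close> closeness relative to \<open>C\<close> follows from
    \<open>|x - y| < |l r|\<close>.\<close>
  define B where "B = {x \<in> carrier R. lt (x \<ominus> x1) r}"
  have Blt: "lt (x \<ominus> x1) r" if "x \<in> B" for x using that by (simp add: B_def)
  have BI: "x \<in> B" if "x \<in> carrier R" "lt (x \<ominus> x1) r" for x using that by (simp add: B_def)
  have Bc [simp]: "x \<in> carrier R" if "x \<in> B" for x using that by (simp add: B_def)
  have Bsym: "lt (x1 \<ominus> x) r" if "x \<in> B" for x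
    using Blt that x1(1) r(1) lt_dist_commute[of x x1 r] by simp
  have Bd: "lt (x \<ominus> y) r" if "x \<in> B" "y \<in> B" for x y
    using lt_dist_trans[of x x1 r y] that Blt[OF that(1)] Bsym[OF that(2)] x1(1) r(1) by simp
  have Bext: "y \<in> B" if "x \<in> B" "y \<in> carrier R" "lt (x \<ominus> y) r" for x y
    using lt_dist_trans[of y x r x1] that Blt[OF that(1)] x1(1) r(1) lt_dist_commute[of x y r]
    by (intro BI) simp_all
  have BC: "le r (x \<ominus> c)" if "x \<in> B" "c \<in> C" for x c
  proof (rule ccontr)
    assume "\<not> le r (x \<ominus> c)"
    then have "lt (x \<ominus> c) r" by (simp add: not_le)
    moreover have "c \<in> carrier R" using that C by auto
    moreover have "lt (x1 \<ominus> x) r" using Bsym[OF that(1)] .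
    ultimately have "lt (x1 \<ominus> c) r" using lt_dist_trans[of x1 x r c] that x1 r by simp
    then show False using x1(3)[OF that(2)] by (simp add: lt_def)
  qed
  have ltC: "lt (x \<ominus> y) (l \<otimes> (x \<ominus> c))"
    if "x \<in> B" "y \<in> B" "c \<in> C" "l \<in> V" "lt (x \<ominus> y) (l \<otimes> r)" for x y c l
  proof -
    have "c \<in> carrier R" using that C by auto
    moreover have "le (l \<otimes> r) (l \<otimes> (x \<ominus> c))" using BC[OF that(1,3)] calculation that r
      by (intro le_mult_left) auto
    ultimately show ?thesis using that r by (intro lt_le_trans[OF that(5)]) auto
  qed
  have lip: "near l (f x \<ominus> d) (f y \<ominus> d)"
    if "x \<in> B" "y \<in> B" "d \<in> D1" "l \<in> V" "l \<noteq> \<zero>" "lt (x \<ominus> y) (l \<otimes> r)" for x y d l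
  proof -
    have "\<forall>c\<in>Ce d. lt (x \<ominus> y) (l \<otimes> (x \<ominus> c))"
      using ltC[OF that(1,2) _ that(4,6)] that(3) by (auto simp: C_def)
    then show ?thesis using Ce[OF that(3)] that by (simp add: good_def)
  qed
  have lip1: "near \<one> (f x \<ominus> d) (f y \<ominus> d)" if "x \<in> B" "y \<in> B" "d \<in> D1" for x y d
    using lip[OF that, of \<one>] Bd[OF that(1,2)] r by simp
  show thesis
  proof (cases "\<exists>x\<in>B. f x \<in> D1")
    case True
    then obtain x where x: "x \<in> B" "f x \<in> D1" by blast
    \<comment> \<open>The leading term of \<open>f - f x\<close> is constant on \<open>B\<close> and
      zero at \<open>x\<close>. So \<open>f\<close> is constant there and the factor is
      zero.\<close>
    have const: "f y = f x" if "y \<in> B" for y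
    proof -
      have "f y \<ominus> f x = \<zero>"
        using lip1[OF x(1) that x(2)] x that by (auto simp: near_def)
      then show ?thesis using x that by simp
    qed
    show thesis
    proof (rule that[of x1 \<zero>])
      fix y z assume "y \<in> carrier R" "z \<in> carrier R" "lt (y \<ominus> x1) r" "lt (z \<ominus> x1) r"
      then have "y \<in> B" "z \<in> B" using BI by auto
      then have "f y \<ominus> f z = \<zero>" using const[of y] const[of z] x(1) by simp
      then show "le ((f y \<ominus> f z) \<otimes> r) (\<zero> \<otimes> (y \<ominus> z)) \<and> le (\<zero> \<otimes> (y \<ominus> z)) ((f y \<ominus> f z) \<otimes> r)"
        using r \<open>y \<in> carrier R\<close> \<open>z \<in> carrier R\<close> by simp
    qed (use x1 in auto)
  next
    case False
    have x1B: "x1 \<in> B" using x1 r by (intro BI) auto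
    obtain d where d: "d \<in> D1" "\<And>d'. d' \<in> D1 \<Longrightarrow> le (f x1 \<ominus> d) (f x1 \<ominus> d')"
    proof (rule ex_min[of D1 "\<lambda>d. f x1 \<ominus> d"])
      show "f x1 \<ominus> d' \<in> carrier R" if "d' \<in> D1" for d' using that D1 x1 by auto
    qed (use D1 in \<open>auto simp: D1_def\<close>)
    have dc [simp]: "d \<in> carrier R" using d D1 by auto
    \<comment> \<open>By \<open>lip1\<close>, all points of \<open>f\<close> on \<open>B\<close>
      have distance exactly \<open>|s|\<close> from \<open>d\<close>, and by minimality at least
      \<open>|s|\<close> from every element of \<open>D1\<close>.\<close>
    define s where "s = f x1 \<ominus> d"
    have s [simp]: "s \<in> carrier R" "s \<noteq> \<zero>"
      using False x1B x1 d by (auto simp: s_def)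
    have sle: "le s (f x \<ominus> d')" if "x \<in> B" "d' \<in> D1" for x d'
    proof -
      have "d' \<in> carrier R" using that D1 by auto
      then have "le (f x1 \<ominus> d') (f x \<ominus> d')"
        using near_le(1)[OF lip1[OF x1B that]] that x1 by simp
      then show ?thesis using le_trans[OF d(2)[OF that(2)]] that x1 \<open>d' \<in> carrier R\<close> by (simp add: s_def)
    qed
    have les: "le (f x \<ominus> d) s" if "x \<in> B" for x
      using near_le(2)[OF lip1[OF x1B that d(1)]] that x1 by (simp add: s_def)
    \<comment> \<open>Write \<open>f x - f y = l s\<close>. If \<open>|x - y| < |l r|\<close>, then
      \<open>lip\<close> would give \<open>|f x - f y| < |l s|\<close>.\<close>
    have upper: "le ((f x \<ominus> f y) \<otimes> r) (s \<otimes> (x \<ominus> y))" if xy: "x \<in> B" "y \<in> B" for x y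
    proof (cases "f x = f y")
      case False
      have e: "(f x \<ominus> d) \<ominus> (f y \<ominus> d) = f x \<ominus> f y"
        using fc[OF Bc[OF xy(1)]] fc[OF Bc[OF xy(2)]] dc by algebra
      have ne: "f x \<ominus> d \<noteq> f y \<ominus> d" using e False xy by (metis Bc dc fc minus_closed minus_eq_zero)
      have "lt (f x \<ominus> f y) (f x \<ominus> d)"
        using lip1[OF xy d(1)] ne e xy by (simp add: near_def)
      then have "lt (f x \<ominus> f y) s"
        using les[OF xy(1)] xy lt_le_trans[of "f x \<ominus> f y" "f x \<ominus> d" s] by simp
      then have "le (f x \<ominus> f y) s" using lt_imp_le xy by simp
      then obtain l where l: "l \<in> V" "f x \<ominus> f y = l \<otimes> s" unfolding le_def by blast
      have l0: "l \<noteq> \<zero>" using l False xy by auto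
      have "\<not> lt (x \<ominus> y) (l \<otimes> r)"
      proof
        assume "lt (x \<ominus> y) (l \<otimes> r)"
        then have "near l (f x \<ominus> d) (f y \<ominus> d)" using lip xy d(1) l l0 by blast
        then have "lt (f x \<ominus> f y) (l \<otimes> (f x \<ominus> d))" using ne e by (simp add: near_def)
        moreover have "le (l \<otimes> (f x \<ominus> d)) (l \<otimes> s)" using les[OF xy(1)] l xy by (intro le_mult_left) auto
        ultimately have "lt (f x \<ominus> f y) (l \<otimes> s)"
          using lt_le_trans[of "f x \<ominus> f y" "l \<otimes> (f x \<ominus> d)" "l \<otimes> s"] xy l by simp
        then show False using l xy by simp
      qed
      then have "le (l \<otimes> r) (x \<ominus> y)" by (simp add: lt_def)
      then have "le (s \<otimes> (l \<otimes> r)) (s \<otimes> (x \<ominus> y))" using l r xy by simp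
      moreover have "s \<otimes> (l \<otimes> r) = (f x \<ominus> f y) \<otimes> r" using l r by (simp add: m_ac)
      ultimately show ?thesis by simp
    qed (use xy r in simp)
    \<comment> \<open>\<open>f x\<close> lies in the image of the class of \<open>x - x0\<close>.
      Since \<open>D0\<close> is at distance at least \<open>|s|\<close> from \<open>f x\<close>,
      preparation puts \<open>z\<close> into this image as well, and points of the class differ from
      \<open>x\<close> by less than \<open>|l r|\<close> because
      \<open>|x - x0| \<le> |r|\<close>.\<close>
    have onto: "\<exists>y\<in>B. lt (x \<ominus> y) (l \<otimes> r) \<and> f y = z"
      if x: "x \<in> B" and l: "l \<in> V" "l \<noteq> \<zero>" and z: "z \<in> carrier R" "lt (f x \<ominus> z) (l \<otimes> s)" for x l z
    proof -
      have "lt (f x \<ominus> z) (l \<otimes> (f x \<ominus> c))" if "c \<in> D0" for c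
      proof -
        have c: "c \<in> D1" "c \<in> carrier R" using that D1 by (auto simp: D1_def)
        then have "le (l \<otimes> s) (l \<otimes> (f x \<ominus> c))" using sle[OF x c(1)] l x by simp
        then show ?thesis using z l x c by (intro lt_le_trans[OF z(2)]) auto
      qed
      moreover have "x0 \<oplus> (x \<ominus> x0) = x" using Bc[OF x] x0 by algebra
      ultimately obtain b' where b': "b' \<in> carrier R" "near l (x \<ominus> x0) b'" "f (x0 \<oplus> b') = z"
        using prepares_familyD[OF D0 l, of "x \<ominus> x0" "f x" z] x x0 z l by (metis Bc fc minus_closed near_refl)
      define y where "y = x0 \<oplus> b'"
      have yc: "y \<in> carrier R" using x0 b' by (simp add: y_def)
      have e: "x \<ominus> y = (x \<ominus> x0) \<ominus> b'" unfolding y_def using Bc[OF x] x0 b'(1) by algebra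
      have lr: "l \<otimes> r \<noteq> \<zero>" "l \<otimes> r \<in> carrier R" using l r by auto
      have "le (x \<ominus> x0) r"
      proof (rule le_dist_trans[of x x1])
        show "le (x \<ominus> x1) r" using Blt[OF x] x lt_imp_le x1 r by simp
      qed (use x x1 x0 r in auto)
      then have le: "le (l \<otimes> (x \<ominus> x0)) (l \<otimes> r)" using l x x0 r by simp
      have "x \<ominus> x0 = b' \<or> lt (x \<ominus> y) (l \<otimes> (x \<ominus> x0))"
        using b'(2) e by (auto simp: near_def)
      then have xy: "lt (x \<ominus> y) (l \<otimes> r)"
      proof
        assume "x \<ominus> x0 = b'"
        then have "x \<ominus> y = \<zero>" using e b' by (metis minus_eq_zero)
        then show ?thesis using lr by simp
      next
        assume "lt (x \<ominus> y) (l \<otimes> (x \<ominus> x0))"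
        then show ?thesis
          using le lt_le_trans[of "x \<ominus> y" "l \<otimes> (x \<ominus> x0)" "l \<otimes> r"] x yc l x0 r by simp
      qed
      have "le (l \<otimes> r) r" using l unfolding le_def by blast
      then have "lt (x \<ominus> y) r" using lt_le_trans[OF xy] x yc lr r by simp
      then have "y \<in> B" using Bext x yc by blast
      then show ?thesis using xy b'(3) unfolding y_def by blast
    qed
    \<comment> \<open>A coincidence is copied along \<open>B\<close> until one fibre of
      \<open>f\<close> is infinite. Some point of it avoids the finite set preparing this fibre, so
      \<open>f\<close> is constant near that point, which contradicts \<open>onto\<close>.\<close>
    have inj: "x = y" if xy: "x \<in> B" "y \<in> B" "f x = f y" for x y
    proof (rule ccontr)
      assume neq: "x \<noteq> y"
      define t where "t = y \<ominus> x"
      have t: "t \<in> carrier R" "t \<noteq> \<zero>" "lt t r" "x \<oplus> t = y"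
      proof -
        show "t \<in> carrier R" "t \<noteq> \<zero>" using xy neq by (auto simp: t_def)
        show "lt t r" using Bd[OF xy(2,1)] by (simp add: t_def)
        show "x \<oplus> t = y" unfolding t_def using Bc[OF xy(1)] Bc[OF xy(2)] by algebra
      qed
      have "\<forall>x'\<in>B. \<exists>t'. t' \<in> carrier R \<and> near \<one> t t' \<and> f (x' \<oplus> t') = f x'"
      proof
        fix x' assume x': "x' \<in> B"
        have "lt (x \<ominus> x') (\<one> \<otimes> (x \<ominus> c))" if "c \<in> Cw" for c
          using ltC[OF xy(1) x', of c \<one>] that Bd[OF xy(1) x'] r by (simp add: C_def)
        moreover have "\<exists>b'\<in>carrier R. near \<one> t b' \<and> f (x \<oplus> b') = f x"
          using t xy by (intro bexI[of _ t]) auto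
        ultimately show "\<exists>t'. t' \<in> carrier R \<and> near \<one> t t' \<and> f (x' \<oplus> t') = f x'"
          using prepares_familyD[OF Cw, of \<one> t x x'] t xy x' by (simp add: Bex_def)
      qed
      from bchoice[OF this] obtain \<tau> where \<tau>: "\<And>x'. x' \<in> B \<Longrightarrow> \<tau> x' \<in> carrier R"
        "\<And>x'. x' \<in> B \<Longrightarrow> near \<one> t (\<tau> x')" "\<And>x'. x' \<in> B \<Longrightarrow> f (x' \<oplus> \<tau> x') = f x'" by blast
      \<comment> \<open>Each step \<open>\<tau> (p n)\<close> has the leading term of
        \<open>t\<close>, so \<open>p n - x\<close> differs from \<open>n t\<close> by less than
        \<open>|t|\<close>. Distinct multiples of \<open>t\<close> are further apart, hence the
        points are distinct.\<close>
      define p where "p = rec_nat x (\<lambda>n q. q \<oplus> \<tau> q)"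
      have p0: "p 0 = x" and pS: "p (Suc n) = p n \<oplus> \<tau> (p n)" for n by (simp_all add: p_def)
      have p: "p n \<in> B \<and> f (p n) = f x \<and> lt ((p n \<ominus> x) \<ominus> [n] \<cdot> t) t" for n
      proof (induction n)
        case 0
        show ?case using xy t by (simp add: p0)
      next
        case (Suc n)
        then have pn: "p n \<in> B" and q: "p n \<in> carrier R" "\<tau> (p n) \<in> carrier R" using \<tau> by auto
        have pc: "p (Suc n) \<in> carrier R" using q by (simp add: pS)
        have "le (\<tau> (p n)) t" using near_le(2)[OF \<tau>(2)[OF pn]] t q by simp
        then have "lt (\<tau> (p n)) r" using le_lt_trans t q r by blast
        moreover have "p (Suc n) \<ominus> p n = \<tau> (p n)" unfolding pS using q by algebra
        ultimately have "lt (p n \<ominus> p (Suc n)) r" using lt_dist_commute[of "p n" "p (Suc n)" r] q pc r by simp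
        then have 1: "p (Suc n) \<in> B" using Bext[OF pn pc] by simp
        have "lt (\<tau> (p n) \<ominus> t) t"
          using \<tau>(2)[OF pn] t q lt_dist_commute[of t "\<tau> (p n)" t] by (auto simp: near_def)
        then have "lt (((p n \<ominus> x) \<ominus> [n] \<cdot> t) \<oplus> (\<tau> (p n) \<ominus> t)) t"
          using Suc q t xy by (intro lt_add) auto
        moreover have "(p (Suc n) \<ominus> x) \<ominus> ([n] \<cdot> t \<oplus> t) = ((p n \<ominus> x) \<ominus> [n] \<cdot> t) \<oplus> (\<tau> (p n) \<ominus> t)"
          unfolding pS using q t(1) Bc[OF xy(1)] add.nat_pow_closed[OF t(1), of n] by algebra
        ultimately show ?case using 1 Suc \<tau>(3)[OF pn] by (simp add: pS)
      qed
      have "inj p"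
      proof (rule injI, rule ccontr)
        fix n m assume nm: "p n = p m" "n \<noteq> m"
        have c: "[n] \<cdot> t \<in> carrier R" "[m] \<cdot> t \<in> carrier R" "p m \<ominus> x \<in> carrier R"
          using t p xy by auto
        have "lt ([n] \<cdot> t \<ominus> [m] \<cdot> t) t"
        proof (rule lt_dist_trans[of _ "p m \<ominus> x"])
          show "lt ([n] \<cdot> t \<ominus> (p m \<ominus> x)) t"
            using p[of n] nm c t lt_dist_commute by simp
          show "lt (p m \<ominus> x \<ominus> [m] \<cdot> t) t" using p by blast
        qed (use c t in auto)
        then show False using le_dist_nat_mult[OF nm(2) t(1)] by (simp add: lt_def)
      qed
      have "D (\<lambda>e. f (e 0) = f x)" by (intro D_intros T_app[OF f]) (use xy in simp)
      then obtain Cf where Cf: "prepares_family Cf (\<lambda>z b. f z = f x)"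
        using ex_prepares_family[of "\<lambda>z b. f z = f x"] by blast
      have "\<exists>n. p n \<notin> Cf"
        using \<open>inj p\<close> prepares_family_finite[OF Cf] by (meson finite_subset image_subsetI infinite_UNIV_nat finite_imageD)
      then obtain n where n: "p n \<notin> Cf" by blast
      define w where "w = p n"
      have w: "w \<in> B" "f w = f x" "w \<notin> Cf" using p n by (auto simp: w_def)
      \<comment> \<open>The extra point \<open>w - r\<close> bounds the distance \<open>|q|\<close>
        to the nearest point by \<open>|r|\<close>, so that \<open>q = l r\<close> with
        \<open>l\<close> in \<open>V\<close>.\<close>
      define Cf' where "Cf' = insert (w \<ominus> r) Cf"
      have Cf': "finite Cf'" "Cf' \<noteq> {}" "Cf' \<subseteq> carrier R"
        using prepares_family_finite[OF Cf] prepares_family_carrier[OF Cf] w r by (auto simp: Cf'_def)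
      have wr: "w \<ominus> (w \<ominus> r) = r" using Bc[OF w(1)] r(1) by algebra
      obtain c0 where c0: "c0 \<in> Cf'" "\<And>c. c \<in> Cf' \<Longrightarrow> le (w \<ominus> c0) (w \<ominus> c)"
      proof (rule ex_min[OF Cf', of "\<lambda>c. w \<ominus> c"])
        show "w \<ominus> c \<in> carrier R" if "c \<in> Cf'" for c using that Cf' w by auto
      qed blast
      have c0c: "c0 \<in> carrier R" using c0 Cf' by auto
      define q where "q = w \<ominus> c0"
      have "w \<ominus> r \<noteq> w" using wr r w by (metis Bc minus_eq_zero)
      then have q: "q \<in> carrier R" "q \<noteq> \<zero>" using w c0 c0c by (auto simp: q_def Cf'_def)
      have "le q r" using c0(2)[of "w \<ominus> r"] wr by (simp add: q_def Cf'_def)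
      then obtain l where l: "l \<in> V" "q = l \<otimes> r" unfolding le_def by blast
      have l0: "l \<noteq> \<zero>" using l q r by auto
      obtain k where k: "k \<in> carrier R" "k \<noteq> \<zero>" "lt k (l \<otimes> s)"
        using ex_small[of "l \<otimes> s"] l l0 by auto
      define z where "z = f w \<ominus> k"
      have zc: "z \<in> carrier R" using k w xy by (simp add: z_def)
      have fwz: "f w \<ominus> z = k" unfolding z_def using fc[OF Bc[OF w(1)]] k(1) by algebra
      obtain y' where y': "y' \<in> B" "lt (w \<ominus> y') q" "f y' = z"
        using onto[OF w(1) l(1) l0 zc] fwz k l by auto
      have "lt (w \<ominus> y') (\<one> \<otimes> (w \<ominus> c))" if "c \<in> Cf" for c
      proof -
        have "c \<in> carrier R" using that prepares_family_carrier[OF Cf] by auto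
        then show ?thesis using c0(2)[of c] that y' w q lt_le_trans[OF y'(2), of "w \<ominus> c"]
          by (simp add: q_def Cf'_def)
      qed
      \<comment> \<open>The prepared relation does not depend on its second argument, for which the
        class of zero is a dummy.\<close>
      then have "f y' = f x"
        using prepares_familyD[OF Cf, of \<one> \<zero> w y'] bexI[of "near \<one> \<zero>", OF near_refl] w y' by auto
      then have "k = \<zero>" using y' w fwz zc fc by (metis Bc minus_eq_zero)
      then show False using k by simp
    qed
    show thesis
    proof (rule that[of x1 s])
      fix x y assume "x \<in> carrier R" "y \<in> carrier R" "lt (x \<ominus> x1) r" "lt (y \<ominus> x1) r"
      then have xy: "x \<in> B" "y \<in> B" using BI by auto
      \<comment> \<open>Otherwise \<open>onto\<close> yields a preimage of \<open>f y\<close>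
        strictly closer to \<open>x\<close> than \<open>y\<close> is, against injectivity.\<close>
      have "le (s \<otimes> (x \<ominus> y)) ((f x \<ominus> f y) \<otimes> r)"
      proof (rule ccontr)
        assume "\<not> ?thesis"
        then have *: "lt ((f x \<ominus> f y) \<otimes> r) (s \<otimes> (x \<ominus> y))" by (simp add: not_le)
        then have "x \<noteq> y" using xy r by auto
        have "le (x \<ominus> y) r" using Bd[OF xy] lt_imp_le xy r by simp
        then obtain l where l: "l \<in> V" "x \<ominus> y = l \<otimes> r" unfolding le_def by blast
        have l0: "l \<noteq> \<zero>" using l \<open>x \<noteq> y\<close> xy r by auto
        have "s \<otimes> (x \<ominus> y) = (l \<otimes> s) \<otimes> r" using l r by (simp add: m_ac)
        then have "lt (f x \<ominus> f y) (l \<otimes> s)" using * xy r l by simp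
        then obtain y' where "y' \<in> B" "lt (x \<ominus> y') (l \<otimes> r)" "f y' = f y"
          using onto[OF xy(1) l(1) l0, of "f y"] xy by auto
        moreover from this have "y' = y" using inj xy by blast
        ultimately show False using l r xy by simp
      qed
      then show "le ((f x \<ominus> f y) \<otimes> r) (s \<otimes> (x \<ominus> y)) \<and> le (s \<otimes> (x \<ominus> y)) ((f x \<ominus> f y) \<otimes> r)"
        using upper[OF xy] by simp
    qed (use x1 in auto)
  qed
qed

end

section \<open>Strict differentiability\<close>

context valued begin

text \<open>The condition \<open>|(f y - f z) / (y - z) - a| < |\<epsilon>|\<close> is multiplied
  out, which avoids inverses in algebra and in definability arguments.\<close>

definition slope_approx :: "('a \<Rightarrow> 'a) \<Rightarrow> 'a \<Rightarrow> 'a \<Rightarrow> 'a \<Rightarrow> bool" where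
  "slope_approx f x \<epsilon> a \<longleftrightarrow> (\<exists>\<delta>\<in>carrier R. \<delta> \<noteq> \<zero> \<and> (\<forall>y\<in>carrier R. \<forall>z\<in>carrier R.
     y \<noteq> z \<longrightarrow> lt (x \<ominus> y) \<delta> \<longrightarrow> lt (x \<ominus> z) \<delta> \<longrightarrow>
     lt ((f y \<ominus> f z) \<ominus> a \<otimes> (y \<ominus> z)) (\<epsilon> \<otimes> (y \<ominus> z))))"

lemma slope_approx_mono:
  assumes "slope_approx f x \<epsilon> a" "le \<epsilon> \<epsilon>'"
    and "\<And>x. x \<in> carrier R \<Longrightarrow> f x \<in> carrier R" "\<epsilon> \<in> carrier R" "\<epsilon>' \<in> carrier R" "a \<in> carrier R"
  shows "slope_approx f x \<epsilon>' a"
proof -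
  obtain \<delta> where \<delta>: "\<delta> \<in> carrier R" "\<delta> \<noteq> \<zero>" and *: "\<forall>y\<in>carrier R. \<forall>z\<in>carrier R.
     y \<noteq> z \<longrightarrow> lt (x \<ominus> y) \<delta> \<longrightarrow> lt (x \<ominus> z) \<delta> \<longrightarrow>
     lt ((f y \<ominus> f z) \<ominus> a \<otimes> (y \<ominus> z)) (\<epsilon> \<otimes> (y \<ominus> z))"
    using assms(1) unfolding slope_approx_def by blast
  have "lt ((f y \<ominus> f z) \<ominus> a \<otimes> (y \<ominus> z)) (\<epsilon>' \<otimes> (y \<ominus> z))"
    if yz: "y \<in> carrier R" "z \<in> carrier R" "y \<noteq> z" "lt (x \<ominus> y) \<delta>" "lt (x \<ominus> z) \<delta>" for y z
  proof -
    have "le (\<epsilon> \<otimes> (y \<ominus> z)) (\<epsilon>' \<otimes> (y \<ominus> z))" using assms yz by simp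
    then show ?thesis
      using lt_le_trans[of "(f y \<ominus> f z) \<ominus> a \<otimes> (y \<ominus> z)" "\<epsilon> \<otimes> (y \<ominus> z)" "\<epsilon>' \<otimes> (y \<ominus> z)"] * yz assms by simp
  qed
  then show ?thesis using \<delta> unfolding slope_approx_def by blast
qed

lemma slope_approx_change:
  assumes "slope_approx f x \<epsilon> a" "lt (a \<ominus> b) \<epsilon>"
    and "\<And>x. x \<in> carrier R \<Longrightarrow> f x \<in> carrier R" "\<epsilon> \<in> carrier R" "a \<in> carrier R" "b \<in> carrier R"
  shows "slope_approx f x \<epsilon> b"
proof -
  obtain \<delta> where \<delta>: "\<delta> \<in> carrier R" "\<delta> \<noteq> \<zero>" and *: "\<forall>y\<in>carrier R. \<forall>z\<in>carrier R.
     y \<noteq> z \<longrightarrow> lt (x \<ominus> y) \<delta> \<longrightarrow> lt (x \<ominus> z) \<delta> \<longrightarrow>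
     lt ((f y \<ominus> f z) \<ominus> a \<otimes> (y \<ominus> z)) (\<epsilon> \<otimes> (y \<ominus> z))"
    using assms(1) unfolding slope_approx_def by blast
  have "lt ((f y \<ominus> f z) \<ominus> b \<otimes> (y \<ominus> z)) (\<epsilon> \<otimes> (y \<ominus> z))"
    if yz: "y \<in> carrier R" "z \<in> carrier R" "y \<noteq> z" "lt (x \<ominus> y) \<delta>" "lt (x \<ominus> z) \<delta>" for y z
  proof -
    have "(F \<ominus> a \<otimes> d) \<oplus> (a \<ominus> b) \<otimes> d = F \<ominus> b \<otimes> d"
      if "F \<in> carrier R" "d \<in> carrier R" for F d
      using that assms(5,6) by algebra
    from this[of "f y \<ominus> f z" "y \<ominus> z"]
    have "(f y \<ominus> f z) \<ominus> b \<otimes> (y \<ominus> z) = ((f y \<ominus> f z) \<ominus> a \<otimes> (y \<ominus> z)) \<oplus> (a \<ominus> b) \<otimes> (y \<ominus> z)"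
      using yz assms(3) by simp
    moreover have "lt ((a \<ominus> b) \<otimes> (y \<ominus> z)) (\<epsilon> \<otimes> (y \<ominus> z))" using assms yz by simp
    ultimately show ?thesis
      using lt_add[of "(f y \<ominus> f z) \<ominus> a \<otimes> (y \<ominus> z)" "\<epsilon> \<otimes> (y \<ominus> z)" "(a \<ominus> b) \<otimes> (y \<ominus> z)"] * yz assms by simp
  qed
  then show ?thesis using \<delta> unfolding slope_approx_def by blast
qed

text \<open>Both approximations are tested on the single pair \<open>x + h\<close>,
  \<open>x\<close>, and the common difference of \<open>f\<close> cancels.\<close>

lemma slope_approx_unique:
  assumes "slope_approx f x \<epsilon> a" "slope_approx f x \<epsilon> b" "x \<in> carrier R"
    and "\<And>x. x \<in> carrier R \<Longrightarrow> f x \<in> carrier R" "\<epsilon> \<in> carrier R" "a \<in> carrier R" "b \<in> carrier R"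
  shows "lt (a \<ominus> b) \<epsilon>"
proof -
  obtain \<delta> where \<delta>: "\<delta> \<in> carrier R" "\<delta> \<noteq> \<zero>" and 1: "\<forall>y\<in>carrier R. \<forall>z\<in>carrier R.
     y \<noteq> z \<longrightarrow> lt (x \<ominus> y) \<delta> \<longrightarrow> lt (x \<ominus> z) \<delta> \<longrightarrow>
     lt ((f y \<ominus> f z) \<ominus> a \<otimes> (y \<ominus> z)) (\<epsilon> \<otimes> (y \<ominus> z))"
    using assms(1) unfolding slope_approx_def by blast
  obtain \<delta>' where \<delta>': "\<delta>' \<in> carrier R" "\<delta>' \<noteq> \<zero>" and 2: "\<forall>y\<in>carrier R. \<forall>z\<in>carrier R.
     y \<noteq> z \<longrightarrow> lt (x \<ominus> y) \<delta>' \<longrightarrow> lt (x \<ominus> z) \<delta>' \<longrightarrow>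
     lt ((f y \<ominus> f z) \<ominus> b \<otimes> (y \<ominus> z)) (\<epsilon> \<otimes> (y \<ominus> z))"
    using assms(2) unfolding slope_approx_def by blast
  obtain h where h: "h \<in> carrier R" "h \<noteq> \<zero>" "lt h \<delta>" "lt h \<delta>'"
    using ex_small[OF \<delta>] ex_small[OF \<delta>'] le_total le_lt_trans \<delta> \<delta>' by metis
  define y where "y = x \<oplus> h"
  have y: "y \<in> carrier R" using h assms by (simp add: y_def)
  have e: "x \<ominus> y = \<ominus> h" "y \<ominus> x = h" unfolding y_def using h(1) assms(3) by algebra+
  have "y \<noteq> x" using e(2) h(2) minus_self[OF assms(3)] by metis
  have "lt (x \<ominus> y) \<delta>" "lt (x \<ominus> y) \<delta>'" "lt (x \<ominus> x) \<delta>" "lt (x \<ominus> x) \<delta>'"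
    using h \<delta> \<delta>' assms(3) unfolding e by (simp_all add: lt_def)
  then have a: "lt ((f y \<ominus> f x) \<ominus> a \<otimes> (y \<ominus> x)) (\<epsilon> \<otimes> (y \<ominus> x))"
    and b: "lt ((f y \<ominus> f x) \<ominus> b \<otimes> (y \<ominus> x)) (\<epsilon> \<otimes> (y \<ominus> x))"
    using 1 2 y assms(3) \<open>y \<noteq> x\<close> by blast+
  have c: "f y \<ominus> f x \<in> carrier R" using y assms by simp
  have "lt (b \<otimes> h \<ominus> a \<otimes> h) (\<epsilon> \<otimes> h)"
  proof (rule lt_dist_trans[of _ "f y \<ominus> f x"])
    show "lt (b \<otimes> h \<ominus> (f y \<ominus> f x)) (\<epsilon> \<otimes> h)"
      using b h c assms lt_dist_commute[of "b \<otimes> h" "f y \<ominus> f x" "\<epsilon> \<otimes> h"] unfolding e by simp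
    show "lt (f y \<ominus> f x \<ominus> a \<otimes> h) (\<epsilon> \<otimes> h)" using a unfolding e .
  qed (use h c assms in auto)
  moreover have "b \<otimes> h \<ominus> a \<otimes> h = (b \<ominus> a) \<otimes> h" using h(1) assms(6,7) by algebra
  ultimately have "lt (b \<ominus> a) \<epsilon>" using h assms by simp
  then show ?thesis using lt_dist_commute assms by simp
qed

end

section \<open>Existence of slopes away from a finite set\<close>

context uniform_preparation begin

lemma ex_radius:
  assumes "finite C" "C \<subseteq> carrier R" "x \<in> carrier R" "x \<notin> C"
  obtains q where "q \<in> carrier R" "q \<noteq> \<zero>" "\<And>c. c \<in> C \<Longrightarrow> le q (x \<ominus> c)"
proof (cases "C = {}")
  case True
  then show thesis using that[of \<one>] by simp
next
  case False
  obtain c where "c \<in> C" "\<And>d. d \<in> C \<Longrightarrow> le (x \<ominus> c) (x \<ominus> d)"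
  proof (rule ex_min[OF assms(1) False assms(2), of "\<lambda>c. x \<ominus> c"])
    show "x \<ominus> c \<in> carrier R" if "c \<in> C" for c using that assms by auto
  qed blast
  moreover have "c \<in> carrier R" if "c \<in> C" for c using that assms by auto
  ultimately show thesis using that[of "x \<ominus> c"] assms by auto
qed

text \<open>The difference quotient \<open>u\<close> of a fixed small step \<open>h\<close> is
  almost constant on a ball larger than \<open>|h|\<close>. After subtracting \<open>a x\<close>,
  the factor by which distances are scaled can be read off from the one pair \<open>x3\<close>,
  \<open>x3 + h\<close>.\<close>

lemma slope_approx_dense:
  assumes f: "dfun f" and z0: "z0 \<in> carrier R" and \<rho>: "\<rho> \<in> carrier R" "\<rho> \<noteq> \<zero>"
    and \<epsilon>: "\<epsilon> \<in> carrier R" "\<epsilon> \<noteq> \<zero>"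
  shows "\<exists>x\<in>carrier R. lt (z0 \<ominus> x) \<rho> \<and> (\<exists>a\<in>carrier R. slope_approx f x \<epsilon> a)"
proof -
  have fc [simp]: "f x \<in> carrier R" if "x \<in> carrier R" for x
    using dfun_closed[OF f that] .
  obtain q0 where q0: "q0 \<in> carrier R" "q0 \<noteq> \<zero>" "lt q0 \<rho>" using ex_small[OF \<rho>] .
  obtain x1 s where x1: "x1 \<in> carrier R" "s \<in> carrier R" "le (x1 \<ominus> z0) q0"
    and iso: "\<And>x y. x \<in> carrier R \<Longrightarrow> y \<in> carrier R \<Longrightarrow> lt (x \<ominus> x1) q0 \<Longrightarrow> lt (y \<ominus> x1) q0 \<Longrightarrow>
      le ((f x \<ominus> f y) \<otimes> q0) (s \<otimes> (x \<ominus> y)) \<and> le (s \<otimes> (x \<ominus> y)) ((f x \<ominus> f y) \<otimes> q0)"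
    using scaled_isometry[OF f z0 q0(1,2)] by blast
  obtain \<rho>1 where \<rho>1: "\<rho>1 \<in> carrier R" "\<rho>1 \<noteq> \<zero>" "lt \<rho>1 q0" using ex_small[OF q0(1,2)] .
  \<comment> \<open>On the first ball all difference quotients have value \<open>|s / q0|\<close>;
    multiplication by \<open>l\<close> brings this down to at most
    \<open>|\<epsilon>|\<close>.\<close>
  obtain l where l: "l \<in> V" "l \<noteq> \<zero>" "le (l \<otimes> s) (\<epsilon> \<otimes> q0)"
  proof (cases "le s (\<epsilon> \<otimes> q0)")
    case True
    then show thesis using that[of \<one>] x1 by simp
  next
    case False
    then have "le (\<epsilon> \<otimes> q0) s" using \<epsilon> q0 x1 by (simp add: not_le lt_imp_le)
    then obtain l where l: "l \<in> V" "\<epsilon> \<otimes> q0 = l \<otimes> s" unfolding le_def by blast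
    have "\<epsilon> \<otimes> q0 \<noteq> \<zero>" using \<epsilon> q0 by simp
    then have "l \<noteq> \<zero>" using l x1 by auto
    moreover have "le (l \<otimes> s) (\<epsilon> \<otimes> q0)" using l x1 by simp
    ultimately show thesis using that[of l] l by blast
  qed
  have lc: "l \<in> carrier R" using l by simp
  obtain r where r: "r \<in> carrier R" "r \<noteq> \<zero>" "lt r (l \<otimes> \<rho>1)"
    using ex_small[of "l \<otimes> \<rho>1"] l \<rho>1 by auto
  \<comment> \<open>The radii satisfy
    \<open>|h| < |r| < |l \<rho>1| \<le> |\<rho>1| < |q0| < |\<rho>|\<close>. The finite set
    \<open>C\<close> below depends on \<open>h\<close>, but the radii do not depend on
    \<open>C\<close>, which is avoided by moving the centre to \<open>x2\<close>.\<close>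
  obtain h where h: "h \<in> carrier R" "h \<noteq> \<zero>" "lt h r" using ex_small[OF r(1,2)] .
  have "le (l \<otimes> \<rho>1) \<rho>1" using l unfolding le_def by blast
  then have r1: "lt r \<rho>1" using lt_le_trans r l \<rho>1 by simp
  define u where "u x = (f (x \<oplus> h) \<ominus> f x) \<otimes> inv h" for x
  have u: "dfun u" unfolding u_def
    by (intro dfunI D_intros T_app[OF f]) (use h in auto)
  have uc [simp]: "u x \<in> carrier R" if "x \<in> carrier R" for x
    using dfun_closed[OF u that] .
  have uh: "f (x \<oplus> h) \<ominus> f x = u x \<otimes> h" if "x \<in> carrier R" for x
    unfolding u_def using that h by simp
  obtain C where C: "finite C" "C \<subseteq> carrier R" and Cu: "\<And>l x y. l \<in> V \<Longrightarrow> l \<noteq> \<zero> \<Longrightarrow>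
      x \<in> carrier R \<Longrightarrow> y \<in> carrier R \<Longrightarrow>
      (\<forall>c\<in>C. lt (x \<ominus> y) (l \<otimes> (x \<ominus> c))) \<Longrightarrow> near l (u x) (u y)"
    using near_dfun[OF u] by (elim exE conjE) simp
  obtain x2 where x2: "x2 \<in> carrier R" "le (x2 \<ominus> x1) \<rho>1" "\<And>c. c \<in> C \<Longrightarrow> le \<rho>1 (x2 \<ominus> c)"
    using avoid[OF C x1(1) \<rho>1(1,2)] by blast
  define a where "a = u x2"
  have a: "a \<in> carrier R" using x2 by (simp add: a_def)
  have ball: "lt (x \<ominus> x1) q0" if "x \<in> carrier R" "lt (x \<ominus> x2) \<rho>1" for x
  proof -
    have "lt (x \<ominus> x2) q0" using lt_trans[OF that(2) \<rho>1(3)] that x2 \<rho>1 q0 by simp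
    moreover have "lt (x2 \<ominus> x1) q0" using le_lt_trans[OF x2(2) \<rho>1(3)] x2 x1 \<rho>1 q0 by simp
    ultimately show ?thesis using lt_dist_trans[of x x2 q0 x1] that x1 x2 q0 by simp
  qed
  \<comment> \<open>Distinct near values satisfy \<open>|u x2 - u x| < |l u x2|\<close>, and
    \<open>|u x2|\<close> is at most \<open>|s / q0|\<close> by the first scaling.\<close>
  have uclose: "lt (a \<ominus> u x) \<epsilon>" if x: "x \<in> carrier R" "le (x \<ominus> x2) r" for x
  proof -
    have xx2: "lt (x \<ominus> x2) \<rho>1" using le_lt_trans[OF x(2) r1] x x2 r \<rho>1 by simp
    have "lt (x2 \<ominus> x) (l \<otimes> (x2 \<ominus> c))" if "c \<in> C" for c
    proof -
      have c: "c \<in> carrier R" using that C by auto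
      have "le (x2 \<ominus> x) r" using le_dist_commute x x2 r by simp
      then have "lt (x2 \<ominus> x) (l \<otimes> \<rho>1)" using le_lt_trans[OF _ r(3)] x x2 r lc \<rho>1 by simp
      moreover have "le (l \<otimes> \<rho>1) (l \<otimes> (x2 \<ominus> c))" using x2(3)[OF that] c x2 l lc \<rho>1 by simp
      ultimately show ?thesis
        using lt_le_trans[of "x2 \<ominus> x" "l \<otimes> \<rho>1" "l \<otimes> (x2 \<ominus> c)"] c x x2 lc \<rho>1 by simp
    qed
    then have nr: "near l (u x2) (u x)" using Cu[OF l(1,2) x2(1) x(1)] by simp
    have hr: "lt h \<rho>1" using lt_trans[OF h(3) r1] h r \<rho>1 by simp
    have "(x2 \<oplus> h) \<ominus> x2 = h" using x2(1) h(1) by algebra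
    then have "lt ((x2 \<oplus> h) \<ominus> x1) q0" "lt (x2 \<ominus> x1) q0"
      using ball[of "x2 \<oplus> h"] ball[of x2] hr x2 h \<rho>1 by simp_all
    then have "le ((f (x2 \<oplus> h) \<ominus> f x2) \<otimes> q0) (s \<otimes> ((x2 \<oplus> h) \<ominus> x2))"
      using iso[of "x2 \<oplus> h" x2] x2 h by simp
    then have "le (u x2 \<otimes> h \<otimes> q0) (s \<otimes> h)"
      using uh[OF x2(1)] \<open>(x2 \<oplus> h) \<ominus> x2 = h\<close> by simp
    moreover have "u x2 \<otimes> h \<otimes> q0 = (u x2 \<otimes> q0) \<otimes> h" using x2 h q0 by (simp add: m_ac)
    ultimately have "le (u x2 \<otimes> q0) s" using x2 h q0 x1 by simp
    then have "le (l \<otimes> (u x2 \<otimes> q0)) (l \<otimes> s)" using l lc x2 q0 x1 by simp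
    then have "le (l \<otimes> (u x2 \<otimes> q0)) (\<epsilon> \<otimes> q0)"
      using le_trans[OF _ l(3)] lc x2 q0 x1 \<epsilon> by simp
    moreover have "l \<otimes> (u x2 \<otimes> q0) = (l \<otimes> u x2) \<otimes> q0" using lc x2 q0 by (simp add: m_assoc)
    ultimately have le: "le (l \<otimes> u x2) \<epsilon>" using lc x2 q0 \<epsilon> by simp
    show ?thesis
    proof (cases "u x2 = u x")
      case True
      then show ?thesis using x \<epsilon> by (simp add: a_def)
    next
      case False
      then have "lt (u x2 \<ominus> u x) (l \<otimes> u x2)" using nr by (simp add: near_def)
      then show ?thesis using lt_le_trans[OF _ le] x x2 lc \<epsilon> by (simp add: a_def)
    qed
  qed
  define F where "F x = f x \<ominus> a \<otimes> x" for x
  have F: "dfun F" unfolding F_def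
    by (intro dfunI D_intros T_app[OF f] a)
  have Fc [simp]: "F x \<in> carrier R" if "x \<in> carrier R" for x
    using dfun_closed[OF F that] .
  have Fdiff: "F x \<ominus> F y = (f x \<ominus> f y) \<ominus> a \<otimes> (x \<ominus> y)"
    if "x \<in> carrier R" "y \<in> carrier R" for x y
    unfolding F_def using that a fc[OF that(1)] fc[OF that(2)] by algebra
  \<comment> \<open>Since \<open>|h| < |r|\<close>, the new ball contains \<open>x3 + h\<close>
    along with \<open>x3\<close>. Its factor \<open>|t / r|\<close> is therefore
    \<open>|u x3 - a|\<close>, which is below \<open>|\<epsilon>|\<close> by
    \<open>uclose\<close>.\<close>
  obtain x3 t where x3: "x3 \<in> carrier R" "t \<in> carrier R" "le (x3 \<ominus> x2) r"
    and iso': "\<And>x y. x \<in> carrier R \<Longrightarrow> y \<in> carrier R \<Longrightarrow> lt (x \<ominus> x3) r \<Longrightarrow> lt (y \<ominus> x3) r \<Longrightarrow>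
      le ((F x \<ominus> F y) \<otimes> r) (t \<otimes> (x \<ominus> y)) \<and> le (t \<otimes> (x \<ominus> y)) ((F x \<ominus> F y) \<otimes> r)"
    using scaled_isometry[OF F x2(1) r(1,2)] by blast
  have x3h: "(x3 \<oplus> h) \<ominus> x3 = h" using x3(1) h(1) by algebra
  have "le (t \<otimes> ((x3 \<oplus> h) \<ominus> x3)) ((F (x3 \<oplus> h) \<ominus> F x3) \<otimes> r)"
    using iso'[of "x3 \<oplus> h" x3] x3h x3 h r by simp
  moreover have "(F (x3 \<oplus> h) \<ominus> F x3) \<otimes> r = ((u x3 \<ominus> a) \<otimes> r) \<otimes> h"
  proof -
    have "F (x3 \<oplus> h) \<ominus> F x3 = u x3 \<otimes> h \<ominus> a \<otimes> h"
      using Fdiff[of "x3 \<oplus> h" x3] uh[OF x3(1)] x3h x3 h by simp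
    also have "\<dots> = (u x3 \<ominus> a) \<otimes> h" using uc[OF x3(1)] a h(1) by algebra
    finally show ?thesis using x3 a h r by (simp add: m_ac)
  qed
  ultimately have "le (t \<otimes> h) (((u x3 \<ominus> a) \<otimes> r) \<otimes> h)" using x3h by simp
  then have "le t ((u x3 \<ominus> a) \<otimes> r)" using x3 a h r by simp
  moreover have "lt ((u x3 \<ominus> a) \<otimes> r) (\<epsilon> \<otimes> r)"
    using uclose[OF x3(1,3)] lt_dist_commute[of a "u x3" \<epsilon>] x3 a r \<epsilon> by simp
  ultimately have t: "lt t (\<epsilon> \<otimes> r)"
    using le_lt_trans[of t "(u x3 \<ominus> a) \<otimes> r" "\<epsilon> \<otimes> r"] x3 a r \<epsilon> by simp
  have "slope_approx f x3 \<epsilon> a"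
    unfolding slope_approx_def
  proof (intro bexI[of _ r] conjI ballI impI)
    fix x y assume xy: "x \<in> carrier R" "y \<in> carrier R" "x \<noteq> y" "lt (x3 \<ominus> x) r" "lt (x3 \<ominus> y) r"
    then have "lt (x \<ominus> x3) r" "lt (y \<ominus> x3) r"
      using lt_dist_commute[of x3 x r] lt_dist_commute[of x3 y r] x3 r by simp_all
    then have "le ((F x \<ominus> F y) \<otimes> r) (t \<otimes> (x \<ominus> y))" using iso' xy by blast
    moreover have "lt (t \<otimes> (x \<ominus> y)) ((\<epsilon> \<otimes> r) \<otimes> (x \<ominus> y))" using t xy x3 \<epsilon> r by simp
    ultimately have "lt ((F x \<ominus> F y) \<otimes> r) ((\<epsilon> \<otimes> r) \<otimes> (x \<ominus> y))"
      using le_lt_trans[of "(F x \<ominus> F y) \<otimes> r" "t \<otimes> (x \<ominus> y)" "(\<epsilon> \<otimes> r) \<otimes> (x \<ominus> y)"] xy x3 \<epsilon> r by simp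
    moreover have "(\<epsilon> \<otimes> r) \<otimes> (x \<ominus> y) = (\<epsilon> \<otimes> (x \<ominus> y)) \<otimes> r" using xy \<epsilon> r by (simp add: m_ac)
    ultimately have "lt (F x \<ominus> F y) (\<epsilon> \<otimes> (x \<ominus> y))" using xy \<epsilon> r by simp
    then show "lt (f x \<ominus> f y \<ominus> a \<otimes> (x \<ominus> y)) (\<epsilon> \<otimes> (x \<ominus> y))" using Fdiff[OF xy(1,2)] by simp
  qed (use r in auto)
  moreover have "lt (z0 \<ominus> x3) \<rho>"
  proof -
    have "lt (x3 \<ominus> x2) \<rho>1" using le_lt_trans[OF x3(3) r1] x3 x2 r \<rho>1 by simp
    then have "lt (x3 \<ominus> x1) q0" using ball x3 by simp
    then have "lt (x1 \<ominus> x3) \<rho>" using lt_trans[OF _ q0(3)] lt_dist_commute[of x3 x1 q0] x3 x1 q0 \<rho> by simp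
    moreover have "lt (z0 \<ominus> x1) \<rho>"
      using le_lt_trans[OF x1(3) q0(3)] lt_dist_commute[of x1 z0 \<rho>] x1 z0 q0 \<rho> by simp
    ultimately show ?thesis using lt_dist_trans[of z0 x1 \<rho> x3] z0 x1 x3 \<rho> by simp
  qed
  ultimately show ?thesis using x3 a by blast
qed

lemma D_slope_approx:
  assumes f: "dfun f" and "T s" "T t" "T v"
  shows "D (\<lambda>e. slope_approx f (s e) (t e) (v e))"
proof -
  have "D (\<lambda>e. \<exists>\<delta>\<in>carrier R. \<not> \<delta> = \<zero> \<and> (\<forall>y\<in>carrier R. \<forall>z\<in>carrier R.
     \<not> y = z \<longrightarrow> lt (s e \<ominus> y) \<delta> \<longrightarrow> lt (s e \<ominus> z) \<delta> \<longrightarrow>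
     lt ((f y \<ominus> f z) \<ominus> v e \<otimes> (y \<ominus> z)) (t e \<otimes> (y \<ominus> z))))"
    by (intro D_intros T_app[OF f] T_weaken assms(2-) zero_closed)
  then show ?thesis by (simp add: slope_approx_def)
qed

text \<open>The second argument of the prepared relation is the precision itself, so one
  \<open>C\<close> handles all precisions. Off \<open>C\<close>, a failure at \<open>x\<close> would
  spread to a whole ball, with a precision of the same value, and contradict density.\<close>

lemma slope_approx_cofinite:
  assumes f: "dfun f"
  shows "\<exists>C. finite C \<and> (\<forall>x\<in>carrier R - C. \<forall>\<epsilon>\<in>carrier R - {\<zero>}. \<exists>a\<in>carrier R. slope_approx f x \<epsilon> a)"
proof -
  have "D (\<lambda>e. \<not> (\<exists>a\<in>carrier R. slope_approx f (e 0) (e (Suc 0)) a))"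
    by (intro D_not D_ex D_slope_approx[OF f] T_var)
  then obtain C where C: "prepares_family C (\<lambda>x \<epsilon>. \<not> (\<exists>a\<in>carrier R. slope_approx f x \<epsilon> a))"
    using ex_prepares_family[of "\<lambda>x \<epsilon>. \<not> (\<exists>a\<in>carrier R. slope_approx f x \<epsilon> a)"] by blast
  have "\<exists>a\<in>carrier R. slope_approx f x \<epsilon> a"
    if x: "x \<in> carrier R" "x \<notin> C" and \<epsilon>: "\<epsilon> \<in> carrier R" "\<epsilon> \<noteq> \<zero>" for x \<epsilon>
  proof (rule ccontr)
    assume bad: "\<not> ?thesis"
    obtain q where q: "q \<in> carrier R" "q \<noteq> \<zero>" "\<And>c. c \<in> C \<Longrightarrow> le q (x \<ominus> c)"
      using ex_radius[OF prepares_family_finite[OF C] prepares_family_carrier[OF C] x] by blast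
    obtain y a where y: "y \<in> carrier R" "lt (x \<ominus> y) q" and a: "a \<in> carrier R" "slope_approx f y \<epsilon> a"
      using slope_approx_dense[OF f x(1) q(1,2) \<epsilon>] by blast
    have "lt (x \<ominus> y) (\<one> \<otimes> (x \<ominus> c))" if "c \<in> C" for c
    proof -
      have "c \<in> carrier R" using that prepares_family_carrier[OF C] by auto
      then show ?thesis using lt_le_trans[OF y(2) q(3)[OF that]] x y q by simp
    qed
    moreover have "\<exists>\<epsilon>'\<in>carrier R. near \<one> \<epsilon> \<epsilon>' \<and> \<not> (\<exists>a\<in>carrier R. slope_approx f x \<epsilon>' a)"
      using bad \<epsilon> by (intro bexI[of _ \<epsilon>]) auto
    ultimately obtain \<epsilon>' where \<epsilon>': "\<epsilon>' \<in> carrier R" "near \<one> \<epsilon> \<epsilon>'"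
      and no: "\<not> (\<exists>a\<in>carrier R. slope_approx f y \<epsilon>' a)"
      using prepares_familyD[OF C, of \<one> \<epsilon> x y] x y \<epsilon> by auto
    have "slope_approx f y \<epsilon>' a"
      using slope_approx_mono[OF a(2) near_le(1)[OF \<epsilon>'(2)]] \<epsilon>' \<epsilon> a dfun_closed[OF f] by simp
    then show False using no a by blast
  qed
  then show ?thesis using prepares_family_finite[OF C] by blast
qed

text \<open>The candidates for the slope at a given precision form a ball. If no point of the
  preparing set lay in all these balls, one of them would be far from this set compared with its
  radius, and preparation would enlarge it beyond that radius.\<close>

lemma slope_limit:
  assumes f: "dfun f" and x: "x \<in> carrier R"
    and approx: "\<And>\<epsilon>. \<epsilon> \<in> carrier R \<Longrightarrow> \<epsilon> \<noteq> \<zero> \<Longrightarrow> \<exists>a\<in>carrier R. slope_approx f x \<epsilon> a"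
  shows "\<exists>a\<in>carrier R. \<forall>\<epsilon>\<in>carrier R - {\<zero>}. slope_approx f x \<epsilon> a"
proof -
  note fc = dfun_closed[OF f]
  have "D (\<lambda>e. slope_approx f x (e (Suc 0)) (e 0))"
    by (intro D_slope_approx[OF f] T_var T_const x)
  then obtain C where C: "prepares_family C (\<lambda>a \<epsilon>. slope_approx f x \<epsilon> a)"
    using ex_prepares_family[of "\<lambda>a \<epsilon>. slope_approx f x \<epsilon> a"] by blast
  have Cc: "c \<in> carrier R" if "c \<in> C" for c using that prepares_family_carrier[OF C] by auto
  have "\<exists>c\<in>C. \<forall>\<epsilon>\<in>carrier R - {\<zero>}. slope_approx f x \<epsilon> c"
  proof (rule ccontr)
    assume "\<not> ?thesis"
    then have "\<forall>c\<in>C. \<exists>\<epsilon>. \<epsilon> \<in> carrier R \<and> \<epsilon> \<noteq> \<zero> \<and> \<not> slope_approx f x \<epsilon> c" by blast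
    from bchoice[OF this] obtain E where E: "\<And>c. c \<in> C \<Longrightarrow> E c \<in> carrier R"
      "\<And>c. c \<in> C \<Longrightarrow> E c \<noteq> \<zero>" "\<And>c. c \<in> C \<Longrightarrow> \<not> slope_approx f x (E c) c" by blast
    have "finite (E ` C)" "E ` C \<subseteq> carrier R"
      using prepares_family_finite[OF C] E by auto
    moreover have "\<zero> \<notin> E ` C" using E(2) by (metis imageE)
    ultimately obtain e where e: "e \<in> carrier R" "e \<noteq> \<zero>" "\<And>c. c \<in> C \<Longrightarrow> le e (E c)"
    proof -
      assume fin: "finite (E ` C)" "E ` C \<subseteq> carrier R" "\<zero> \<notin> E ` C"
      \<comment> \<open>A radius around zero that avoids the finitely many \<open>E c\<close> is a
        common lower bound for their values.\<close>
      obtain q where q: "q \<in> carrier R" "q \<noteq> \<zero>" "\<And>c. c \<in> E ` C \<Longrightarrow> le q (\<zero> \<ominus> c)"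
        using ex_radius[OF fin(1,2) zero_closed fin(3)] by blast
      have "le q (E c)" if "c \<in> C" for c
      proof -
        have "le q (\<zero> \<ominus> E c)" using q(3) that by blast
        then show ?thesis using E(1)[OF that] q by (simp add: a_minus_def)
      qed
      then show thesis using that q by blast
    qed
    have bad: "\<not> slope_approx f x e c" if "c \<in> C" for c
      using slope_approx_mono[of f x e c "E c", OF _ e(3)[OF that] fc] E[OF that] e Cc[OF that] by blast
    obtain e2 where e2: "e2 \<in> carrier R" "e2 \<noteq> \<zero>" "lt e2 e" using ex_small[OF e(1,2)] .
    obtain a where a: "a \<in> carrier R" "slope_approx f x e2 a" using approx[OF e2(1,2)] by blast
    have ae: "slope_approx f x e a"
      using slope_approx_mono[OF a(2) lt_imp_le[OF e2(3)]] e2 e a fc by simp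
    have far: "le e (a \<ominus> c)" if "c \<in> C" for c
    proof (rule ccontr)
      assume "\<not> ?thesis"
      then have "lt (a \<ominus> c) e" by (simp add: not_le)
      then have "slope_approx f x e c" using slope_approx_change[OF ae] fc e a Cc[OF that] by simp
      then show False using bad that by blast
    qed
    \<comment> \<open>\<open>b\<close> has distance exactly \<open>|e2|\<close> from
      \<open>a\<close>, closer than any element of \<open>C\<close>. Preparation makes it a
      candidate, while candidates at precision \<open>e2\<close> lie at distance below
      \<open>|e2|\<close>.\<close>
    define b where "b = a \<ominus> e2"
    have b: "b \<in> carrier R" using a e2 by (simp add: b_def)
    have ab: "a \<ominus> b = e2" unfolding b_def using a(1) e2(1) by algebra
    have "lt (a \<ominus> b) (\<one> \<otimes> (a \<ominus> c))" if "c \<in> C" for c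
      using lt_le_trans[OF e2(3) far[OF that]] ab a e e2 Cc[OF that] by simp
    moreover have "\<exists>e'\<in>carrier R. near \<one> e2 e' \<and> slope_approx f x e' a"
      using a e2 by (intro bexI[of _ e2]) auto
    ultimately obtain e' where e': "e' \<in> carrier R" "near \<one> e2 e'" "slope_approx f x e' b"
      using prepares_familyD[OF C, of \<one> e2 a b] a b e2 by auto
    then have "slope_approx f x e2 b"
      using slope_approx_mono[OF e'(3) near_le(2)[OF e'(2)]] e2 b fc by simp
    then have "lt (a \<ominus> b) e2"
      using slope_approx_unique[OF a(2)] x fc e2 a b by blast
    then show False using ab e2 by simp
  qed
  then show ?thesis using Cc by blast
qed

theorem strict_derivative_cofinite:
  assumes "dfun f"
  shows "finite {x \<in> carrier R. \<not> (\<exists>a\<in>carrier R. \<forall>\<epsilon>\<in>carrier R - {\<zero>}. slope_approx f x \<epsilon> a)}"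
proof -
  obtain C where C: "finite C" "\<forall>x\<in>carrier R - C. \<forall>\<epsilon>\<in>carrier R - {\<zero>}. \<exists>a\<in>carrier R. slope_approx f x \<epsilon> a"
    using slope_approx_cofinite[OF assms] by blast
  have "x \<in> C" if "x \<in> carrier R" "\<not> (\<exists>a\<in>carrier R. \<forall>\<epsilon>\<in>carrier R - {\<zero>}. slope_approx f x \<epsilon> a)" for x
  proof (rule ccontr)
    assume "x \<notin> C"
    then have "\<exists>a\<in>carrier R. slope_approx f x \<epsilon> a" if "\<epsilon> \<in> carrier R" "\<epsilon> \<noteq> \<zero>" for \<epsilon>
      using C(2) \<open>x \<in> carrier R\<close> that by blast
    then show False using slope_limit[OF assms \<open>x \<in> carrier R\<close>] that(2) by blast
  qed
  then show ?thesis using C(1) by (auto intro: finite_subset)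
qed

end

section \<open>Values and leading terms in structures\<close>

context valuation_subring begin

lemma minus_distr:
  "x \<in> carrier R \<Longrightarrow> y \<in> carrier R \<Longrightarrow> z \<in> carrier R \<Longrightarrow> (x \<ominus> y) \<otimes> z = x \<otimes> z \<ominus> y \<otimes> z"
  by algebra

lemma V_iff: "x \<in> V \<longleftrightarrow> x \<in> carrier R \<and> le x \<one>"
  unfolding le_def by (metis V_carrier r_one)

lemma Units_V: "Units (R\<lparr>carrier := V\<rparr>) = {u \<in> V. le \<one> u}"
proof -
  have "(\<exists>x\<in>V. x \<otimes> u = \<one> \<and> u \<otimes> x = \<one>) \<longleftrightarrow> (\<exists>x\<in>V. \<one> = x \<otimes> u)" if "u \<in> V" for u
    using that m_comm V_carrier by metis
  then show ?thesis by (auto simp: Units_def le_def)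
qed

lemma nonunits_V: "V - Units (R\<lparr>carrier := V\<rparr>) = {x \<in> carrier R. lt x \<one>}"
  unfolding Units_V by (auto simp: V_iff lt_def dest: le_total[OF one_closed])

text \<open>A quotient of two elements of equal nonzero value is a unit of \<open>V\<close>; for
  \<open>x = \<zero>\<close> both sides are the singleton of zero.\<close>

lemma value_class:
  assumes "x \<in> carrier R"
  shows "{x \<otimes> u |u. u \<in> Units (R\<lparr>carrier := V\<rparr>)} = {y \<in> carrier R. le x y \<and> le y x}"
proof (intro Set.set_eqI iffI)
  fix y assume "y \<in> {x \<otimes> u |u. u \<in> Units (R\<lparr>carrier := V\<rparr>)}"
  then obtain u where u: "u \<in> V" "le \<one> u" "y = x \<otimes> u" by (auto simp: Units_V)
  have "le (x \<otimes> \<one>) (x \<otimes> u)" using u assms by (intro le_mult_left) auto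
  moreover have "le (x \<otimes> u) x" unfolding le_def using u assms by (intro bexI[of _ u]) (auto simp: m_comm)
  ultimately show "y \<in> {y \<in> carrier R. le x y \<and> le y x}" using u assms by simp
next
  fix y assume "y \<in> {y \<in> carrier R. le x y \<and> le y x}"
  then have y: "y \<in> carrier R" "le x y" "le y x" by auto
  show "y \<in> {x \<otimes> u |u. u \<in> Units (R\<lparr>carrier := V\<rparr>)}"
  proof (cases "x = \<zero>")
    case True
    then have "y = \<zero>" using y by simp
    then show ?thesis using True by (auto simp: Units_V intro!: exI[of _ \<one>])
  next
    case False
    obtain c where c: "c \<in> V" "y = c \<otimes> x" using y(3) unfolding le_def by blast
    have "le (\<one> \<otimes> x) (c \<otimes> x)" using y(2) c assms by simp
    then have "le \<one> c" using c False assms by (subst (asm) le_mult_right_iff) auto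
    then show ?thesis using c assms by (auto simp: Units_V m_comm intro!: exI[of _ c])
  qed
qed

lemma value_class_eq_iff:
  assumes "x \<in> carrier R" "y \<in> carrier R"
  shows "{z \<in> carrier R. le x z \<and> le z x} = {z \<in> carrier R. le y z \<and> le z y} \<longleftrightarrow> le x y \<and> le y x"
  using assms le_trans le_refl by blast

text \<open>Dividing by \<open>x\<close> turns \<open>|z - x| < |l x|\<close> into
  \<open>|z / x - 1| < |l|\<close>; for \<open>x = \<zero>\<close> both sides are the singleton of
  zero.\<close>

lemma near_set:
  assumes "x \<in> carrier R" "l \<in> carrier R" "l \<noteq> \<zero>"
  shows "{x \<otimes> (\<one> \<oplus> y) |y. y \<in> carrier R \<and> lt y l} = {z \<in> carrier R. near l x z}"
proof (intro Set.set_eqI iffI)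
  fix z assume "z \<in> {x \<otimes> (\<one> \<oplus> y) |y. y \<in> carrier R \<and> lt y l}"
  then obtain y where y: "y \<in> carrier R" "lt y l" "z = x \<otimes> (\<one> \<oplus> y)" by blast
  have e: "x \<ominus> z = \<ominus> (x \<otimes> y)" unfolding y(3) using y(1) assms(1) by algebra
  have "x = z \<or> lt (x \<otimes> y) (x \<otimes> l)"
    using y assms by (cases "x = \<zero>") auto
  then have "near l x z" using e y assms by (auto simp: near_def m_comm lt_def)
  then show "z \<in> {z \<in> carrier R. near l x z}" using y assms by simp
next
  fix z assume "z \<in> {z \<in> carrier R. near l x z}"
  then have z: "z \<in> carrier R" "near l x z" by auto
  show "z \<in> {x \<otimes> (\<one> \<oplus> y) |y. y \<in> carrier R \<and> lt y l}"
  proof (cases "x = z")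
    case True
    then show ?thesis using z assms by (intro CollectI exI[of _ \<zero>]) auto
  next
    case False
    then have lt: "lt (x \<ominus> z) (l \<otimes> x)" using z by (simp add: near_def)
    have x0: "x \<noteq> \<zero>" using lt assms z by auto
    define y where "y = (z \<ominus> x) \<otimes> inv x"
    have yc: "y \<in> carrier R" using x0 z assms by (simp add: y_def)
    have xy: "x \<otimes> y = z \<ominus> x" using x0 z assms by (simp add: y_def)
    have "x \<otimes> (\<one> \<oplus> y) = x \<oplus> x \<otimes> y" using assms yc by algebra
    also have "\<dots> = z" unfolding xy using assms(1) z(1) by algebra
    finally have "z = x \<otimes> (\<one> \<oplus> y)" by simp
    moreover have "lt (x \<otimes> y) (x \<otimes> l)"
      unfolding xy using lt lt_dist_commute[of x z "l \<otimes> x"] assms z by (simp add: m_comm)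
    then have "lt y l" using x0 yc assms by simp
    ultimately show ?thesis using yc by blast
  qed
qed

lemma nonunits_ideal: "ideal {x \<in> carrier R. lt x \<one>} (R\<lparr>carrier := V\<rparr>)"
proof (rule idealI)
  show "ring (R\<lparr>carrier := V\<rparr>)" using subring_is_ring[OF V_subring] .
  then interpret S: ring "R\<lparr>carrier := V\<rparr>" .
  have V: "x \<in> V" if "x \<in> carrier R" "lt x \<one>" for x
    using that lt_imp_le[of x \<one>] by (intro V_iff[THEN iffD2]) simp
  show "subgroup {x \<in> carrier R. lt x \<one>} (add_monoid (R\<lparr>carrier := V\<rparr>))"
  proof (rule S.add.subgroupI)
    fix a assume a: "a \<in> {x \<in> carrier R. lt x \<one>}"
    then have aV: "a \<in> V" using V by simp
    have "a \<oplus> (\<ominus>\<^bsub>R\<lparr>carrier := V\<rparr>\<^esub> a) = \<zero>" "\<ominus>\<^bsub>R\<lparr>carrier := V\<rparr>\<^esub> a \<in> V"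
      using S.r_neg[of a] S.a_inv_closed[of a] aV by simp_all
    then have "\<ominus>\<^bsub>R\<lparr>carrier := V\<rparr>\<^esub> a = \<ominus> a" using aV by (metis V_carrier add.inv_comm minus_equality)
    then show "\<ominus>\<^bsub>R\<lparr>carrier := V\<rparr>\<^esub> a \<in> {x \<in> carrier R. lt x \<one>}" using a by (simp add: lt_def)
  qed (use V in \<open>auto intro: lt_add\<close>)
  fix a x assume a: "a \<in> {x \<in> carrier R. lt x \<one>}" and x: "x \<in> carrier (R\<lparr>carrier := V\<rparr>)"
  have "le (x \<otimes> a) a" unfolding le_def using x by auto
  then have *: "lt (x \<otimes> a) \<one>" using le_lt_trans[of "x \<otimes> a" a \<one>] a x by simp
  then show "x \<otimes>\<^bsub>R\<lparr>carrier := V\<rparr>\<^esub> a \<in> {x \<in> carrier R. lt x \<one>}" using a x by simp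
  show "a \<otimes>\<^bsub>R\<lparr>carrier := V\<rparr>\<^esub> x \<in> {x \<in> carrier R. lt x \<one>}" using * a x by (simp add: m_comm)
qed

text \<open>A positive integer in the maximal ideal would have residue zero; outside this ideal it
  is invertible in \<open>V\<close>.\<close>

lemma valued_of_residue_char:
  assumes "char_zero ((R\<lparr>carrier := V\<rparr>) Quot (V - Units (R\<lparr>carrier := V\<rparr>)))"
  shows "valued R V"
proof (unfold_locales)
  fix n :: nat assume n: "n > 0"
  let ?S = "R\<lparr>carrier := V\<rparr>" and ?I = "{x \<in> carrier R. lt x \<one>}"
  interpret I: ideal ?I ?S by (rule nonunits_ideal)
  interpret h: ring_hom_ring ?S "?S Quot ?I" "(+>\<^bsub>?S\<^esub>) ?I" by (rule I.rcos_ring_hom_ring)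
  have S: "[k] \<cdot>\<^bsub>?S\<^esub> \<one> = [k] \<cdot> \<one>" for k :: nat
    by (simp add: add_pow_def nat_pow_def)
  have h: "[k] \<cdot>\<^bsub>?S Quot ?I\<^esub> \<one>\<^bsub>?S Quot ?I\<^esub> = ?I +>\<^bsub>?S\<^esub> ([k] \<cdot> \<one>)" for k :: nat
  proof (induction k)
    case 0
    then show ?case using h.hom_zero by simp
  next
    case (Suc k)
    have "[k] \<cdot> \<one> \<in> V" by (rule nat_V)
    then show ?case using Suc h.hom_add[of "[k] \<cdot> \<one>" \<one>] h.hom_one by simp
  qed
  have "[n] \<cdot>\<^bsub>?S Quot ?I\<^esub> \<one>\<^bsub>?S Quot ?I\<^esub> \<noteq> ?I"
    using assms n unfolding char_zero_def nonunits_V by (simp add: FactRing_def)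
  then have "[n] \<cdot> \<one> \<notin> ?I"
    using h[of n] I.ring_axioms ring.a_rcos_zero[OF _ I.ideal_axioms, of "[n] \<cdot> \<one>"] by auto
  then have "le \<one> ([n] \<cdot> \<one>)" by (simp add: lt_def)
  then show "\<exists>v\<in>V. v \<otimes> ([n] \<cdot> \<one>) = \<one>" unfolding le_def by (auto simp: eq_commute)
qed

end

lemma carrier_ring_of [simp]: "carrier (ring_of L M) = univ M"
  by (simp add: ring_of_def Let_def)

lemma valued_ring_of:
  assumes "equichar0_valued_field L M"
  shows "valued (ring_of L M) (vring L M)"
proof -
  have *: "field (ring_of L M)" "valuation_subring_axioms (ring_of L M) (vring L M)"
    using assms by (auto simp: equichar0_valued_field_def valued_field_def valuation_subring_axioms_def)
  interpret valuation_subring "ring_of L M" "vring L M"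
    by (intro valuation_subring.intro *)
  show ?thesis
    by (rule valued_of_residue_char)
      (use assms in \<open>simp add: equichar0_valued_field_def residue_field_def vring_units_def\<close>)
qed

section \<open>Translation of the coset definitions into relations between elements\<close>

locale equichar0 =
  fixes L :: "('f, 'r) lang" and M :: "('f, 'r, 'a) struct"
  assumes equichar0: "equichar0_valued_field L M"
begin

sublocale valued "ring_of L M" "vring L M"
  by (rule valued_ring_of[OF equichar0])

lemma vabs_eq: "x \<in> univ M \<Longrightarrow> vabs L M x = {y \<in> univ M. le x y \<and> le y x}"
  unfolding vabs_def vring_units_def using value_class[of x] by simp

lemma vabs_eq_iff: "x \<in> univ M \<Longrightarrow> y \<in> univ M \<Longrightarrow> vabs L M x = vabs L M y \<longleftrightarrow> le x y \<and> le y x"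
  using value_class_eq_iff[of x y] by (simp add: vabs_eq)

lemma vle_vabs_iff:
  assumes "x \<in> univ M" "y \<in> univ M"
  shows "vle L M (vabs L M x) (vabs L M y) \<longleftrightarrow> le x y"
proof -
  have "vle L M (vabs L M x) (vabs L M y) \<longleftrightarrow> (\<exists>x'\<in>vabs L M x. \<exists>y'\<in>vabs L M y. le x' y')"
    by (simp add: vle_def le_def)
  also have "\<dots> \<longleftrightarrow> le x y"
  proof
    assume "\<exists>x'\<in>vabs L M x. \<exists>y'\<in>vabs L M y. le x' y'"
    then obtain x' y' where "x' \<in> univ M" "y' \<in> univ M" "le x x'" "le x' y'" "le y' y"
      using assms by (auto simp: vabs_eq)
    then show "le x y" using le_trans[of x x' y'] le_trans[of x y' y] assms by simp
  next
    assume "le x y"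
    moreover have "x \<in> vabs L M x" "y \<in> vabs L M y" using assms by (simp_all add: vabs_eq)
    ultimately show "\<exists>x'\<in>vabs L M x. \<exists>y'\<in>vabs L M y. le x' y'" by blast
  qed
  finally show ?thesis .
qed

lemma vless_vabs_iff:
  assumes "x \<in> univ M" "y \<in> univ M"
  shows "vless L M (vabs L M x) (vabs L M y) \<longleftrightarrow> lt x y"
  using vle_vabs_iff[OF assms] vabs_eq_iff[OF assms] le_total[of x y] assms
  by (auto simp: vless_def lt_def)

lemma rv_eq:
  assumes "x \<in> univ M" "l \<in> univ M" "l \<noteq> \<zero>\<^bsub>ring_of L M\<^esub>"
  shows "rv L M (vabs L M l) x = {y \<in> univ M. near l x y}"
proof -
  have "rv L M (vabs L M l) x = {x \<otimes>\<^bsub>ring_of L M\<^esub> (\<one>\<^bsub>ring_of L M\<^esub> \<oplus>\<^bsub>ring_of L M\<^esub> y) |y. y \<in> univ M \<and> lt y l}"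
    unfolding rv_def using assms(2) by (auto simp: vless_vabs_iff)
  then show ?thesis using near_set[of x l] assms by simp
qed

lemma rv_eq_iff:
  assumes "x \<in> univ M" "y \<in> univ M" "l \<in> vring L M" "l \<noteq> \<zero>\<^bsub>ring_of L M\<^esub>"
  shows "rv L M (vabs L M l) x = rv L M (vabs L M l) y \<longleftrightarrow> near l x y"
proof -
  have l: "l \<in> univ M" using V_carrier assms by simp
  have "{z \<in> univ M. near l x z} = {z \<in> univ M. near l y z} \<longleftrightarrow> near l x y"
  proof
    assume "{z \<in> univ M. near l x z} = {z \<in> univ M. near l y z}"
    then have "near l x y" if "near l y y" using assms(2) that by blast
    then show "near l x y" by simp
  next
    assume "near l x y"
    then show "{z \<in> univ M. near l x z} = {z \<in> univ M. near l y z}"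
      using near_trans[of l x y] near_trans[of l y x] near_sym[of l x y] assms by auto
  qed
  then show ?thesis using assms l by (simp add: rv_eq)
qed

text \<open>Elements of the value group are represented by nonzero field elements, and multiplying
  by the nonzero \<open>y - z\<close> removes the quotient.\<close>

lemma strictly_differentiable_iff:
  assumes f: "f ` univ M \<subseteq> univ M" and x: "x \<in> univ M"
  shows "strictly_differentiable L M f x \<longleftrightarrow>
    (\<exists>a\<in>univ M. \<forall>\<epsilon>\<in>univ M - {\<zero>\<^bsub>ring_of L M\<^esub>}. slope_approx f x \<epsilon> a)"
proof -
  let ?R = "ring_of L M"
  have fc: "f y \<in> univ M" if "y \<in> univ M" for y using f that by auto
  have VG: "value_group L M = vabs L M ` (univ M - {\<zero>\<^bsub>?R\<^esub>})" by (simp add: value_group_def)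
  have quot: "vless L M (vabs L M (((f y \<ominus>\<^bsub>?R\<^esub> f z) \<otimes>\<^bsub>?R\<^esub> inv\<^bsub>?R\<^esub> (y \<ominus>\<^bsub>?R\<^esub> z)) \<ominus>\<^bsub>?R\<^esub> a)) (vabs L M \<epsilon>) \<longleftrightarrow>
      lt ((f y \<ominus>\<^bsub>?R\<^esub> f z) \<ominus>\<^bsub>?R\<^esub> a \<otimes>\<^bsub>?R\<^esub> (y \<ominus>\<^bsub>?R\<^esub> z)) (\<epsilon> \<otimes>\<^bsub>?R\<^esub> (y \<ominus>\<^bsub>?R\<^esub> z))"
    if "y \<in> univ M" "z \<in> univ M" "y \<noteq> z" "a \<in> univ M" "\<epsilon> \<in> univ M" for y z a \<epsilon>
  proof -
    define d where "d = y \<ominus>\<^bsub>?R\<^esub> z"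
    define F where "F = f y \<ominus>\<^bsub>?R\<^esub> f z"
    have d: "d \<in> univ M" "d \<noteq> \<zero>\<^bsub>?R\<^esub>" using that minus_closed[of y z] by (auto simp: d_def)
    have F: "F \<in> univ M" using fc[OF that(1)] fc[OF that(2)] minus_closed by (simp add: F_def)
    define q where "q = F \<otimes>\<^bsub>?R\<^esub> inv\<^bsub>?R\<^esub> d"
    have q: "q \<in> univ M" using F d inv_closed[of d] m_closed by (simp add: q_def)
    have qd: "q \<otimes>\<^bsub>?R\<^esub> d = F" using F d by (simp add: q_def)
    have "(q \<ominus>\<^bsub>?R\<^esub> a) \<otimes>\<^bsub>?R\<^esub> d = F \<ominus>\<^bsub>?R\<^esub> a \<otimes>\<^bsub>?R\<^esub> d"
    proof -
      have "(q \<ominus>\<^bsub>?R\<^esub> a) \<otimes>\<^bsub>?R\<^esub> d = q \<otimes>\<^bsub>?R\<^esub> d \<ominus>\<^bsub>?R\<^esub> a \<otimes>\<^bsub>?R\<^esub> d"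
        using minus_distr[of q a d] q d that by simp
      then show ?thesis by (simp add: qd)
    qed
    moreover have "q \<ominus>\<^bsub>?R\<^esub> a \<in> univ M" using minus_closed[of q a] q that by simp
    ultimately show ?thesis
      using lt_mult_right_iff[of "q \<ominus>\<^bsub>?R\<^esub> a" \<epsilon> d] d that
      unfolding d_def[symmetric] F_def[symmetric] q_def[symmetric] by (simp add: vless_vabs_iff)
  qed
  have dist: "vless L M (vabs L M (x \<ominus>\<^bsub>?R\<^esub> y)) (vabs L M \<delta>) \<longleftrightarrow> lt (x \<ominus>\<^bsub>?R\<^esub> y) \<delta>"
    if "y \<in> univ M" "\<delta> \<in> univ M" for y \<delta>
    using vless_vabs_iff[of "x \<ominus>\<^bsub>?R\<^esub> y" \<delta>] minus_closed[of x y] x that by simp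
  have iff: "(\<forall>y1\<in>univ M. \<forall>y2\<in>univ M.
        y1 \<noteq> y2 \<and> vless L M (vabs L M (x \<ominus>\<^bsub>?R\<^esub> y1)) (vabs L M \<delta>) \<and> vless L M (vabs L M (x \<ominus>\<^bsub>?R\<^esub> y2)) (vabs L M \<delta>) \<longrightarrow>
        vless L M (vabs L M (((f y1 \<ominus>\<^bsub>?R\<^esub> f y2) \<otimes>\<^bsub>?R\<^esub> inv\<^bsub>?R\<^esub> (y1 \<ominus>\<^bsub>?R\<^esub> y2)) \<ominus>\<^bsub>?R\<^esub> a)) (vabs L M \<epsilon>))
     \<longleftrightarrow> (\<forall>y\<in>univ M. \<forall>z\<in>univ M. y \<noteq> z \<longrightarrow> lt (x \<ominus>\<^bsub>?R\<^esub> y) \<delta> \<longrightarrow> lt (x \<ominus>\<^bsub>?R\<^esub> z) \<delta> \<longrightarrow>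
     lt ((f y \<ominus>\<^bsub>?R\<^esub> f z) \<ominus>\<^bsub>?R\<^esub> a \<otimes>\<^bsub>?R\<^esub> (y \<ominus>\<^bsub>?R\<^esub> z)) (\<epsilon> \<otimes>\<^bsub>?R\<^esub> (y \<ominus>\<^bsub>?R\<^esub> z)))"
    if "a \<in> univ M" "\<epsilon> \<in> univ M" "\<delta> \<in> univ M" for a \<epsilon> \<delta>
    using quot dist that by (intro ball_cong refl) auto
  have slope: "slope_approx f x \<epsilon> a \<longleftrightarrow> (\<exists>\<delta>\<in>univ M - {\<zero>\<^bsub>?R\<^esub>}. \<forall>y\<in>univ M. \<forall>z\<in>univ M.
     y \<noteq> z \<longrightarrow> lt (x \<ominus>\<^bsub>?R\<^esub> y) \<delta> \<longrightarrow> lt (x \<ominus>\<^bsub>?R\<^esub> z) \<delta> \<longrightarrow>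
     lt ((f y \<ominus>\<^bsub>?R\<^esub> f z) \<ominus>\<^bsub>?R\<^esub> a \<otimes>\<^bsub>?R\<^esub> (y \<ominus>\<^bsub>?R\<^esub> z)) (\<epsilon> \<otimes>\<^bsub>?R\<^esub> (y \<ominus>\<^bsub>?R\<^esub> z)))" for \<epsilon> a
    unfolding slope_approx_def carrier_ring_of by blast
  show ?thesis
    unfolding strictly_differentiable_def Let_def VG ball_simps(9) bex_simps(7) slope
    by (intro bex_cong ball_cong refl iff) simp_all
qed

end

section \<open>The leading-term sort and its defining formula\<close>

lemma add_ring_of: "x \<oplus>\<^bsub>ring_of L M\<^esub> y = fint M (plus_sym L) [x, y]"
  and mult_ring_of: "x \<otimes>\<^bsub>ring_of L M\<^esub> y = fint M (times_sym L) [x, y]"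
  by (simp_all add: ring_of_def Let_def)

definition fm_or :: "('f, 'r) fm \<Rightarrow> ('f, 'r) fm \<Rightarrow> ('f, 'r) fm" where
  "fm_or p q = Neg (And (Neg p) (Neg q))"

text \<open>The bound variable \<open>k\<close> holds the multiplier and has to be fresh for both
  terms.\<close>

definition fm_le :: "('f, 'r) lang \<Rightarrow> 'f tm \<Rightarrow> 'f tm \<Rightarrow> nat \<Rightarrow> ('f, 'r) fm" where
  "fm_le L s t k = Ex k (And (Rel (vring_sym L) [Var k]) (Eq s (Fun (times_sym L) [Var k, t])))"

text \<open>The variables 0, 1 hold one pair \<open>(x, l)\<close> and 2, 3 the other. As there is
  no symbol for zero, nonzero is expressed by \<open>l + l \<noteq> l\<close>; subtraction is
  replaced by a quantified difference, variable 4.\<close>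

definition fm_rv :: "('f, 'r) lang \<Rightarrow> ('f, 'r) fm" where
  "fm_rv L =
     And (Rel (vring_sym L) [Var 1])
     (And (Neg (Eq (Fun (plus_sym L) [Var 1, Var 1]) (Var 1)))
     (And (Neg (Eq (Fun (plus_sym L) [Var 3, Var 3]) (Var 3)))
     (And (fm_le L (Var 1) (Var 3) 4)
     (And (fm_le L (Var 3) (Var 1) 4)
     (fm_or (Eq (Var 0) (Var 2))
       (Ex 4 (And (Eq (Var 0) (Fun (plus_sym L) [Var 2, Var 4]))
         (Neg (fm_le L (Fun (times_sym L) [Var 1, Var 0]) (Var 4) 5)))))))))"

lemma sat_fm_or [simp]: "sat M e (fm_or p q) \<longleftrightarrow> sat M e p \<or> sat M e q"
  by (simp add: fm_or_def)

lemma wf_fm_rv: "vf_language L \<Longrightarrow> wf_fm L (fm_rv L)"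
  by (simp add: fm_rv_def fm_or_def fm_le_def vf_language_def)

lemma vars_fm_rv: "fm_vars (fm_rv L) = {0, 1, 2, 3}"
  by (auto simp: fm_rv_def fm_or_def fm_le_def)

locale vf_structure = equichar0 L M
  for L :: "('f, 'r) lang" and M :: "('f, 'r, 'a) struct" +
  assumes lang: "vf_language L" and M_structure: "is_structure L M"
begin

text \<open>In a finite universe, \<open>avoid\<close> would produce a point at distance at least 1
  from itself.\<close>

lemma infinite_univ: "infinite (univ M)"
proof
  assume fin: "finite (univ M)"
  obtain y where "y \<in> univ M" "\<And>c. c \<in> univ M \<Longrightarrow> le \<one>\<^bsub>ring_of L M\<^esub> (y \<ominus>\<^bsub>ring_of L M\<^esub> c)"
    using avoid[of "univ M" "\<one>\<^bsub>ring_of L M\<^esub>" "\<one>\<^bsub>ring_of L M\<^esub>"] fin one_closed one_not_zero by auto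
  then have "le \<one>\<^bsub>ring_of L M\<^esub> (y \<ominus>\<^bsub>ring_of L M\<^esub> y)" by blast
  then show False using \<open>y \<in> univ M\<close> one_not_zero one_closed by simp
qed

lemma vring_iff: "x \<in> vring L M \<longleftrightarrow> x \<in> univ M \<and> rint M (vring_sym L) [x]"
  by (simp add: vring_def)

lemma sat_fm_le:
  assumes "k \<notin> tm_vars s" "k \<notin> tm_vars t"
  shows "sat M e (fm_le L s t k) \<longleftrightarrow> le (eval M e s) (eval M e t)"
proof -
  have "eval M (e(k := a)) s = eval M e s" "eval M (e(k := a)) t = eval M e t" for a
    using assms by (auto intro!: eval_cong)
  then show ?thesis by (auto simp: fm_le_def le_def mult_ring_of vring_iff)
qed

lemma add_self_iff: "x \<in> univ M \<Longrightarrow> x \<oplus>\<^bsub>ring_of L M\<^esub> x = x \<longleftrightarrow> x = \<zero>\<^bsub>ring_of L M\<^esub>"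
  using add.l_cancel_one[of x x] by simp

text \<open>One parameter-free sort for all radii: each pair carries an \<open>l\<close>, so the
  radius need not be named by a parameter. Its classes are the codes \<open>rv_imag\<close>, see
  \<open>rv_sort_class\<close>.\<close>

definition rv_sort :: "'a eqsort" where
  "rv_sort = {([x, l], [x', l']) | x l x' l'. x \<in> univ M \<and> x' \<in> univ M \<and>
     l \<in> vring L M - {\<zero>\<^bsub>ring_of L M\<^esub>} \<and> l' \<in> vring L M - {\<zero>\<^bsub>ring_of L M\<^esub>} \<and>
     le l l' \<and> le l' l \<and> near l x x'}"

lemma sat_fm_rv:
  assumes e: "e 0 \<in> univ M" "e 1 \<in> univ M" "e 2 \<in> univ M" "e 3 \<in> univ M"
  shows "sat M e (fm_rv L) \<longleftrightarrow> ([e 0, e 1], [e 2, e 3]) \<in> rv_sort"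
proof -
  let ?R = "ring_of L M"
  have "(\<exists>a\<in>univ M. e 0 = e 2 \<oplus>\<^bsub>?R\<^esub> a \<and> \<not> le (e 1 \<otimes>\<^bsub>?R\<^esub> e 0) a) \<longleftrightarrow>
    lt (e 0 \<ominus>\<^bsub>?R\<^esub> e 2) (e 1 \<otimes>\<^bsub>?R\<^esub> e 0)"
  proof -
    have "e 0 = e 2 \<oplus>\<^bsub>?R\<^esub> a \<longleftrightarrow> a = e 0 \<ominus>\<^bsub>?R\<^esub> e 2" if "a \<in> univ M" for a
    proof -
      have "x = y \<oplus>\<^bsub>?R\<^esub> z \<Longrightarrow> z = x \<ominus>\<^bsub>?R\<^esub> y" "z = x \<ominus>\<^bsub>?R\<^esub> y \<Longrightarrow> x = y \<oplus>\<^bsub>?R\<^esub> z"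
        if "x \<in> carrier ?R" "y \<in> carrier ?R" "z \<in> carrier ?R" for x y z
        using that by algebra+
      then show ?thesis using e that by auto
    qed
    moreover have "e 0 \<ominus>\<^bsub>?R\<^esub> e 2 \<in> univ M" using minus_closed[of "e 0" "e 2"] e by simp
    ultimately show ?thesis by (auto simp: lt_def)
  qed
  moreover have "l \<in> vring L M" if "l' \<in> vring L M" "le l l'" "l \<in> univ M" for l l'
    using that V_mult unfolding le_def by auto
  ultimately show ?thesis
    unfolding fm_rv_def rv_sort_def using e
    by (auto simp: sat_fm_le vring_iff add_ring_of[symmetric] mult_ring_of[symmetric] add_self_iff near_def)
qed

lemma rv_sort_class:
  assumes "x \<in> univ M" "l \<in> vring L M" "l \<noteq> \<zero>\<^bsub>ring_of L M\<^esub>"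
  shows "rv_sort `` {[x, l]} = rv_imag (vabs L M l) (rv L M (vabs L M l) x)"
proof -
  have l: "l \<in> univ M" using assms by (simp add: vring_iff)
  have "l' \<in> vring L M - {\<zero>\<^bsub>ring_of L M\<^esub>}" if "l' \<in> univ M" "le l l'" "le l' l" for l'
    using that assms V_mult l unfolding le_def[of l' l] by auto
  moreover have "l' \<in> univ M" if "l' \<in> vring L M" for l' using that by (simp add: vring_iff)
  ultimately show ?thesis
    using assms l unfolding rv_sort_def rv_imag_def rv_eq[OF assms(1) l assms(3)]
    unfolding vabs_eq[OF l] by auto
qed

lemma Domain_rv_sort: "Domain rv_sort = {[x, l] | x l. x \<in> univ M \<and> l \<in> vring L M - {\<zero>\<^bsub>ring_of L M\<^esub>}}"
proof (intro Set.set_eqI iffI)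
  fix z assume "z \<in> {[x, l] | x l. x \<in> univ M \<and> l \<in> vring L M - {\<zero>\<^bsub>ring_of L M\<^esub>}}"
  then obtain x l where "z = [x, l]" "x \<in> univ M" "l \<in> vring L M" "l \<noteq> \<zero>\<^bsub>ring_of L M\<^esub>" by blast
  moreover from this have "le l l" by (simp add: vring_iff)
  ultimately have "(z, z) \<in> rv_sort" by (auto simp: rv_sort_def)
  then show "z \<in> Domain rv_sort" by blast
qed (auto simp: rv_sort_def)

text \<open>Nearness and equality of values are equalities of cosets, and the coset for
  \<open>l\<close> depends only on the value of \<open>l\<close>. Symmetry and transitivity are
  inherited from equality.\<close>

lemma rv_sort_equiv: "equiv (Domain rv_sort) rv_sort"
proof -
  have cl: "z \<in> Domain rv_sort \<and> w \<in> Domain rv_sort" if "(z, w) \<in> rv_sort" for z w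
    using that unfolding Domain_rv_sort by (auto simp: rv_sort_def)
  have sym: "(w, z) \<in> rv_sort" if zw: "(z, w) \<in> rv_sort" for z w
  proof -
    obtain x l x' l' where *: "z = [x, l]" "w = [x', l']" "x \<in> univ M" "x' \<in> univ M"
      "l \<in> vring L M" "l \<noteq> \<zero>\<^bsub>ring_of L M\<^esub>" "l' \<in> vring L M" "l' \<noteq> \<zero>\<^bsub>ring_of L M\<^esub>"
      "le l l'" "le l' l" "near l x x'" using zw by (auto simp: rv_sort_def)
    have c: "l \<in> univ M" "l' \<in> univ M" using * by (auto simp: vring_iff)
    have "vabs L M l = vabs L M l'" using vabs_eq_iff c * by blast
    then have "near l' x' x"
      using rv_eq_iff[of x x' l] rv_eq_iff[of x' x l'] * by auto
    then show ?thesis using * by (auto simp: rv_sort_def)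
  qed
  have trans: "(z, v) \<in> rv_sort" if zw: "(z, w) \<in> rv_sort" "(w, v) \<in> rv_sort" for z w v
  proof -
    obtain x l x' l' x'' l'' where *: "z = [x, l]" "w = [x', l']" "v = [x'', l'']"
      "x \<in> univ M" "x' \<in> univ M" "x'' \<in> univ M"
      "l \<in> vring L M" "l \<noteq> \<zero>\<^bsub>ring_of L M\<^esub>" "l' \<in> vring L M" "l' \<noteq> \<zero>\<^bsub>ring_of L M\<^esub>"
      "l'' \<in> vring L M" "l'' \<noteq> \<zero>\<^bsub>ring_of L M\<^esub>"
      "le l l'" "le l' l" "near l x x'" "le l' l''" "le l'' l'" "near l' x' x''"
      using zw by (auto simp: rv_sort_def)
    have c: "l \<in> univ M" "l' \<in> univ M" "l'' \<in> univ M" using * by (auto simp: vring_iff)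
    have "vabs L M l = vabs L M l'" "vabs L M l' = vabs L M l''" using vabs_eq_iff c * by blast+
    then have "near l x x''" "le l l''" "le l'' l"
      using rv_eq_iff[of x x' l] rv_eq_iff[of x' x'' l'] rv_eq_iff[of x x'' l] vabs_eq_iff[of l l''] * c
      by auto
    then show ?thesis using * by (auto simp: rv_sort_def)
  qed
  show ?thesis
  proof (rule equivI)
    show "refl_on (Domain rv_sort) rv_sort"
      using cl sym trans by (intro refl_onI) (meson Domain.cases)+
    show "sym rv_sort" using sym by (rule symI)
    show "trans rv_sort" using trans by (rule transI)
  qed (use cl in auto)
qed

lemma rv_sort_eqsort: "is_eqsort L M rv_sort"
  unfolding is_eqsort_def
proof (intro exI[of _ 2] conjI rv_sort_equiv)
  show "rv_sort \<subseteq> tuples M 2 \<times> tuples M 2"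
    by (auto simp: rv_sort_def tuples_def vring_iff)
  have "{xs @ ys | xs ys. (xs, ys) \<in> rv_sort} =
    {zs \<in> tuples M (2 * 2). sat M (\<lambda>i. if i < 2 * 2 then zs ! i else undefined) (fm_rv L)}" (is "?A = ?B")
  proof (intro Set.set_eqI iffI)
    fix zs assume "zs \<in> ?A"
    then obtain x l x' l' where zs: "zs = [x, l, x', l']" "([x, l], [x', l']) \<in> rv_sort"
      unfolding rv_sort_def by auto
    then have "x \<in> univ M" "l \<in> univ M" "x' \<in> univ M" "l' \<in> univ M"
      by (auto simp: rv_sort_def vring_iff)
    then show "zs \<in> ?B" using zs by (simp add: tuples_def sat_fm_rv)
  next
    fix zs assume zs: "zs \<in> ?B"
    then have "length zs = 4" by (simp add: tuples_def)
    then obtain x l x' l' where *: "zs = [x, l, x', l']"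
      by (auto simp: numeral_eq_Suc length_Suc_conv)
    then have "x \<in> univ M" "l \<in> univ M" "x' \<in> univ M" "l' \<in> univ M"
      using zs by (simp_all add: tuples_def)
    then have "([x, l], [x', l']) \<in> rv_sort" using zs * by (simp add: sat_fm_rv)
    then show "zs \<in> ?A"
      unfolding * by (intro CollectI exI[of _ "[x, l]"] exI[of _ "[x', l']"]) simp
  qed
  then show "definable L M {} (2 * 2) {xs @ ys | xs ys. (xs, ys) \<in> rv_sort}"
    unfolding definable_def using wf_fm_rv[OF lang] vars_fm_rv[of L]
    by (intro exI[of _ "fm_rv L"] exI[of _ "\<lambda>_. undefined"]) auto
qed

lemma pdefinable_atoms:
  "pdefinable L M (\<lambda>e. e i = e k)"
  "c \<in> univ M \<Longrightarrow> pdefinable L M (\<lambda>e. e i = c)"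
  "pdefinable L M (\<lambda>e. e i = e k \<oplus>\<^bsub>ring_of L M\<^esub> e m)"
  "pdefinable L M (\<lambda>e. e i = e k \<otimes>\<^bsub>ring_of L M\<^esub> e m)"
  "pdefinable L M (\<lambda>e. e i \<in> vring L M)"
proof -
  have z: "range (\<lambda>_. \<zero>\<^bsub>ring_of L M\<^esub>) \<subseteq> univ M" using zero_closed by auto
  show "pdefinable L M (\<lambda>e. e i = e k)"
    by (rule pdefinableI[of L "Eq (Var (2 * i)) (Var (2 * k))", OF _ z]) simp_all
  show "pdefinable L M (\<lambda>e. e i = c)" if "c \<in> univ M"
    by (rule pdefinableI[of L "Eq (Var (2 * i)) (Var (Suc 0))" "\<lambda>_. c"]) (use that in simp_all)
  show "pdefinable L M (\<lambda>e. e i = e k \<oplus>\<^bsub>ring_of L M\<^esub> e m)"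
    by (rule pdefinableI[of L "Eq (Var (2 * i)) (Fun (plus_sym L) [Var (2 * k), Var (2 * m)])", OF _ z])
      (use lang in \<open>simp_all add: vf_language_def add_ring_of\<close>)
  show "pdefinable L M (\<lambda>e. e i = e k \<otimes>\<^bsub>ring_of L M\<^esub> e m)"
    by (rule pdefinableI[of L "Eq (Var (2 * i)) (Fun (times_sym L) [Var (2 * k), Var (2 * m)])", OF _ z])
      (use lang in \<open>simp_all add: vf_language_def mult_ring_of\<close>)
  show "pdefinable L M (\<lambda>e. e i \<in> vring L M)"
    by (rule pdefinableI[of L "Rel (vring_sym L) [Var (2 * i)]", OF _ z])
      (use lang in \<open>auto simp: vf_language_def vring_iff\<close>)
qed

end

section \<open>Uniform preparation\<close>

context valuation_subring begin

lemma minus_add_cancel: "x \<in> carrier R \<Longrightarrow> y \<in> carrier R \<Longrightarrow> x \<ominus> y \<oplus> y = x"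
  by algebra

lemma add_minus_cancel: "x \<in> carrier R \<Longrightarrow> y \<in> carrier R \<Longrightarrow> x \<oplus> y \<ominus> y = x"
  by algebra

end

text \<open>An imaginary element is accessible only through the pairs projecting to it, so both
  coordinates are quantified. The variables 0, 2, 4 are the first three environment slots of the
  interleaved layout.\<close>

lemma (in vf_structure) eq_definable_rv_fibre:
  assumes p: "wf_fm L p" and e: "\<And>n. e n \<in> A"
    and b: "b \<in> univ M" and l: "l \<in> vring L M" "l \<noteq> \<zero>\<^bsub>ring_of L M\<^esub>"
    and B: "rv_imag (vabs L M l) (rv L M (vabs L M l) b) \<in> B"
  shows "eq_definable L M A B {x \<in> univ M. \<exists>b'\<in>univ M. \<exists>l'\<in>univ M.
    near l b b' \<and> le l l' \<and> le l' l \<and> sat M (e(0 := x, 2 := b', 4 := l')) p}"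
proof -
  have lc: "l \<in> univ M" using l by (simp add: vring_iff)
  \<comment> \<open>Only one imaginary variable occurs in the formula, so a constant assignment
    suffices.\<close>
  define g where "g = (\<lambda>_ :: 'a eqsort \<times> nat. rv_imag (vabs L M l) (rv L M (vabs L M l) b))"
  have g: "g k = rv_sort `` {[b, l]}" for k using rv_sort_class[OF b l] by (simp add: g_def)
  have bl: "[b, l] \<in> Domain rv_sort" using b l by (simp add: Domain_rv_sort)
  have im: "g k \<in> imaginaries rv_sort" for k
    unfolding g imaginaries_def by (rule quotientI[OF bl])
  have *: "[b', l'] \<in> Domain rv_sort \<and> rv_sort `` {[b', l']} = g k \<longleftrightarrow> near l b b' \<and> le l l' \<and> le l' l"
    if "b' \<in> univ M" "l' \<in> univ M" for b' l' k
  proof -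
    have "[b', l'] \<in> Domain rv_sort \<and> rv_sort `` {[b', l']} = g k \<longleftrightarrow> ([b, l], [b', l']) \<in> rv_sort"
      unfolding g using equiv_class_eq_iff[OF rv_sort_equiv, of "[b, l]" "[b', l']"] bl by auto
    also have "\<dots> \<longleftrightarrow> near l b b' \<and> le l l' \<and> le l' l"
    proof -
      have "l' \<in> vring L M - {\<zero>\<^bsub>ring_of L M\<^esub>}" if "le l l'" "le l' l"
        using that l lc V_mult \<open>l' \<in> univ M\<close> unfolding le_def[of l' l] by auto
      then show ?thesis using that b l by (auto simp: rv_sort_def)
    qed
    finally show ?thesis .
  qed
  show ?thesis
    unfolding eq_definable_def
  proof (intro exI[of _ "QEx 2 (QEx 4 (QAnd (Proj rv_sort [Var 2, Var 4] 0) (Home p)))"] exI[of _ e] exI[of _ g] conjI)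
    show "{x \<in> univ M. \<exists>b'\<in>univ M. \<exists>l'\<in>univ M. near l b b' \<and> le l l' \<and> le l' l \<and> sat M (e(0 := x, 2 := b', 4 := l')) p} =
      {x \<in> univ M. eqsat M (e(0 := x)) g (QEx 2 (QEx 4 (QAnd (Proj rv_sort [Var 2, Var 4] 0) (Home p))))}"
      by (simp add: * conj_assoc cong: bex_cong)
  qed (use p e B im rv_sort_eqsort in \<open>auto simp: g_def\<close>)
qed

section \<open>Ultrapowers of valued fields\<close>

locale vf_ultrapower = ultrapower L K U j + base: vf_structure L K
  for L :: "('f, 'r) lang" and K :: "('f, 'r, 'a) struct"
    and U :: "'i filter" and j :: "('i \<Rightarrow> 'a) \<Rightarrow> 'u" +
  assumes equichar0_power: "equichar0_valued_field L power"
begin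

sublocale pow: vf_structure L power
  by unfold_locales (use equichar0_power base.lang power_structure in auto)

lemma add_power:
  "s \<in> seqs \<Longrightarrow> t \<in> seqs \<Longrightarrow> cls s \<oplus>\<^bsub>ring_of L power\<^esub> cls t = cls (\<lambda>i. s i \<oplus>\<^bsub>ring_of L K\<^esub> t i)"
  using fint_power[of "[s, t]"] by (simp add: add_ring_of)

lemma mult_power:
  "s \<in> seqs \<Longrightarrow> t \<in> seqs \<Longrightarrow> cls s \<otimes>\<^bsub>ring_of L power\<^esub> cls t = cls (\<lambda>i. s i \<otimes>\<^bsub>ring_of L K\<^esub> t i)"
  using fint_power[of "[s, t]"] by (simp add: mult_ring_of)

lemma vring_power: "s \<in> seqs \<Longrightarrow> cls s \<in> vring L power \<longleftrightarrow> (\<forall>\<^sub>F i in U. s i \<in> vring L K)"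
  using rint_power[of "[s]"] seqsD[of s] by (simp add: pow.vring_iff base.vring_iff cls_univ)

lemma mult_seqs: "s \<in> seqs \<Longrightarrow> t \<in> seqs \<Longrightarrow> (\<lambda>i. s i \<otimes>\<^bsub>ring_of L K\<^esub> t i) \<in> seqs"
  using base.m_closed by (intro seqsI) (auto dest: seqsD)

lemma minus_seqs: "s \<in> seqs \<Longrightarrow> t \<in> seqs \<Longrightarrow> (\<lambda>i. s i \<ominus>\<^bsub>ring_of L K\<^esub> t i) \<in> seqs"
  using base.minus_closed by (intro seqsI) (auto dest: seqsD)

lemma zero_seqs: "(\<lambda>_. \<zero>\<^bsub>ring_of L K\<^esub>) \<in> seqs"
  using base.zero_closed by (intro seqsI) auto

lemma zero_power: "\<zero>\<^bsub>ring_of L power\<^esub> = cls (\<lambda>_. \<zero>\<^bsub>ring_of L K\<^esub>)"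
proof -
  have "cls (\<lambda>_. \<zero>\<^bsub>ring_of L K\<^esub>) \<oplus>\<^bsub>ring_of L power\<^esub> cls (\<lambda>_. \<zero>\<^bsub>ring_of L K\<^esub>) = cls (\<lambda>_. \<zero>\<^bsub>ring_of L K\<^esub>)"
    using zero_seqs base.zero_closed by (simp add: add_power)
  then show ?thesis using pow.add_self_iff cls_univ[OF zero_seqs] by simp
qed

lemma minus_power:
  assumes "s \<in> seqs" "t \<in> seqs"
  shows "cls s \<ominus>\<^bsub>ring_of L power\<^esub> cls t = cls (\<lambda>i. s i \<ominus>\<^bsub>ring_of L K\<^esub> t i)"
proof -
  let ?d = "\<lambda>i. s i \<ominus>\<^bsub>ring_of L K\<^esub> t i"
  have "cls ?d \<oplus>\<^bsub>ring_of L power\<^esub> cls t = cls s"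
    using assms minus_seqs[OF assms] by (simp add: add_power seqsD base.minus_add_cancel)
  then show ?thesis
    using cls_univ[OF minus_seqs[OF assms]] cls_univ[OF assms(2)] pow.add_minus_cancel
    by (metis carrier_ring_of)
qed

lemma le_power:
  assumes s: "s \<in> seqs" and t: "t \<in> seqs"
  shows "pow.le (cls s) (cls t) \<longleftrightarrow> (\<forall>\<^sub>F i in U. base.le (s i) (t i))"
proof
  assume "pow.le (cls s) (cls t)"
  then obtain c where c: "c \<in> vring L power" "cls s = c \<otimes>\<^bsub>ring_of L power\<^esub> cls t"
    unfolding pow.le_def by blast
  then obtain r where r: "r \<in> seqs" "c = cls r" by (auto simp: pow.vring_iff univ_power)
  have "\<forall>\<^sub>F i in U. r i \<in> vring L K" using c(1) r by (simp add: vring_power)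
  moreover have "\<forall>\<^sub>F i in U. s i = r i \<otimes>\<^bsub>ring_of L K\<^esub> t i"
    using c(2) r s t mult_seqs by (simp add: mult_power cls_eq_iff)
  ultimately show "\<forall>\<^sub>F i in U. base.le (s i) (t i)"
    by eventually_elim (auto simp: base.le_def)
next
  assume ev: "\<forall>\<^sub>F i in U. base.le (s i) (t i)"
  \<comment> \<open>Multipliers are chosen at every index; where the comparison fails, zero serves
    as a default in the valuation ring.\<close>
  have "\<forall>i. \<exists>c. c \<in> vring L K \<and> (base.le (s i) (t i) \<longrightarrow> s i = c \<otimes>\<^bsub>ring_of L K\<^esub> t i)"
    unfolding base.le_def using base.zero_V by blast
  then obtain r where r: "\<And>i. r i \<in> vring L K"
    "\<And>i. base.le (s i) (t i) \<Longrightarrow> s i = r i \<otimes>\<^bsub>ring_of L K\<^esub> t i" by metis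
  have rs: "r \<in> seqs" using r(1) by (intro seqsI) (simp add: base.vring_iff)
  have "\<forall>\<^sub>F i in U. s i = r i \<otimes>\<^bsub>ring_of L K\<^esub> t i" using ev by (rule eventually_mono) (rule r(2))
  then have "cls s = cls r \<otimes>\<^bsub>ring_of L power\<^esub> cls t"
    using rs s t mult_seqs by (simp add: mult_power cls_eq_iff)
  moreover have "cls r \<in> vring L power" using rs r(1) by (simp add: vring_power)
  ultimately show "pow.le (cls s) (cls t)" unfolding pow.le_def by blast
qed

lemma near_power:
  assumes "l \<in> seqs" "s \<in> seqs" "t \<in> seqs"
  shows "pow.near (cls l) (cls s) (cls t) \<longleftrightarrow> (\<forall>\<^sub>F i in U. base.near (l i) (s i) (t i))"
  using assms
  by (simp add: pow.near_def base.near_def pow.lt_def base.lt_def ultrafilter_or[OF U] ultrafilter_not[OF U]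
      cls_eq_iff minus_power mult_power le_power minus_seqs mult_seqs)

text \<open>The same formula and parameters define a set \<open>S\<close> in \<open>K\<close> that
  embeds into \<open>C\<close> diagonally, so \<open>S\<close> is finite. A sequence that is
  eventually in a finite set is eventually constant along an ultrafilter, hence \<open>C\<close> has
  no further elements.\<close>

lemma finite_definable_constant:
  assumes fin: "finite C" and C: "definable L power ((\<lambda>c. cls (\<lambda>_. c)) ` univ K) 1 ((\<lambda>c. [c]) ` C)"
  shows "\<exists>S. finite S \<and> S \<subseteq> univ K \<and> C = (\<lambda>c. cls (\<lambda>_. c)) ` S"
proof -
  obtain p e where p: "wf_fm L p" "\<forall>i\<in>fm_vars p. 1 \<le> i \<longrightarrow> e i \<in> (\<lambda>c. cls (\<lambda>_. c)) ` univ K"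
    and eq: "(\<lambda>c. [c]) ` C = {xs \<in> tuples power 1. sat power (\<lambda>i. if i < 1 then xs ! i else e i) p}"
    using C unfolding definable_def by blast
  have const: "(\<lambda>_. c) \<in> seqs" if "c \<in> univ K" for c using that by (intro seqsI)
  have "\<forall>i. \<exists>c. c \<in> univ K \<and> (i \<in> fm_vars p \<longrightarrow> 1 \<le> i \<longrightarrow> e i = cls (\<lambda>_. c))"
  proof
    fix i
    show "\<exists>c. c \<in> univ K \<and> (i \<in> fm_vars p \<longrightarrow> 1 \<le> i \<longrightarrow> e i = cls (\<lambda>_. c))"
    proof (cases "i \<in> fm_vars p \<and> 1 \<le> i")
      case True
      then show ?thesis using p(2) by blast
    next
      case False
      then show ?thesis using base.zero_closed by auto
    qed
  qed
  then obtain d where d: "\<And>i. d i \<in> univ K" "\<And>i. i \<in> fm_vars p \<Longrightarrow> 1 \<le> i \<Longrightarrow> e i = cls (\<lambda>_. d i)" by metis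
  define S where "S = {a \<in> univ K. sat K (\<lambda>i. if i < 1 then a else d i) p}"
  have inC: "cls s \<in> C \<longleftrightarrow> (\<forall>\<^sub>F i in U. s i \<in> S)" if s: "s \<in> seqs" for s
  proof -
    have "cls s \<in> C \<longleftrightarrow> [cls s] \<in> (\<lambda>c. [c]) ` C" by auto
    also have "\<dots> \<longleftrightarrow> sat power (\<lambda>i. if i < 1 then [cls s] ! i else e i) p"
      unfolding eq using cls_univ[OF s] by (simp add: tuples_def)
    also have "\<dots> \<longleftrightarrow> sat power (\<lambda>n. cls (if n < 1 then s else (\<lambda>_. d n))) p"
      by (rule sat_cong) (use d(2) in auto)
    also have "\<dots> \<longleftrightarrow> (\<forall>\<^sub>F i in U. sat K (\<lambda>n. (if n < 1 then s else (\<lambda>_. d n)) i) p)"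
      by (rule sat_power) (use s const d(1) p(1) in auto)
    also have "\<dots> \<longleftrightarrow> (\<forall>\<^sub>F i in U. s i \<in> S)"
      using seqsD[OF s] by (simp add: S_def if_distrib[of "\<lambda>f. f _"] cong: if_cong)
    finally show ?thesis .
  qed
  have S: "S \<subseteq> univ K" by (auto simp: S_def)
  have inj: "inj_on (\<lambda>c. cls (\<lambda>_. c)) S"
  proof (rule inj_onI)
    fix a b assume ab: "a \<in> S" "b \<in> S" "cls (\<lambda>_. a) = cls (\<lambda>_. b)"
    then have "\<forall>\<^sub>F i in U. a = b" using cls_eq_iff const S by blast
    then show "a = b" using U by (auto simp: ultrafilter_def eventually_const_iff)
  qed
  have sub: "(\<lambda>c. cls (\<lambda>_. c)) ` S \<subseteq> C"
    using inC const S by (auto simp: subset_iff)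
  have finS: "finite S"
    using finite_imageD[OF finite_subset[OF sub fin] inj] .
  have "C \<subseteq> (\<lambda>c. cls (\<lambda>_. c)) ` S"
  proof
    fix z assume z: "z \<in> C"
    then have "[z] \<in> tuples power 1" using eq by auto
    then have "z \<in> univ power" by (simp add: tuples_def)
    then obtain s where s: "s \<in> seqs" "z = cls s" by (auto simp: univ_power)
    then have "\<forall>\<^sub>F i in U. s i \<in> S" using inC z by blast
    then obtain a where "a \<in> S" "\<forall>\<^sub>F i in U. s i = a" using ultrafilter_finite[OF U finS] by blast
    then show "z \<in> (\<lambda>c. cls (\<lambda>_. c)) ` S" using cls_eqI[of s "\<lambda>_. a"] s by auto
  qed
  then show ?thesis using sub S finS by blast
qed

end

text \<open>Compactness by means of an ultrapower: counterexamples to all finite candidates are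
  assembled into one fibre over a single leading term, to which minimality applies.\<close>

theorem (in vf_structure) uniform_prepare:
  assumes h_min: "h_minimal TYPE('u) L 1 (Th L M)"
    and large: "\<exists>h :: ('b + 'a) set \<Rightarrow> 'u. inj h"
    and \<phi>: "pdefinable L M (\<lambda>e. \<phi> (e 0) (e (Suc 0)))"
  shows "\<exists>C. finite C \<and> C \<subseteq> univ M \<and>
    (\<forall>l\<in>vring L M - {\<zero>\<^bsub>ring_of L M\<^esub>}. \<forall>b\<in>univ M. \<forall>x\<in>univ M. \<forall>y\<in>univ M.
      (\<forall>c\<in>C. near l (x \<ominus>\<^bsub>ring_of L M\<^esub> c) (y \<ominus>\<^bsub>ring_of L M\<^esub> c)) \<longrightarrow>
      (\<exists>b'\<in>univ M. near l b b' \<and> \<phi> x b') \<longrightarrow> (\<exists>b'\<in>univ M. near l b b' \<and> \<phi> y b'))"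
proof (rule ccontr)
  assume contra: "\<not> ?thesis"
  define bad where "bad C l b x y \<longleftrightarrow> l \<in> vring L M \<and> l \<noteq> \<zero>\<^bsub>ring_of L M\<^esub> \<and> b \<in> univ M \<and> x \<in> univ M \<and> y \<in> univ M \<and>
      (\<forall>c\<in>C. near l (x \<ominus>\<^bsub>ring_of L M\<^esub> c) (y \<ominus>\<^bsub>ring_of L M\<^esub> c)) \<and>
      (\<exists>b'\<in>univ M. near l b b' \<and> \<phi> x b') \<and> \<not> (\<exists>b'\<in>univ M. near l b b' \<and> \<phi> y b')" for C l b x y
  \<comment> \<open>Index lists range over the whole type, so they are cut down to the
    universe.\<close>
  have ex_bad: "\<exists>l b x y. bad (set i \<inter> univ M) l b x y" for i
  proof (rule ccontr)
    assume none: "\<not> ?thesis"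
    show False
    proof (rule notE[OF contra], intro exI[of _ "set i \<inter> univ M"] conjI ballI impI)
      fix l b x y
      assume "l \<in> vring L M - {\<zero>\<^bsub>ring_of L M\<^esub>}" "b \<in> univ M" "x \<in> univ M" "y \<in> univ M"
        "\<forall>c\<in>set i \<inter> univ M. near l (x \<ominus>\<^bsub>ring_of L M\<^esub> c) (y \<ominus>\<^bsub>ring_of L M\<^esub> c)"
        "\<exists>b'\<in>univ M. near l b b' \<and> \<phi> x b'"
      moreover have "\<not> bad (set i \<inter> univ M) l b x y" using none by blast
      ultimately show "\<exists>b'\<in>univ M. near l b b' \<and> \<phi> y b'" unfolding bad_def by blast
    qed auto
  qed
  have "infinite (UNIV :: 'a set)" using infinite_univ finite_subset[OF subset_UNIV] by blast
  then obtain j :: "('a list \<Rightarrow> 'a) \<Rightarrow> 'u" where j: "inj j" using inj_sequences large by blast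
  obtain U :: "'a list filter" where U: "ultrafilter U" and mem: "\<And>c. \<forall>\<^sub>F i in U. c \<in> set i"
    using ex_list_ultrafilter by blast
  interpret ultrapower L M U j
    by unfold_locales (use M_structure U j in auto)
  \<comment> \<open>As the ultrapower is a model of the theory inside \<open>'u\<close>, minimality
    yields both its valued field structure and the preparation property.\<close>
  note hm = h_min[unfolded h_minimal_def, rule_format, OF power_model]
  interpret vf_ultrapower L M U j
    by unfold_locales (use hm in blast)
  obtain l b x y where bad: "\<And>i. bad (set i \<inter> univ M) (l i) (b i) (x i) (y i)"
    using ex_bad by metis
  have seqs: "l \<in> seqs" "b \<in> seqs" "x \<in> seqs" "y \<in> seqs"
    using bad by (auto simp: bad_def vring_iff intro!: seqsI)
  have lV: "cls l \<in> vring L power" using seqs bad by (simp add: vring_power bad_def)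
  have l0: "cls l \<noteq> \<zero>\<^bsub>ring_of L power\<^esub>"
  proof
    assume "cls l = \<zero>\<^bsub>ring_of L power\<^esub>"
    then have "\<forall>\<^sub>F i in U. l i = \<zero>\<^bsub>ring_of L M\<^esub>" using seqs zero_seqs by (simp add: zero_power cls_eq_iff)
    then have "\<forall>\<^sub>F i in U. False" by (rule eventually_mono) (use bad in \<open>simp add: bad_def\<close>)
    then show False using U by (simp add: ultrafilter_def eventually_False)
  qed
  obtain p q where p: "wf_fm L p" and q: "range q \<subseteq> univ M"
    and sat: "\<And>e. range e \<subseteq> univ M \<Longrightarrow> \<phi> (e 0) (e (Suc 0)) \<longleftrightarrow> sat M (interleave e q) p"
    using \<phi> unfolding pdefinable_def by blast
  define diag where "diag = (\<lambda>c. cls (\<lambda>_. c))"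
  define A where "A = diag ` univ M"
  \<comment> \<open>The odd variables carry the parameters of \<open>p\<close>, embedded diagonally;
    the even ones are filled with zero, and 0, 2, 4 are overwritten where \<open>p\<close> is
    evaluated.\<close>
  define e where "e n = diag (interleave (\<lambda>_. \<zero>\<^bsub>ring_of L M\<^esub>) q n)" for n
  have const: "(\<lambda>_. c) \<in> seqs" if "c \<in> univ M" for c using that by (intro seqsI)
  have zq: "interleave (\<lambda>_. \<zero>\<^bsub>ring_of L M\<^esub>) q n \<in> univ M" for n
    using zero_closed q by (auto simp: interleave_def)
  have eA: "e n \<in> A" for n using zq by (simp add: e_def A_def)
  have \<phi>_power: "sat power (e(0 := cls s, 2 := cls t, 4 := cls r)) p \<longleftrightarrow> (\<forall>\<^sub>F i in U. \<phi> (s i) (t i))"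
    if str: "s \<in> seqs" "t \<in> seqs" "r \<in> seqs" for s t r
  proof -
    define E where "E = (\<lambda>n. (\<lambda>_. interleave (\<lambda>_. \<zero>\<^bsub>ring_of L M\<^esub>) q n))(0 := s, 2 := t, 4 := r)"
    have E: "E n \<in> seqs" for n using str const[OF zq] by (simp add: E_def)
    have "e(0 := cls s, 2 := cls t, 4 := cls r) = (\<lambda>n. cls (E n))"
      by (simp add: E_def e_def diag_def fun_eq_iff)
    then have 1: "sat power (e(0 := cls s, 2 := cls t, 4 := cls r)) p \<longleftrightarrow> (\<forall>\<^sub>F i in U. sat M (\<lambda>n. E n i) p)"
      using sat_power[OF E p] by simp
    have 2: "sat M (\<lambda>n. E n i) p \<longleftrightarrow> \<phi> (s i) (t i)" for i
    proof -
      define v where "v = (\<lambda>_. \<zero>\<^bsub>ring_of L M\<^esub>)(0 := s i, Suc 0 := t i, 2 := r i)"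
      have "E n i = interleave v q n" for n
      proof (cases n rule: interleave_cases)
        case (1 k)
        then show ?thesis by (cases "k = 0"; cases "k = 1"; cases "k = 2") (auto simp: E_def v_def interleave_def)
      next
        case (2 k)
        have "Suc (2 * k) \<noteq> 2" "Suc (2 * k) \<noteq> 4" by presburger+
        then show ?thesis using 2 by (simp add: E_def)
      qed
      moreover have "range v \<subseteq> univ M" using str seqsD zero_closed by (auto simp: v_def)
      ultimately show ?thesis using sat[of v] by (simp add: v_def)
    qed
    show ?thesis unfolding 1 2 ..
  qed
  define X where "X = {x \<in> univ power. \<exists>b'\<in>univ power. \<exists>l'\<in>univ power.
    pow.near (cls l) (cls b) b' \<and> pow.le (cls l) l' \<and> pow.le l' (cls l) \<and> sat power (e(0 := x, 2 := b', 4 := l')) p}"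
  have X_iff: "cls s \<in> X \<longleftrightarrow> (\<exists>t\<in>seqs. \<forall>\<^sub>F i in U. near (l i) (b i) (t i) \<and> \<phi> (s i) (t i))" if s: "s \<in> seqs" for s
  proof
    assume "cls s \<in> X"
    then obtain t r where tr: "t \<in> seqs" "r \<in> seqs" "pow.near (cls l) (cls b) (cls t)"
      "sat power (e(0 := cls s, 2 := cls t, 4 := cls r)) p" by (auto simp: X_def univ_power)
    then have "\<forall>\<^sub>F i in U. near (l i) (b i) (t i) \<and> \<phi> (s i) (t i)"
      using s seqs by (simp add: near_power \<phi>_power eventually_conj_iff)
    then show "\<exists>t\<in>seqs. \<forall>\<^sub>F i in U. near (l i) (b i) (t i) \<and> \<phi> (s i) (t i)" using tr by blast
  next
    assume "\<exists>t\<in>seqs. \<forall>\<^sub>F i in U. near (l i) (b i) (t i) \<and> \<phi> (s i) (t i)"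
    then obtain t where t: "t \<in> seqs" "\<forall>\<^sub>F i in U. near (l i) (b i) (t i)" "\<forall>\<^sub>F i in U. \<phi> (s i) (t i)"
      by (auto simp: eventually_conj_iff)
    have "pow.le (cls l) (cls l)" using cls_univ[OF seqs(1)] by simp
    moreover have "pow.near (cls l) (cls b) (cls t)" using t seqs by (simp add: near_power)
    moreover have "sat power (e(0 := cls s, 2 := cls t, 4 := cls l)) p" using \<phi>_power s t seqs by blast
    ultimately show "cls s \<in> X" unfolding X_def using cls_univ s t(1) seqs by blast
  qed
  define \<rho> where "\<rho> = vabs L power (cls l)"
  define \<xi> where "\<xi> = rv L power \<rho> (cls b)"
  have \<rho>: "\<rho> \<in> value_group L power"
    unfolding \<rho>_def value_group_def using cls_univ[OF seqs(1)] l0 by blast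
  have "\<exists>C. definable L power A 1 ((\<lambda>c. [c]) ` C) \<and> prepares L power \<rho> C X"
  proof -
    have "vle L power \<rho> (vone L power)"
      unfolding \<rho>_def vone_def using pow.vle_vabs_iff[of "cls l" "\<one>\<^bsub>ring_of L power\<^esub>"] pow.V_iff lV pow.one_closed
      by simp
    moreover have "A \<subseteq> univ power" using cls_univ const by (auto simp: A_def diag_def)
    moreover have "{\<xi>} \<subseteq> RV L power \<rho>" using cls_univ[OF seqs(2)] by (simp add: RV_def \<xi>_def)
    \<comment> \<open>The one leading term \<open>\<xi>\<close> is exactly the extra parameter that
      1-h-minimality allows.\<close>
    moreover have "card_le {\<xi>} 1" by (simp add: card_le_def one_enat_def)
    moreover have "eq_definable L power A
      (rv_imag (vone L power) ` RV L power (vone L power) \<union> rv_imag \<rho> ` {\<xi>}) X"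
      unfolding X_def
      by (rule pow.eq_definable_rv_fibre[OF p eA cls_univ[OF seqs(2)] lV l0]) (simp add: \<rho>_def \<xi>_def)
    ultimately show ?thesis
      by (intro hm[THEN conjunct2, rule_format, OF \<rho>, of A "{\<xi>}" X] conjI)
  qed
  then obtain C where C: "definable L power A 1 ((\<lambda>c. [c]) ` C)" and prep: "prepares L power \<rho> C X" by blast
  have "finite C" using prep by (simp add: prepares_def)
  then obtain S where S: "finite S" "S \<subseteq> univ M" "C = diag ` S"
    using finite_definable_constant[of C] C unfolding A_def diag_def by blast
  \<comment> \<open>Each element of \<open>C\<close> comes from some \<open>a\<close> in
    \<open>M\<close>, which by \<open>mem\<close> eventually belongs to the index list; at such
    indices \<open>x i\<close> and \<open>y i\<close> have the same leading term with respect to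
    \<open>a\<close>.\<close>
  have "rv L power \<rho> (cls x \<ominus>\<^bsub>ring_of L power\<^esub> c) = rv L power \<rho> (cls y \<ominus>\<^bsub>ring_of L power\<^esub> c)" if "c \<in> C" for c
  proof -
    obtain a where a: "a \<in> S" "c = cls (\<lambda>_. a)" using \<open>c \<in> C\<close> S by (auto simp: diag_def)
    have aM: "a \<in> univ M" using a S by auto
    have "\<forall>\<^sub>F i in U. near (l i) (x i \<ominus>\<^bsub>ring_of L M\<^esub> a) (y i \<ominus>\<^bsub>ring_of L M\<^esub> a)"
      using mem[of a] by (rule eventually_mono) (use bad aM in \<open>simp add: bad_def\<close>)
    then have "pow.near (cls l) (cls x \<ominus>\<^bsub>ring_of L power\<^esub> c) (cls y \<ominus>\<^bsub>ring_of L power\<^esub> c)"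
      using seqs const[OF aM] a by (simp add: minus_power near_power minus_seqs)
    moreover have "cls x \<ominus>\<^bsub>ring_of L power\<^esub> c \<in> univ power" "cls y \<ominus>\<^bsub>ring_of L power\<^esub> c \<in> univ power"
      using seqs const[OF aM] a by (simp_all add: minus_power cls_univ minus_seqs)
    ultimately show ?thesis using pow.rv_eq_iff lV l0 by (simp add: \<rho>_def)
  qed
  then have xy: "cls x \<in> X \<longleftrightarrow> cls y \<in> X"
    using prep cls_univ seqs unfolding prepares_def by blast
  \<comment> \<open>Witnesses at every index put \<open>cls x\<close> into the fibre. Then
    \<open>cls y\<close> belongs to it too, which is impossible because \<open>y i\<close> has no
    witness at any index.\<close>
  have "\<forall>i. \<exists>b'. b' \<in> univ M \<and> near (l i) (b i) b' \<and> \<phi> (x i) b'" using bad unfolding bad_def by blast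
  then obtain t where "\<And>i. t i \<in> univ M" "\<And>i. near (l i) (b i) (t i) \<and> \<phi> (x i) (t i)" by metis
  then have "cls x \<in> X"
    by (intro iffD2[OF X_iff[OF seqs(3)]] bexI[of _ t] always_eventually allI seqsI)
  then obtain t where t: "t \<in> seqs" "\<forall>\<^sub>F i in U. near (l i) (b i) (t i) \<and> \<phi> (y i) (t i)"
    using xy X_iff[OF seqs(4)] by blast
  have "\<forall>\<^sub>F i in U. False"
    using t(2) by (rule eventually_mono) (use bad seqsD[OF t(1)] in \<open>auto simp: bad_def\<close>)
  then show False using U by (simp add: ultrafilter_def eventually_False)
qed

theorem theorem3p1p4:
  fixes L :: "('f, 'r) lang"
    and K :: "('f, 'r, 'a) struct"
    and f :: "'a \<Rightarrow> 'a"
  assumes "vf_language L"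
    and "is_structure L K"
    and "equichar0_valued_field L K"
    and universe_large: "\<exists>h :: (('f, 'r) fm + 'a) set \<Rightarrow> 'u. inj h"
    and "h_minimal TYPE('u) L 1 (Th L K)"
    and "f ` univ K \<subseteq> univ K"
    and "definable L K (univ K) 2 {[x, f x] | x. x \<in> univ K}"
  shows "finite {x \<in> univ K. \<not> strictly_differentiable L K f x}"
proof -
  interpret vf_structure L K
    by unfold_locales (use assms in auto)
  interpret uniform_preparation "ring_of L K" "vring L K" "pdefinable L K"
  proof (unfold_locales, unfold carrier_ring_of)
    show "pdefinable L K Q" if "pdefinable L K P" "\<And>e. range e \<subseteq> univ K \<Longrightarrow> P e = Q e" for P Q
      using that by (rule pdefinable_cong)
    show "\<exists>C. finite C \<and> C \<subseteq> univ K \<and>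
        (\<forall>l\<in>vring L K - {\<zero>\<^bsub>ring_of L K\<^esub>}. \<forall>b\<in>univ K. \<forall>x\<in>univ K. \<forall>y\<in>univ K.
          (\<forall>c\<in>C. near l (x \<ominus>\<^bsub>ring_of L K\<^esub> c) (y \<ominus>\<^bsub>ring_of L K\<^esub> c)) \<longrightarrow>
          (\<exists>b'\<in>univ K. near l b b' \<and> \<phi> x b') \<longrightarrow> (\<exists>b'\<in>univ K. near l b b' \<and> \<phi> y b'))"
      if "pdefinable L K (\<lambda>e. \<phi> (e 0) (e (Suc 0)))" for \<phi>
      using uniform_prepare[OF assms(5) universe_large that] .
  qed (fact pdefinable_not pdefinable_and pdefinable_ex pdefinable_atoms pdefinable_rename)+
  have "univ K \<noteq> {}"
    using assms(2) by (simp add: is_structure_def)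
  then have "dfun f"
    using assms(6) pdefinable_graph[OF assms(7)] by (auto simp: dfun_def)
  from strict_derivative_cofinite[OF this] show ?thesis
    using strictly_differentiable_iff[OF assms(6)] by (simp cong: conj_cong)
qed

end
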